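(* Let $\alpha\in(0,1)$. Assume that the heat kernel satisfies, for a constant $C>0$, $$p_s(x,y)\simeq\frac{1}{\mu(B(x,\sqrt s))}e^{-Cd(x,y)^2/s}\qquad\text{for all }(x,y,s)\in\mathbb M\times\mathbb M\times(0,\infty).$$ Let $\mu$ satisfy $$\sup_{(x,r)\in\mathbb M\times(0,\infty)}\frac{\mu(B(x,r))}{r^{\beta}}<\infty ,$$ let $1<q<p<\infty$ and let $\nu\in\mathcal M_+(\mathbb M_+)$. Then the following two statements are equivalent: (i) The extension $e^{-t\mathcal L^\alpha}:L^p(\mathbb M)\to L^q(\mathbb M_+,\nu)$ is bounded. (ii) $$\int_0^\infty\left(\frac{\lambda^{p/q}}{\kappa(\nu;\lambda)}\right)^{q/(p-q)}\frac{d\lambda}{\lambda}<\infty .$$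
   Context: Setting: $(\mathbb M,d,\mu)$ is a metric measure space, i.e. $(\mathbb M,d)$ is a non-empty, locally compact, separable metric space and $\mu$ is a Borel measure on $\mathbb M$; $B(x,r)=\{y\in\mathbb M: d(x,y)<r\}$; $\mathbb M_+=\mathbb M\times(0,\infty)$, whose points are written $(t,x)$ with $t>0$, $x\in\mathbb M$. $\beta$ is a positive constant less than or equal to the Hausdorff dimension of $\mathbb M$. Heat kernel: a family $\{p_t\}_{t>0}$ of measurable functions on $\mathbb M\times\mathbb M$ such that for almost all $x,y\in\mathbb M$ and all $s,t>0$: (i) $p_t(x,y)\ge0$; (ii) $\int_{\mathbb M}p_t(x,y)\,d\mu(y)\le1$; (iii) $p_t(x,y)=p_t(y,x)$; (iv) $p_{s+t}(x,y)=\int_{\mathbb M}p_s(x,z)p_t(z,y)\,d\mu(z)$; (v) $\lim_{t\to0^+}\int_{\mathbb M}p_t(x,y)f(y)\,d\mu(y)=f(x)$ for all $f\in L^2(\mathbb M,\mu)$. It generates the semigroup $P_tf(x)=\int_{\mathbb M}p_t(x,y)f(y)\,d\mu(y)$ on $L^2(\mathbb M,\mu)$, with generator $\mathcal Lf=\lim_{t\to0}(f-P_tf)/t$ (limit in $L^2$), a self-adjoint, positive definite operator, so $P_t=e^{-t\mathcal L}$. Fractional heat semigroup: for $0<\alpha<1$, $e^{-t\mathcal L^\alpha}f(x)=\int_{\mathbb M}K^{\mathcal L}_{\alpha,t}(x,y)f(y)\,d\mu(y)$ with $K^{\mathcal L}_{\alpha,t}(x,y)=\int_0^\infty\eta^\alpha_t(s)p_s(x,y)\,ds$,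 where $\eta^\alpha_t$ is the non-negative continuous subordination density, satisfying $\eta^\alpha_t(s)=t^{-1/\alpha}\eta^\alpha_1(s/t^{1/\alpha})$; $\eta^\alpha_t(s)\lesssim t/s^{1+\alpha}$ for all $s,t>0$; $\int_0^\infty s^{-\gamma}\eta^\alpha_1(s)\,ds<\infty$ for $\gamma>0$; $\eta^\alpha_t(s)\simeq t/s^{1+\alpha}$ for $s\ge t^{1/\alpha}>0$. The extension maps $f$ on $\mathbb M$ to the function $(t,x)\mapsto e^{-t\mathcal L^\alpha}f(x)$ on $\mathbb M_+$. Capacity: for compact $K\subset\mathbb M_+$, $C^{(\alpha)}_p(K)=\inf\{\|f\|^p_{L^p(\mathbb M)}: f\ge0,\ e^{-t\mathcal L^\alpha}f(x)\ge1_K(t,x)\}$, where $1_K$ is the characteristic function of $K$. $\mathcal M_+(\mathbb M_+)$ is the class of all nonnegative Radon measures on $\mathbb M_+$, $L^q(\mathbb M_+,\nu)$ the Lebesgue space with respect to $\nu$, and for $\lambda>0$, $\kappa(\nu;\lambda)=\inf\{C^{(\alpha)}_p(K): K\subset\mathbb M_+\text{ compact},\ \nu(K)\ge\lambda\}$ (with $\inf\emptyset=+\infty$). $X\lesssim Y$ means $X\le cY$ with a constant $c>0$ independent of the main parameters; $X\simeq Y$ means $X\lesssim Y\lesssim X$. *)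

theory Defs
  imports "HOL-Analysis.Analysis"
begin

text \<open>A separable metric space is a type of class metric_space and second_countable_topology.
  Measures on it are Borel: their sigma-algebra is that of \<^const>\<open>borel\<close>.\<close>

subsection \<open>Hausdorff dimension\<close>

text \<open>Covers consist of bounded sets, since \<^const>\<open>diameter\<close> is only meaningful there.\<close>

definition hausdorff_premeasure :: "real \<Rightarrow> real \<Rightarrow> 'a::metric_space set \<Rightarrow> ennreal" where
  "hausdorff_premeasure s \<delta> A =
     (INF U \<in> {U :: nat \<Rightarrow> 'a set. A \<subseteq> (\<Union>i. U i) \<and> (\<forall>i. bounded (U i) \<and> diameter (U i) \<le> \<delta>)}.
        (\<Sum>i. ennreal (diameter (U i) powr s)))"

definition hausdorff_measure :: "real \<Rightarrow> 'a::metric_space set \<Rightarrow> ennreal" where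
  "hausdorff_measure s A = (SUP \<delta> \<in> {0<..}. hausdorff_premeasure s \<delta> A)"

text \<open>Only exponents \<open>s > 0\<close> are used, so the convention for \<open>diam\<^sup>0\<close> does not matter.
  The dimension may be infinite.\<close>

definition hausdorff_dim :: "'a::metric_space set \<Rightarrow> ennreal" where
  "hausdorff_dim A = (INF s \<in> {s. 0 < s \<and> hausdorff_measure s A = 0}. ennreal s)"

subsection \<open>Lebesgue spaces\<close>

definition Lp_space :: "real \<Rightarrow> 'b measure \<Rightarrow> ('b \<Rightarrow> real) set" where
  "Lp_space p M = {f \<in> borel_measurable M. integrable M (\<lambda>x. \<bar>f x\<bar> powr p)}"

definition Lp_norm :: "real \<Rightarrow> 'b measure \<Rightarrow> ('b \<Rightarrow> real) \<Rightarrow> real" where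
  "Lp_norm p M f = (\<integral>x. \<bar>f x\<bar> powr p \<partial>M) powr (1 / p)"

subsection \<open>Heat kernels\<close>

text \<open>The kernel is taken Borel measurable jointly in \<open>(t, x, y)\<close>: the subordination integral over
  \<open>t\<close> and the measurability of the extension with respect to an arbitrary (possibly singular)
  measure on the upper half space need this. In the last clause the exceptional null set
  necessarily depends on \<open>f\<close>.\<close>

definition heat_kernel ::
  "'a::{metric_space,second_countable_topology} measure \<Rightarrow> (real \<Rightarrow> 'a \<Rightarrow> 'a \<Rightarrow> real) \<Rightarrow> bool" where
  "heat_kernel \<mu> p \<longleftrightarrow>
     (\<lambda>(t, x, y). p t x y) \<in> borel_measurable (restrict_space borel ({0<..} \<times> UNIV)) \<and>
     (AE (x, y) in \<mu> \<Otimes>\<^sub>M \<mu>. \<forall>t>0. 0 \<le> p t x y) \<and>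
     (AE x in \<mu>. \<forall>t>0. (\<integral>\<^sup>+y. ennreal (p t x y) \<partial>\<mu>) \<le> 1) \<and>
     (AE (x, y) in \<mu> \<Otimes>\<^sub>M \<mu>. \<forall>t>0. p t x y = p t y x) \<and>
     (AE (x, y) in \<mu> \<Otimes>\<^sub>M \<mu>. \<forall>s>0. \<forall>t>0.
        ennreal (p (s + t) x y) = (\<integral>\<^sup>+z. ennreal (p s x z) * ennreal (p t z y) \<partial>\<mu>)) \<and>
     (\<forall>f \<in> Lp_space 2 \<mu>. AE x in \<mu>.
        ((\<lambda>t. \<integral>y. p t x y * f y \<partial>\<mu>) \<longlongrightarrow> f x) (at_right 0))"

text \<open>Two-sided Gaussian bounds, stated in \<^typ>\<open>ennreal\<close>, where division by zero gives infinity;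
  so the lower bound forces every ball to have positive measure.\<close>

definition gaussian_bounds ::
  "'a::metric_space measure \<Rightarrow> real \<Rightarrow> (real \<Rightarrow> 'a \<Rightarrow> 'a \<Rightarrow> real) \<Rightarrow> bool" where
  "gaussian_bounds \<mu> C p \<longleftrightarrow> (\<exists>c1>0. \<exists>c2>0. \<forall>x y. \<forall>s>0.
     ennreal c1 * (ennreal (exp (- C * (dist x y)\<^sup>2 / s)) / emeasure \<mu> (ball x (sqrt s)))
       \<le> ennreal (p s x y) \<and>
     ennreal (p s x y)
       \<le> ennreal c2 * (ennreal (exp (- C * (dist x y)\<^sup>2 / s)) / emeasure \<mu> (ball x (sqrt s))))"

subsection \<open>The fractional heat semigroup\<close>

text \<open>\<open>\<eta> t s\<close> is the density at \<open>s > 0\<close> of the \<open>\<alpha>\<close>-stable subordinator at time \<open>t\<close>. The first four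
  clauses (in particular the Laplace transform, which expresses
  \<open>exp (- t u\<^sup>\<alpha>) = \<integral> \<eta> t s exp (- s u) ds\<close>) determine it on \<open>s > 0\<close>; the remaining clauses are its
  standard scaling, decay and moment properties.\<close>

definition subordination_density :: "real \<Rightarrow> (real \<Rightarrow> real \<Rightarrow> real) \<Rightarrow> bool" where
  "subordination_density \<alpha> \<eta> \<longleftrightarrow>
     (\<forall>t>0. \<forall>s>0. 0 \<le> \<eta> t s) \<and>
     (\<forall>t>0. continuous_on {0<..} (\<eta> t)) \<and>
     (\<forall>t>0. (\<integral>\<^sup>+s\<in>{0<..}. ennreal (\<eta> t s) \<partial>lborel) = 1) \<and>
     (\<forall>t>0. \<forall>u>0. (\<integral>\<^sup>+s\<in>{0<..}. ennreal (exp (- s * u) * \<eta> t s) \<partial>lborel)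
        = ennreal (exp (- t * u powr \<alpha>))) \<and>
     (\<forall>t>0. \<forall>s>0. \<eta> t s = t powr (- 1 / \<alpha>) * \<eta> 1 (s / t powr (1 / \<alpha>))) \<and>
     (\<exists>c>0. \<forall>t>0. \<forall>s>0. \<eta> t s \<le> c * (t / s powr (1 + \<alpha>))) \<and>
     (\<forall>\<gamma>>0. (\<integral>\<^sup>+s\<in>{0<..}. ennreal (s powr (- \<gamma>) * \<eta> 1 s) \<partial>lborel) < \<infinity>) \<and>
     (\<exists>c>0. \<forall>t>0. \<forall>s \<ge> t powr (1 / \<alpha>). c * (t / s powr (1 + \<alpha>)) \<le> \<eta> t s)"

definition frac_kernel ::
  "(real \<Rightarrow> real \<Rightarrow> real) \<Rightarrow> (real \<Rightarrow> 'a \<Rightarrow> 'a \<Rightarrow> real) \<Rightarrow> real \<Rightarrow> 'a \<Rightarrow> 'a \<Rightarrow> real" where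
  "frac_kernel \<eta> p t x y = (LBINT s:{0<..}. \<eta> t s * p s x y)"

text \<open>The function \<open>(t, x) \<mapsto> exp (- t L\<^sup>\<alpha>) f x\<close> on the upper half space.\<close>

definition frac_extension ::
  "'a measure \<Rightarrow> (real \<Rightarrow> real \<Rightarrow> real) \<Rightarrow> (real \<Rightarrow> 'a \<Rightarrow> 'a \<Rightarrow> real) \<Rightarrow>
     ('a \<Rightarrow> real) \<Rightarrow> real \<times> 'a \<Rightarrow> real" where
  "frac_extension \<mu> \<eta> p f = (\<lambda>(t, x). \<integral>y. frac_kernel \<eta> p t x y * f y \<partial>\<mu>)"

subsection \<open>Upper half space, Radon measures and capacity\<close>

definition upper_half :: "(real \<times> 'a) set" where
  "upper_half = {0<..} \<times> UNIV"

definition radon_measure_on :: "'b::t2_space set \<Rightarrow> 'b measure \<Rightarrow> bool" where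
  "radon_measure_on S \<nu> \<longleftrightarrow>
     space \<nu> = S \<and>
     sets \<nu> = sets (restrict_space borel S) \<and>
     (\<forall>K. compact K \<and> K \<subseteq> S \<longrightarrow> emeasure \<nu> K < \<infinity>) \<and>
     (\<forall>A \<in> sets \<nu>. emeasure \<nu> A = (SUP K \<in> {K. compact K \<and> K \<subseteq> A}. emeasure \<nu> K))"

definition capacity ::
  "'a measure \<Rightarrow> (real \<Rightarrow> real \<Rightarrow> real) \<Rightarrow> (real \<Rightarrow> 'a \<Rightarrow> 'a \<Rightarrow> real) \<Rightarrow> real \<Rightarrow>
     (real \<times> 'a) set \<Rightarrow> ennreal" where
  "capacity \<mu> \<eta> p r K =
     (INF f \<in> {f \<in> Lp_space r \<mu>. (\<forall>x. 0 \<le> f x) \<and>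
                 (\<forall>z \<in> upper_half. indicator K z \<le> frac_extension \<mu> \<eta> p f z)}.
        ennreal (Lp_norm r \<mu> f powr r))"

definition capacity_profile ::
  "'a::metric_space measure \<Rightarrow> (real \<Rightarrow> real \<Rightarrow> real) \<Rightarrow> (real \<Rightarrow> 'a \<Rightarrow> 'a \<Rightarrow> real) \<Rightarrow> real \<Rightarrow>
     (real \<times> 'a) measure \<Rightarrow> real \<Rightarrow> ennreal" where
  "capacity_profile \<mu> \<eta> p r \<nu> l =
     (INF K \<in> {K. compact K \<and> K \<subseteq> upper_half \<and> ennreal l \<le> emeasure \<nu> K}. capacity \<mu> \<eta> p r K)"

definition bounded_extension ::
  "'a measure \<Rightarrow> (real \<Rightarrow> real \<Rightarrow> real) \<Rightarrow> (real \<Rightarrow> 'a \<Rightarrow> 'a \<Rightarrow> real) \<Rightarrow> real \<Rightarrow> real \<Rightarrow>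
     (real \<times> 'a) measure \<Rightarrow> bool" where
  "bounded_extension \<mu> \<eta> p r q \<nu> \<longleftrightarrow>
     (\<exists>c. \<forall>f \<in> Lp_space r \<mu>. frac_extension \<mu> \<eta> p f \<in> Lp_space q \<nu> \<and>
        Lp_norm q \<nu> (frac_extension \<mu> \<eta> p f) \<le> c * Lp_norm r \<mu> f)"

text \<open>Real powers, for exponents \<open>a > 0\<close>.\<close>

definition ennreal_powr :: "ennreal \<Rightarrow> real \<Rightarrow> ennreal" where
  "ennreal_powr x a = (if x = \<infinity> then \<infinity> else ennreal (enn2real x powr a))"

end

theory Submission
  imports Defs
begin

text \<open>
  Write \<open>T f (t, x)\<close> for the extension and \<open>r = t\<^sup>1\<^sup>/\<^sup>2\<^sup>\<alpha>\<close>.  The whole argument rests on the fact that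
  the kernel of \<open>T\<close> at \<open>(t, x)\<close> behaves like an average at scale \<open>r\<close> around \<open>x\<close>:

  \<^item> (upper bound) if every average of \<open>f \<ge> 0\<close> over a ball \<open>B(x, R)\<close> with \<open>R \<ge> r\<close> is at most \<open>S\<close>,
    then \<open>T f (t, x) \<le> c\<^sub>0 S\<close>;
  \<^item> (lower bound) the kernel is at least \<open>c\<^sub>3 / \<mu>(B(x, r))\<close> on \<open>B(x, r)\<close>.

  Both follow from the Gaussian bounds by integrating against the subordination density, once
  volumes of balls at different scales can be compared.  That comparison, the doubling property, is
  itself forced by the two-sided Gaussian bound: evaluate \<open>p\<^sub>2\<^sub>s(x, y) = \<integral> p\<^sub>s(x, z) p\<^sub>s(z, y) dz\<close> from
  below on \<open>B(x, \<surd>s)\<close> and from above by the Gaussian bound.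

  The two kernel bounds give the capacitary strong type inequality
  \<open>\<Sum>\<^sub>j 2\<^sup>j\<^sup>p C(K\<^sub>j) \<le> B \<parallel>f\<parallel>\<^sub>p\<^sup>p\<close> for compact \<open>K\<^sub>j \<subseteq> {T f \<ge> 2\<^sup>j}\<close> (\<open>capacity_strong_type\<close>).  Indeed, if
  \<open>T f (t, x) \<ge> l\<close>, then by the upper bound some ball \<open>B(x, R)\<close> with \<open>R \<ge> r\<close> carries an average of
  \<open>f\<close> above \<open>l / (2 c\<^sub>0)\<close>; so \<open>B(x, r)\<close> lies in the set \<open>U\<close> where the uncentred maximal function of
  \<open>f\<close> exceeds \<open>l / (2 c\<^sub>0)\<close>, and by the lower bound \<open>1\<^sub>U / c\<^sub>3\<close> has extension at least \<open>1\<close> at \<open>(t, x)\<close>.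
  Hence \<open>C({T f \<ge> l}) \<le> c\<^sub>3\<^sup>-\<^sup>p \<mu>(U)\<close>, and the dyadic sum of \<open>\<mu>(U)\<close> is controlled by the
  Hardy-Littlewood maximal theorem (\<open>high_average_strong_type\<close>).

  If the integral of the profile is finite, cut \<open>T f\<close> into the dyadic shells \<open>F\<^sub>j\<close>, approximate them
  from inside by compact sets \<open>L\<^sub>j\<close> and compare \<open>2\<^sup>j\<^sup>q \<nu>(L\<^sub>j)\<close> with the capacity of
  \<open>K\<^sub>j = L\<^sub>j \<union> L\<^sub>j\<^sub>+\<^sub>1 \<union> \<dots>\<close> by Young's inequality.  The capacities are summed by the strong type
  inequality; the remaining terms are dominated by the integral of the profile over the disjoint
  intervals just below \<open>\<nu>(K\<^sub>j)\<close> (\<open>bounded_if_integral_finite\<close>).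

  Conversely, if the extension is bounded, glue nearly optimal functions \<open>f\<^sub>j\<close> for \<open>\<kappa>(2\<^sup>j)\<close> with
  weights \<open>w\<^sub>j = (2\<^sup>j / \<kappa>(2\<^sup>j))\<^sup>1\<^sup>/\<^sup>(\<^sup>p\<^sup>-\<^sup>q\<^sup>)\<close> into \<open>g\<close>.  Then \<open>\<parallel>g\<parallel>\<^sub>p\<^sup>p\<close> and the lower bound for
  \<open>\<parallel>T g\<parallel>\<^sub>q\<^sup>q\<close> are the same dyadic sum \<open>S\<close> up to constants, so boundedness reads
  \<open>S \<le> D S\<^sup>q\<^sup>/\<^sup>p\<close>.  Since \<open>q < p\<close>, this bounds \<open>S\<close>, which is a dyadic version of the integral
  (\<open>integral_finite_if_bounded\<close>).
\<close>

section \<open>Dyadic sums and Gaussian decay\<close>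

text \<open>A finite subsum of a geometric series is comparable to its largest term, even when the indices
  have gaps: after removing the largest index, all other terms are at most \<open>2\<^sup>-\<^sup>\<theta>\<close> times the largest.\<close>

lemma dyadic_sum_le_largest:
  fixes \<theta> Y :: real and J :: "int set"
  assumes "finite J" and \<theta>: "0 < \<theta>" and "0 \<le> Y" and "\<And>j. j \<in> J \<Longrightarrow> 2 powr (\<theta> * j) \<le> Y"
  shows "(\<Sum>j\<in>J. 2 powr (\<theta> * j)) \<le> Y / (1 - 2 powr - \<theta>)"
  using assms(1,3,4)
proof (induction J arbitrary: Y rule: finite_linorder_max_induct)
  case empty
  have "2 powr - \<theta> < 2 powr 0" using \<theta> by (intro powr_less_mono) auto
  then show ?case using empty by simp
next
  case (insert m J)
  define g where "g = 2 powr - \<theta>"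
  have g: "0 < g" "g < 1"
    using powr_less_mono[of "-\<theta>" 0 "2::real"] \<theta> by (auto simp: g_def)
  define Z where "Z = 2 powr (\<theta> * m)"
  have "2 powr (\<theta> * j) \<le> g * Z" if "j \<in> J" for j
  proof -
    have "j \<le> m - 1" using insert.hyps(2) that by fastforce
    then have "real_of_int j \<le> real_of_int m - 1" by linarith
    then have "\<theta> * j \<le> - \<theta> + \<theta> * m"
      using \<theta> mult_left_mono[of "real_of_int j" "real_of_int m - 1" \<theta>] by (simp add: algebra_simps)
    then have "2 powr (\<theta> * j) \<le> 2 powr (- \<theta> + \<theta> * m)" by (intro powr_mono) auto
    then show ?thesis by (simp only: powr_add g_def Z_def)
  qed
  moreover have "0 \<le> g * Z" using g by (simp add: Z_def)
  ultimately have "(\<Sum>j\<in>J. 2 powr (\<theta> * j)) \<le> g * Z / (1 - g)"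
    unfolding g_def by (intro insert.IH) auto
  then have "(\<Sum>j\<in>insert m J. 2 powr (\<theta> * j)) \<le> Z + g * Z / (1 - g)"
    using insert.hyps by (subst sum.insert) (auto simp: Z_def)
  also have "\<dots> = Z / (1 - g)" using g by (simp add: field_simps)
  also have "\<dots> \<le> Y / (1 - g)"
    using insert.prems g by (intro divide_right_mono) (auto simp: Z_def)
  finally show ?case by (simp add: g_def)
qed

text \<open>A Gaussian decays faster than any power of \<open>u\<close>, hence is dominated by a step function that is
  constant on dyadic shells with values \<open>N M\<^sup>-\<^sup>k\<close>.  The ratio \<open>M\<close> will be chosen to beat the volume
  growth of the balls of radius \<open>2\<^sup>k\<close>.\<close>

lemma gaussian_below_geometric:
  fixes C M :: real
  assumes "0 < C" "0 < M"
  obtains N where "0 < N"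
    "\<And>u. 0 \<le> u \<Longrightarrow> \<exists>k::nat. u < 2 ^ k \<and> exp (- C * u\<^sup>2) \<le> N / M ^ k"
proof -
  \<comment> \<open>On the shell where \<open>u\<close> is about \<open>2\<^sup>k\<close>, the bound \<open>exp v \<ge> v\<^sup>m / m!\<close> gives decay \<open>4\<^sup>-\<^sup>m\<^sup>k\<close>.\<close>
  obtain m :: nat where m: "M < 4 ^ m" using real_arch_pow[of 4 M] by auto
  define N where "N = 1 + fact m * M / C ^ m"
  have N: "0 < N" using assms by (auto simp: N_def intro!: add_pos_nonneg)
  have "\<exists>k::nat. u < 2 ^ k \<and> exp (- C * u\<^sup>2) \<le> N / M ^ k" if u: "0 \<le> u" for u
  proof (cases "u < 1")
    case True
    have "exp (- C * u\<^sup>2) \<le> 1" using assms by simp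
    also have "1 \<le> N" using assms by (simp add: N_def)
    finally show ?thesis using True by (intro exI[of _ 0]) auto
  next
    case False
    obtain k0 :: nat where "u < 2 ^ k0" using real_arch_pow[of 2 u] by auto
    define k where "k = (LEAST k::nat. u < 2 ^ k)"
    have k: "u < 2 ^ k" unfolding k_def by (rule LeastI) fact
    with False have "k \<noteq> 0" by (metis power_0)
    then obtain i where i: "k = Suc i" by (cases k) auto
    have "\<not> u < 2 ^ i" using not_less_Least[of i "\<lambda>k. u < 2 ^ k"] i k_def by simp
    then have ui: "2 ^ i \<le> u" by simp
    have "(C * u\<^sup>2) ^ m / fact m \<le> exp (C * u\<^sup>2)"
    proof -
      have "(\<Sum>n\<in>{m}. (C * u\<^sup>2) ^ n /\<^sub>R fact n) \<le> (\<Sum>n. (C * u\<^sup>2) ^ n /\<^sub>R fact n)"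
        using assms by (intro sum_le_suminf summable_exp_generic) auto
      then show ?thesis by (simp add: exp_def divide_inverse mult.commute)
    qed
    moreover have "C ^ m * M ^ i \<le> (C * u\<^sup>2) ^ m"
    proof -
      have "M ^ i \<le> (4 ^ m) ^ i" using m assms by (intro power_mono) auto
      also have "\<dots> = ((2 ^ i)\<^sup>2) ^ m"
      proof -
        have "(4::real) = 2\<^sup>2" by simp
        then show ?thesis by (simp only: power_mult[symmetric]) (simp add: ac_simps)
      qed
      also have "\<dots> \<le> (u\<^sup>2) ^ m" using ui by (intro power_mono) auto
      finally show ?thesis using assms by (simp add: power_mult_distrib)
    qed
    ultimately have "C ^ m * M ^ i / fact m \<le> exp (C * u\<^sup>2)"
      by (meson divide_right_mono fact_ge_zero order_trans)
    then have "exp (- C * u\<^sup>2) \<le> 1 / (C ^ m * M ^ i / fact m)"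
      using assms by (simp add: exp_minus inverse_eq_divide field_simps)
    also have "\<dots> = (fact m * M / C ^ m) / M ^ k" using assms by (simp add: i)
    also have "\<dots> \<le> N / M ^ k" using assms by (intro divide_right_mono) (auto simp: N_def)
    finally show ?thesis using k by blast
  qed
  with N show ?thesis using that by blast
qed

section \<open>The Hardy-Littlewood maximal theorem in a doubling space\<close>

text \<open>Greedy selection: keep a ball of largest radius and discard every ball that meets it; those are
  contained in its threefold enlargement.\<close>

lemma finite_vitali:
  fixes I :: "('a::metric_space \<times> real) set"
  assumes "finite I" and "\<And>x r. (x, r) \<in> I \<Longrightarrow> 0 < r"
  shows "\<exists>J\<subseteq>I. disjoint_family_on (\<lambda>(x, r). ball x r) J \<and>
           (\<Union>(x, r)\<in>I. ball x r) \<subseteq> (\<Union>(x, r)\<in>J. ball x (3 * r))"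
  using assms
proof (induction "card I" arbitrary: I rule: less_induct)
  case less
  show ?case
  proof (cases "I = {}")
    case True
    then show ?thesis by (auto simp: disjoint_family_on_def)
  next
    case False
    have "Max (snd ` I) \<in> snd ` I" using less.prems False by (intro Max_in) auto
    then obtain x r where xr: "(x, r) \<in> I" "r = Max (snd ` I)" by auto
    have big: "s \<le> r" if "(y, s) \<in> I" for y s
      using that less.prems xr by (auto intro!: Max_ge rev_image_eqI)
    define I' where "I' = {(y, s) \<in> I. ball y s \<inter> ball x r = {}}"
    have r0: "0 < r" using less.prems(2) xr by auto
    have I': "I' \<subseteq> I" "(x, r) \<notin> I'" using r0 by (auto simp: I'_def)
    then have "I' \<subset> I" using xr by blast
    then have "card I' < card I" using less.prems by (intro psubset_card_mono)
    then obtain J where J: "J \<subseteq> I'" "disjoint_family_on (\<lambda>(x, r). ball x r) J"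
      "(\<Union>(x, r)\<in>I'. ball x r) \<subseteq> (\<Union>(x, r)\<in>J. ball x (3 * r))"
      using less.hyps[of I'] less.prems I' finite_subset by (metis (no_types, lifting) subsetD)
    have "disjoint_family_on (\<lambda>(x, r). ball x r) (insert (x, r) J)"
      using J(1) I'
      by (subst disjoint_family_on_insert) (use J in \<open>auto simp: I'_def\<close>)
    moreover have "ball y s \<subseteq> (\<Union>(x, r)\<in>insert (x, r) J. ball x (3 * r))" if ys: "(y, s) \<in> I" for y s
    proof (cases "(y, s) \<in> I'")
      case True
      then show ?thesis using J(3) by blast
    next
      case False
      then obtain z where z: "dist y z < s" "dist x z < r" using ys by (auto simp: I'_def)
      have "ball y s \<subseteq> ball x (3 * r)"
      proof
        fix w assume "w \<in> ball y s"
        then have "dist y w < r" "dist y z < r" using big[OF ys] z by auto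
        then have "dist x w < 3 * r" using z(2) dist_triangle[of x w y] dist_triangle[of x y z]
          by (simp add: dist_commute)
        then show "w \<in> ball x (3 * r)" by simp
      qed
      then show ?thesis by blast
    qed
    ultimately show ?thesis using J(1) I'(1) xr(1)
      by (intro exI[of _ "insert (x, r) J"]) blast
  qed
qed

locale finite_ball_space =
  fixes \<mu> :: "'a::{metric_space,second_countable_topology} measure"
  assumes sets_mu: "sets \<mu> = sets borel"
    and ball_finite: "0 < r \<Longrightarrow> emeasure \<mu> (ball x r) < \<infinity>"
begin

lemma ball_sets [measurable]: "ball x r \<in> sets \<mu>"
  by (simp add: sets_mu)

lemma space_mu: "space \<mu> = UNIV"
  using sets_eq_imp_space_eq[OF sets_mu] by simp

lemma emeasure_ball: "0 < r \<Longrightarrow> emeasure \<mu> (ball x r) = ennreal (measure \<mu> (ball x r))"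
  using ball_finite[of r x] by (intro emeasure_eq_ennreal_measure) auto

lemma measure_ball_mono:
  "0 < r \<Longrightarrow> ball x s \<subseteq> ball y r \<Longrightarrow> measure \<mu> (ball x s) \<le> measure \<mu> (ball y r)"
  using ball_finite[of r y] by (intro measure_mono_fmeasurable) (auto simp: fmeasurable_def)

lemma sigma_finite: "sigma_finite_measure \<mu>"
proof
  show "\<exists>A. countable A \<and> A \<subseteq> sets \<mu> \<and> \<Union>A = space \<mu> \<and> (\<forall>a\<in>A. emeasure \<mu> a \<noteq> \<infinity>)"
  proof (intro exI[of _ "range (\<lambda>n::nat. ball (undefined::'a) (Suc n))"] conjI)
    have "\<exists>n::nat. dist undefined x < Suc n" for x :: 'a
      using reals_Archimedean2[of "dist undefined x"]
        less_trans[OF _ of_nat_less_iff[THEN iffD2, OF lessI]] by blast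
    then show "\<Union> (range (\<lambda>n::nat. ball (undefined::'a) (Suc n))) = space \<mu>"
      by (auto simp: space_mu)
    show "\<forall>a\<in>range (\<lambda>n::nat. ball (undefined::'a) (Suc n)). emeasure \<mu> a \<noteq> \<infinity>"
      using ball_finite[of "real (Suc _)" "undefined::'a"] by (auto simp: less_top)
  qed auto
qed

end

locale doubling_space = finite_ball_space \<mu>
  for \<mu> :: "'a::{metric_space,second_countable_topology} measure" +
  fixes A :: real
  assumes ball_pos: "0 < r \<Longrightarrow> 0 < measure \<mu> (ball x r)"
    and doubling: "0 < r \<Longrightarrow> measure \<mu> (ball x (2 * r)) \<le> A * measure \<mu> (ball x r)"
    and A_ge: "2 \<le> A"
begin

lemma doubling_iterated: "0 < r \<Longrightarrow> measure \<mu> (ball x (2 ^ k * r)) \<le> A ^ k * measure \<mu> (ball x r)"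
proof (induction k)
  case (Suc k)
  have "measure \<mu> (ball x (2 ^ Suc k * r)) \<le> A * measure \<mu> (ball x (2 ^ k * r))"
    using doubling[of "2 ^ k * r" x] Suc by (simp add: mult.assoc)
  also have "\<dots> \<le> A * (A ^ k * measure \<mu> (ball x r))"
    using A_ge Suc by (intro mult_left_mono) auto
  finally show ?case by simp
qed simp

text \<open>Iterated doubling gives polynomial volume growth with exponent \<open>log\<^sub>2 A\<close>; the factor \<open>A\<close> pays
  for rounding the ratio of the radii up to a power of two.\<close>

lemma ball_growth:
  assumes "0 < \<sigma>" "\<sigma> \<le> \<rho>"
  shows "measure \<mu> (ball x \<rho>) \<le> A * (\<rho> / \<sigma>) powr log 2 A * measure \<mu> (ball x \<sigma>)"
proof -
  define k where "k = nat \<lceil>log 2 (\<rho> / \<sigma>)\<rceil>"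
  have ge: "0 \<le> log 2 (\<rho> / \<sigma>)" using assms by simp
  then have k: "log 2 (\<rho> / \<sigma>) \<le> k" "k \<le> log 2 (\<rho> / \<sigma>) + 1"
    unfolding k_def by linarith+
  have "\<rho> / \<sigma> = 2 powr log 2 (\<rho> / \<sigma>)" using assms by simp
  also have "\<dots> \<le> 2 powr k" using k by (intro powr_mono) auto
  finally have "\<rho> \<le> 2 ^ k * \<sigma>" using assms by (simp add: powr_realpow field_simps)
  then have "measure \<mu> (ball x \<rho>) \<le> measure \<mu> (ball x (2 ^ k * \<sigma>))"
    using assms by (intro measure_ball_mono) auto
  also have "\<dots> \<le> A ^ k * measure \<mu> (ball x \<sigma>)" using assms by (intro doubling_iterated)
  also have "A ^ k = A powr k" using A_ge by (simp add: powr_realpow)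
  also have "\<dots> \<le> A powr (log 2 (\<rho> / \<sigma>) + 1)" using k A_ge by (intro powr_mono) auto
  also have "\<dots> = A * A powr log 2 (\<rho> / \<sigma>)" using A_ge by (simp add: powr_add)
  also have "A powr log 2 (\<rho> / \<sigma>) = (\<rho> / \<sigma>) powr log 2 A"
    using A_ge assms by (simp add: powr_def log_def)
  finally show ?thesis by (simp add: mult_right_mono)
qed

text \<open>This is the level set of the uncentred maximal function.  Taking it as a union of open balls makes
  it open, hence measurable, without further argument.\<close>

definition high_average_set :: "('a \<Rightarrow> ennreal) \<Rightarrow> real \<Rightarrow> 'a set" where
  "high_average_set f l = \<Union>{ball x r | x r. 0 < r \<and>
     ennreal (l * measure \<mu> (ball x r)) < (\<integral>\<^sup>+y\<in>ball x r. f y \<partial>\<mu>)}"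

lemma open_high_average_set: "open (high_average_set f l)"
  by (auto simp: high_average_set_def)

lemma high_average_set_sets [measurable]: "high_average_set f l \<in> sets \<mu>"
  using open_high_average_set[of f l] by (simp add: sets_mu)

text \<open>The weak type inequality.  By Lindelof's property the union of balls is countable, so finite
  unions suffice; there a disjoint subfamily found by Vitali's covering argument carries a fixed
  fraction of the measure.\<close>

lemma emeasure_high_average_set:
  assumes [measurable]: "f \<in> borel_measurable \<mu>" and l: "0 < l"
  shows "ennreal l * emeasure \<mu> (high_average_set f l) \<le> ennreal (A\<^sup>2) * (\<integral>\<^sup>+y. f y \<partial>\<mu>)"
proof -
  define P where "P = {(x, r). 0 < r \<and> ennreal (l * measure \<mu> (ball x r)) < (\<integral>\<^sup>+y\<in>ball x r. f y \<partial>\<mu>)}"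
  have U: "high_average_set f l = (\<Union>(x, r)\<in>P. ball x r)"
    by (auto simp: high_average_set_def P_def)
  have fin: "ennreal l * emeasure \<mu> (\<Union>(x, r)\<in>I. ball x r) \<le> ennreal (A\<^sup>2) * (\<integral>\<^sup>+y. f y \<partial>\<mu>)"
    if I: "finite I" "I \<subseteq> P" for I
  proof -
    obtain J where J: "J \<subseteq> I" "disjoint_family_on (\<lambda>(x, r). ball x r) J"
      "(\<Union>(x, r)\<in>I. ball x r) \<subseteq> (\<Union>(x, r)\<in>J. ball x (3 * r))"
      using finite_vitali[of I] I by (auto simp: P_def)
    have finJ: "finite J" using J I finite_subset by blast
    have "emeasure \<mu> (\<Union>(x, r)\<in>I. ball x r) \<le> emeasure \<mu> (\<Union>(x, r)\<in>J. ball x (3 * r))"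
      using finJ by (intro emeasure_mono J sets.finite_UN) auto
    also have "\<dots> \<le> (\<Sum>z\<in>J. emeasure \<mu> (case z of (x, r) \<Rightarrow> ball x (3 * r)))"
      by (intro emeasure_subadditive_finite finJ) auto
    also have "\<dots> \<le> (\<Sum>z\<in>J. ennreal (A\<^sup>2) * emeasure \<mu> (case z of (x, r) \<Rightarrow> ball x r))"
    proof (intro sum_mono)
      fix z assume "z \<in> J"
      then obtain x r where z: "z = (x, r)" "0 < r" using J I by (cases z) (auto simp: P_def)
      have "emeasure \<mu> (ball x (3 * r)) \<le> emeasure \<mu> (ball x (2 ^ 2 * r))"
        using z by (intro emeasure_mono) auto
      also have "\<dots> \<le> ennreal (A\<^sup>2 * measure \<mu> (ball x r))"
        using z doubling_iterated[of r x 2] by (simp add: emeasure_ball)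
      also have "\<dots> = ennreal (A\<^sup>2) * emeasure \<mu> (ball x r)"
        using z by (simp add: emeasure_ball ennreal_mult)
      finally show "emeasure \<mu> (case z of (x, r) \<Rightarrow> ball x (3 * r))
          \<le> ennreal (A\<^sup>2) * emeasure \<mu> (case z of (x, r) \<Rightarrow> ball x r)"
        using z by simp
    qed
    finally have "ennreal l * emeasure \<mu> (\<Union>(x, r)\<in>I. ball x r)
        \<le> ennreal l * (\<Sum>z\<in>J. ennreal (A\<^sup>2) * emeasure \<mu> (case z of (x, r) \<Rightarrow> ball x r))"
      by (intro mult_left_mono) auto
    also have "\<dots> = ennreal (A\<^sup>2) * (\<Sum>z\<in>J. ennreal l * emeasure \<mu> (case z of (x, r) \<Rightarrow> ball x r))"
      by (simp add: sum_distrib_left ac_simps)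
    also have "\<dots> \<le> ennreal (A\<^sup>2) * (\<Sum>z\<in>J. \<integral>\<^sup>+y\<in>(case z of (x, r) \<Rightarrow> ball x r). f y \<partial>\<mu>)"
    proof (intro mult_left_mono sum_mono)
      fix z assume "z \<in> J"
      then obtain x r where z: "z = (x, r)" "z \<in> P" "0 < r"
        using J I by (cases z) (auto simp: P_def)
      then show "ennreal l * emeasure \<mu> (case z of (x, r) \<Rightarrow> ball x r)
          \<le> (\<integral>\<^sup>+y\<in>(case z of (x, r) \<Rightarrow> ball x r). f y \<partial>\<mu>)"
        using l by (auto simp: P_def emeasure_ball ennreal_mult[symmetric])
    qed auto
    also have "(\<Sum>z\<in>J. \<integral>\<^sup>+y\<in>(case z of (x, r) \<Rightarrow> ball x r). f y \<partial>\<mu>)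
        = (\<integral>\<^sup>+y\<in>(\<Union>(x, r)\<in>J. ball x r). f y \<partial>\<mu>)"
      using finJ J(2)
      by (subst nn_integral_sum[symmetric])
        (auto simp: indicator_UN_disjoint sum_distrib_left intro!: nn_integral_cong)
    also have "ennreal (A\<^sup>2) * \<dots> \<le> ennreal (A\<^sup>2) * (\<integral>\<^sup>+y. f y \<partial>\<mu>)"
      by (intro mult_left_mono nn_integral_mono) (auto simp: indicator_def)
    finally show ?thesis .
  qed
  obtain I where I: "I \<subseteq> P" "countable I" "(\<Union>(x, r)\<in>I. ball x r) = (\<Union>(x, r)\<in>P. ball x r)"
  proof -
    define b where "b = (\<lambda>(x::'a, r). ball x r)"
    have op: "open S" if "S \<in> b ` P" for S using that by (auto simp: b_def)
    obtain F where F: "F \<subseteq> b ` P" "countable F" "\<Union>F = \<Union>(b ` P)"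
      using Lindelof[of "b ` P", OF op] by metis
    then obtain I where "I \<subseteq> P" "countable I" "F = b ` I"
      using countable_subset_image[of F b P] by metis
    then show ?thesis using F that unfolding b_def by simp
  qed
  show ?thesis
  proof (cases "I = {}")
    case True
    then show ?thesis using I U by simp
  next
    case False
    define g where "g n = (\<Union>(x, r)\<in>from_nat_into I ` {..<n}. ball x r)" for n
    have "(\<Union>n. g n) = high_average_set f l"
    proof -
      have "(\<Union>n. g n) = (\<Union>(x, r)\<in>(\<Union>n. from_nat_into I ` {..<n}). ball x r)"
        unfolding g_def by (simp only: UN_UN_flatten)
      also have "(\<Union>n. from_nat_into I ` {..<n}) = range (from_nat_into I)"
        by (simp only: image_UN[symmetric] UN_lessThan_UNIV)
      finally show ?thesis using range_from_nat_into[OF False I(2)] I U by simp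
    qed
    moreover have "incseq g"
      unfolding incseq_def g_def by (intro allI impI UN_mono image_mono) auto
    moreover have "range g \<subseteq> sets \<mu>" by (auto simp: g_def split_beta intro!: sets.finite_UN)
    ultimately have "emeasure \<mu> (high_average_set f l) = (SUP n. emeasure \<mu> (g n))"
      by (simp add: SUP_emeasure_incseq)
    then have "ennreal l * emeasure \<mu> (high_average_set f l) = (SUP n. ennreal l * emeasure \<mu> (g n))"
      by (simp add: SUP_mult_left_ennreal)
    also have "\<dots> \<le> ennreal (A\<^sup>2) * (\<integral>\<^sup>+y. f y \<partial>\<mu>)"
    proof (intro SUP_least)
      fix n
      have "from_nat_into I ` {..<n} \<subseteq> P" using I(1) from_nat_into[OF False] by blast
      then show "ennreal l * emeasure \<mu> (g n) \<le> ennreal (A\<^sup>2) * (\<integral>\<^sup>+y. f y \<partial>\<mu>)"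
        unfolding g_def by (intro fin) auto
    qed
    finally show ?thesis .
  qed
qed

text \<open>The part of \<open>f\<close> below \<open>l / 2\<close> contributes at most \<open>l / 2\<close> to any average.  Together with the weak
  type inequality this is the truncation step of the Marcinkiewicz argument.\<close>

lemma high_average_set_truncate:
  assumes [measurable]: "f \<in> borel_measurable \<mu>" and l: "0 < l"
  shows "high_average_set f l \<subseteq> high_average_set (\<lambda>y. f y * indicator {y. ennreal (l / 2) < f y} y) (l / 2)"
proof -
  have "ennreal (l / 2 * measure \<mu> (ball x r))
      < (\<integral>\<^sup>+y\<in>ball x r. f y * indicator {y. ennreal (l / 2) < f y} y \<partial>\<mu>)"
    if r: "0 < r" and gt: "ennreal (l * measure \<mu> (ball x r)) < (\<integral>\<^sup>+y\<in>ball x r. f y \<partial>\<mu>)" for x r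
  proof (rule ccontr)
    define V where "V = measure \<mu> (ball x r)"
    assume "\<not> ?thesis"
    then have le: "(\<integral>\<^sup>+y\<in>ball x r. f y * indicator {y. ennreal (l / 2) < f y} y \<partial>\<mu>) \<le> ennreal (l / 2 * V)"
      by (simp add: V_def)
    have [measurable]: "{y. ennreal (l / 2) < f y} \<in> sets \<mu>"
      using borel_measurable_less[of "\<lambda>_. ennreal (l / 2)" \<mu> f] by (simp add: space_mu pred_def)
    have "(\<integral>\<^sup>+y\<in>ball x r. f y \<partial>\<mu>) \<le> (\<integral>\<^sup>+y. ennreal (l / 2) * indicator (ball x r) y
        + (f y * indicator {y. ennreal (l / 2) < f y} y) * indicator (ball x r) y \<partial>\<mu>)"
      by (intro nn_integral_mono) (auto simp: indicator_def not_less)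
    also have "\<dots> = ennreal (l / 2) * emeasure \<mu> (ball x r)
        + (\<integral>\<^sup>+y\<in>ball x r. f y * indicator {y. ennreal (l / 2) < f y} y \<partial>\<mu>)"
      by (subst nn_integral_add) (auto simp: nn_integral_cmult_indicator)
    also have "\<dots> \<le> ennreal (l / 2 * V) + ennreal (l / 2 * V)"
      using le r l by (intro add_mono) (auto simp: emeasure_ball V_def ennreal_mult[symmetric])
    also have "\<dots> = ennreal (l * V)"
      using l by (subst ennreal_plus[symmetric]) (auto simp: V_def)
    finally show False using gt by (simp add: V_def)
  qed
  then show ?thesis unfolding high_average_set_def by blast
qed

text \<open>A dyadic form of the maximal theorem: the weak type inequality for the truncation of \<open>f\<close> at height
  \<open>c 2\<^sup>j / 2\<close> is multiplied by \<open>2\<^sup>p\<^sup>j\<close> and summed; pointwise this leaves a geometric sum whose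
  largest term is about \<open>(2 f / c)\<^sup>p\<^sup>-\<^sup>1\<close>.\<close>

lemma high_average_strong_type:
  fixes f :: "'a \<Rightarrow> real" and c p :: real
  assumes [measurable]: "f \<in> borel_measurable \<mu>" and f: "\<And>x. 0 \<le> f x" and c: "0 < c" and p: "1 < p"
    and J: "finite (J :: int set)"
  shows "(\<Sum>j\<in>J. ennreal (2 powr (p * j)) * emeasure \<mu> (high_average_set (\<lambda>y. ennreal (f y)) (c * 2 powr j)))
    \<le> ennreal (2 * A\<^sup>2 / c * (2 / c) powr (p - 1) / (1 - 2 powr - (p - 1))) * (\<integral>\<^sup>+y. ennreal (f y powr p) \<partial>\<mu>)"
proof -
  define E where "E j = {y. c / 2 * 2 powr real_of_int j < f y}" for j :: int
  have [measurable]: "E j \<in> sets \<mu>" for j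
    using borel_measurable_less[of "\<lambda>_. c / 2 * 2 powr real_of_int j" \<mu> f] by (simp add: space_mu E_def)
  have p1: "1 - 2 powr - (p - 1) > 0" using powr_less_mono[of "-(p-1)" 0 "2::real"] p by auto
  have "ennreal (2 powr (p * j)) * emeasure \<mu> (high_average_set (\<lambda>y. ennreal (f y)) (c * 2 powr j))
      \<le> (\<integral>\<^sup>+y. ennreal (2 * A\<^sup>2 / c * 2 powr ((p - 1) * j)) * (ennreal (f y) * indicator (E j) y) \<partial>\<mu>)" for j :: int
  proof -
    define l where "l = c * 2 powr j"
    have l: "0 < l" using c by (simp add: l_def)
    have eq: "{y. ennreal (l / 2) < ennreal (f y)} = E j"
      using f l by (auto simp: E_def l_def ennreal_less_iff)
    have "ennreal (l / 2) * emeasure \<mu> (high_average_set (\<lambda>y. ennreal (f y)) l)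
        \<le> ennreal (l / 2) * emeasure \<mu> (high_average_set (\<lambda>y. ennreal (f y) * indicator (E j) y) (l / 2))"
      using high_average_set_truncate[of "\<lambda>y. ennreal (f y)" l] l unfolding eq
      by (intro mult_left_mono emeasure_mono) auto
    also have "\<dots> \<le> ennreal (A\<^sup>2) * (\<integral>\<^sup>+y. ennreal (f y) * indicator (E j) y \<partial>\<mu>)"
      using l by (intro emeasure_high_average_set) auto
    finally have w: "ennreal (l / 2) * emeasure \<mu> (high_average_set (\<lambda>y. ennreal (f y)) l)
      \<le> ennreal (A\<^sup>2) * (\<integral>\<^sup>+y. ennreal (f y) * indicator (E j) y \<partial>\<mu>)" .
    have pj: "2 powr (p * j) = 2 / c * 2 powr ((p - 1) * j) * (l / 2)"
      using c by (simp add: l_def left_diff_distrib powr_diff)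
    have "ennreal (2 powr (p * j)) * emeasure \<mu> (high_average_set (\<lambda>y. ennreal (f y)) l)
      = ennreal (2 / c * 2 powr ((p - 1) * j)) * (ennreal (l / 2) * emeasure \<mu> (high_average_set (\<lambda>y. ennreal (f y)) l))"
      unfolding pj mult.assoc[symmetric]
      using c l by (subst ennreal_mult) auto
    also have "\<dots> \<le> ennreal (2 / c * 2 powr ((p - 1) * j)) * (ennreal (A\<^sup>2) * (\<integral>\<^sup>+y. ennreal (f y) * indicator (E j) y \<partial>\<mu>))"
      by (intro mult_left_mono w) auto
    also have "\<dots> = ennreal (2 * A\<^sup>2 / c * 2 powr ((p - 1) * j)) * (\<integral>\<^sup>+y. ennreal (f y) * indicator (E j) y \<partial>\<mu>)"
      using c by (simp add: ennreal_mult[symmetric] mult.assoc[symmetric]) (simp add: ac_simps)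
    also have "\<dots> = (\<integral>\<^sup>+y. ennreal (2 * A\<^sup>2 / c * 2 powr ((p - 1) * j)) * (ennreal (f y) * indicator (E j) y) \<partial>\<mu>)"
      by (rule nn_integral_cmult[symmetric]) measurable
    finally show ?thesis by (simp add: l_def)
  qed
  then have "(\<Sum>j\<in>J. ennreal (2 powr (p * j)) * emeasure \<mu> (high_average_set (\<lambda>y. ennreal (f y)) (c * 2 powr j)))
    \<le> (\<Sum>j\<in>J. \<integral>\<^sup>+y. ennreal (2 * A\<^sup>2 / c * 2 powr ((p - 1) * j)) * (ennreal (f y) * indicator (E j) y) \<partial>\<mu>)"
    by (intro sum_mono)
  also have "\<dots> = (\<integral>\<^sup>+y. (\<Sum>j\<in>J. ennreal (2 * A\<^sup>2 / c * 2 powr ((p - 1) * j)) * (ennreal (f y) * indicator (E j) y)) \<partial>\<mu>)"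
    by (rule nn_integral_sum[symmetric]) measurable
  also have "\<dots> \<le> (\<integral>\<^sup>+y. ennreal (2 * A\<^sup>2 / c * (2 / c) powr (p - 1) / (1 - 2 powr - (p - 1))) * ennreal (f y powr p) \<partial>\<mu>)"
  proof (intro nn_integral_mono)
    fix y
    have "(\<Sum>j\<in>J. ennreal (2 * A\<^sup>2 / c * 2 powr ((p - 1) * j)) * (ennreal (f y) * indicator (E j) y))
      = (\<Sum>j\<in>J. ennreal (2 * A\<^sup>2 / c * f y * (2 powr ((p - 1) * j) * indicator (E j) y)))"
      using c f by (intro sum.cong refl) (auto simp: indicator_def ennreal_mult[symmetric] ac_simps)
    also have "\<dots> = ennreal (2 * A\<^sup>2 / c * f y * (\<Sum>j\<in>J. 2 powr ((p - 1) * j) * indicator (E j) y))"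
      using c f by (subst sum_ennreal) (auto simp: sum_distrib_left)
    also have "(\<Sum>j\<in>J. 2 powr ((p - 1) * j) * indicator (E j) y) = (\<Sum>j\<in>{j\<in>J. y \<in> E j}. 2 powr ((p - 1) * j))"
      by (subst sum.inter_filter[OF J]) (intro sum.cong refl, simp add: indicator_def)
    also have "2 * A\<^sup>2 / c * f y * \<dots> \<le> 2 * A\<^sup>2 / c * f y * ((2 / c * f y) powr (p - 1) / (1 - 2 powr - (p - 1)))"
    proof (intro mult_left_mono dyadic_sum_le_largest)
      fix j assume "j \<in> {j\<in>J. y \<in> E j}"
      then have "2 powr real_of_int j \<le> 2 / c * f y" using c by (auto simp: E_def field_simps)
      then have "(2 powr real_of_int j) powr (p - 1) \<le> (2 / c * f y) powr (p - 1)"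
        using p by (intro powr_mono2) auto
      then show "2 powr ((p - 1) * real_of_int j) \<le> (2 / c * f y) powr (p - 1)"
        by (simp add: powr_powr mult.commute)
    qed (use J p c f in auto)
    also have "\<dots> = 2 * A\<^sup>2 / c * (2 / c) powr (p - 1) / (1 - 2 powr - (p - 1)) * f y powr p"
      using c f[of y] by (cases "f y = 0") (auto simp: powr_mult powr_diff powr_divide)
    also have "ennreal \<dots> = ennreal (2 * A\<^sup>2 / c * (2 / c) powr (p - 1) / (1 - 2 powr - (p - 1))) * ennreal (f y powr p)"
      using c p1 by (intro ennreal_mult) auto
    finally show "(\<Sum>j\<in>J. ennreal (2 * A\<^sup>2 / c * 2 powr ((p - 1) * j)) * (ennreal (f y) * indicator (E j) y))
      \<le> ennreal (2 * A\<^sup>2 / c * (2 / c) powr (p - 1) / (1 - 2 powr - (p - 1))) * ennreal (f y powr p)"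
      by (auto intro: ennreal_leI)
  qed
  also have "\<dots> = ennreal (2 * A\<^sup>2 / c * (2 / c) powr (p - 1) / (1 - 2 powr - (p - 1))) * (\<integral>\<^sup>+y. ennreal (f y powr p) \<partial>\<mu>)"
    by (rule nn_integral_cmult) measurable
  finally show ?thesis .
qed

text \<open>A Gaussian at scale \<open>\<rho>\<close> only sees averages over balls of radius at least \<open>\<rho>\<close>: dominate it by dyadic
  shells with weights \<open>N (2 A)\<^sup>-\<^sup>k\<close>, where \<open>A\<^sup>k\<close> compensates the volume of the \<open>k\<close>-th ball and \<open>2\<^sup>-\<^sup>k\<close>
  makes the sum converge.\<close>

lemma gaussian_average:
  assumes C: "0 < C"
  shows "\<exists>N>0. \<forall>f\<in>borel_measurable \<mu>. \<forall>S x \<rho>. 0 < \<rho> \<longrightarrow>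
       (\<forall>R\<ge>\<rho>. (\<integral>\<^sup>+y\<in>ball x R. f y \<partial>\<mu>) \<le> S * ennreal (measure \<mu> (ball x R))) \<longrightarrow>
       (\<integral>\<^sup>+y. ennreal (exp (- C * (dist x y / \<rho>)\<^sup>2)) * f y \<partial>\<mu>) \<le> ennreal N * S * ennreal (measure \<mu> (ball x \<rho>))"
proof -
  obtain N where N: "0 < N" "\<And>u. 0 \<le> u \<Longrightarrow> \<exists>k::nat. u < 2 ^ k \<and> exp (- C * u\<^sup>2) \<le> N / (2 * A) ^ k"
    using gaussian_below_geometric[of C "2 * A"] C A_ge by (metis mult_pos_pos less_le_trans zero_less_numeral)
  have "(\<integral>\<^sup>+y. ennreal (exp (- C * (dist x y / \<rho>)\<^sup>2)) * f y \<partial>\<mu>) \<le> ennreal (2 * N) * S * ennreal (measure \<mu> (ball x \<rho>))"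
    if [measurable]: "f \<in> borel_measurable \<mu>" and \<rho>: "0 < \<rho>"
      and av: "\<And>R. \<rho> \<le> R \<Longrightarrow> (\<integral>\<^sup>+y\<in>ball x R. f y \<partial>\<mu>) \<le> S * ennreal (measure \<mu> (ball x R))" for f S x \<rho>
  proof -
    define V where "V = measure \<mu> (ball x \<rho>)"
    have "(\<integral>\<^sup>+y. ennreal (exp (- C * (dist x y / \<rho>)\<^sup>2)) * f y \<partial>\<mu>)
      \<le> (\<integral>\<^sup>+y. (\<Sum>k. ennreal (N / (2 * A) ^ k) * (f y * indicator (ball x (2 ^ k * \<rho>)) y)) \<partial>\<mu>)"
    proof (intro nn_integral_mono)
      fix y
      obtain k :: nat where k: "dist x y / \<rho> < 2 ^ k" "exp (- C * (dist x y / \<rho>)\<^sup>2) \<le> N / (2 * A) ^ k"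
        using N(2)[of "dist x y / \<rho>"] \<rho> by auto
      have "ennreal (exp (- C * (dist x y / \<rho>)\<^sup>2)) * f y \<le> ennreal (N / (2 * A) ^ k) * f y"
        using k by (intro mult_right_mono ennreal_leI) auto
      also have "\<dots> = (\<Sum>k\<in>{k}. ennreal (N / (2 * A) ^ k) * (f y * indicator (ball x (2 ^ k * \<rho>)) y))"
        using k \<rho> by (simp add: field_simps)
      also have "\<dots> \<le> (\<Sum>k. ennreal (N / (2 * A) ^ k) * (f y * indicator (ball x (2 ^ k * \<rho>)) y))"
        by (intro sum_le_suminf) auto
      finally show "ennreal (exp (- C * (dist x y / \<rho>)\<^sup>2)) * f y \<le> \<dots>" .
    qed
    also have "\<dots> = (\<Sum>k. ennreal (N / (2 * A) ^ k) * (\<integral>\<^sup>+y\<in>ball x (2 ^ k * \<rho>). f y \<partial>\<mu>))"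
      by (subst nn_integral_suminf) (auto simp: nn_integral_cmult)
    also have "\<dots> \<le> (\<Sum>k. (S * ennreal (N * V)) * ennreal ((1 / 2) ^ k))"
    proof (intro suminf_le)
      fix k
      have "1 * \<rho> \<le> 2 ^ k * \<rho>" using \<rho> by (intro mult_right_mono) auto
      then have "(\<integral>\<^sup>+y\<in>ball x (2 ^ k * \<rho>). f y \<partial>\<mu>) \<le> S * ennreal (measure \<mu> (ball x (2 ^ k * \<rho>)))"
        using av[of "2 ^ k * \<rho>"] by simp
      also have "\<dots> \<le> S * ennreal (A ^ k * V)"
        using doubling_iterated[OF \<rho>] by (intro mult_left_mono ennreal_leI) (auto simp: V_def)
      finally have "ennreal (N / (2 * A) ^ k) * (\<integral>\<^sup>+y\<in>ball x (2 ^ k * \<rho>). f y \<partial>\<mu>)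
        \<le> ennreal (N / (2 * A) ^ k) * (S * ennreal (A ^ k * V))"
        by (intro mult_left_mono) auto
      also have "\<dots> = S * (ennreal (N / (2 * A) ^ k) * ennreal (A ^ k * V))" by (simp add: ac_simps)
      also have "ennreal (N / (2 * A) ^ k) * ennreal (A ^ k * V) = ennreal (N / (2 * A) ^ k * (A ^ k * V))"
        using N A_ge by (intro ennreal_mult[symmetric]) (auto simp: V_def)
      also have "N / (2 * A) ^ k * (A ^ k * V) = N * V * (1 / 2) ^ k"
        using A_ge by (simp add: power_mult_distrib power_divide)
      also have "ennreal \<dots> = ennreal (N * V) * ennreal ((1 / 2) ^ k)"
        using N by (intro ennreal_mult) (auto simp: V_def)
      finally show "ennreal (N / (2 * A) ^ k) * (\<integral>\<^sup>+y\<in>ball x (2 ^ k * \<rho>). f y \<partial>\<mu>) \<le> (S * ennreal (N * V)) * ennreal ((1 / 2) ^ k)"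
        by (simp add: ac_simps)
    qed auto
    also have "\<dots> = (S * ennreal (N * V)) * (\<Sum>k. ennreal ((1 / 2) ^ k))" by simp
    also have "(\<Sum>k. ennreal ((1 / 2) ^ k)) = ennreal 2"
      using suminf_geometric[of "1/2::real"] by (subst suminf_ennreal_eq) (auto intro: geometric_sums summable_sums simp: summable_geometric sums_iff)
    also have "S * ennreal (N * V) * ennreal 2 = ennreal (2 * N) * S * ennreal V"
      using N by (simp add: ennreal_mult V_def ac_simps)
    finally show ?thesis by (simp add: V_def)
  qed
  moreover have "0 < 2 * N" using N by simp
  ultimately show ?thesis by blast
qed

end

section \<open>Two-sided Gaussian bounds force doubling\<close>

lemma AE_ex_in_positive:
  assumes "AE x in M. P x" and "S \<in> sets M" and "0 < emeasure M S"
  shows "\<exists>x\<in>S. P x"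
proof (rule ccontr)
  assume "\<not> ?thesis"
  with assms(1) have "AE x in M. x \<notin> S" by (auto elim: eventually_mono)
  then have "emeasure M S = 0"
    using assms(2) by (subst (asm) AE_iff_measurable[OF assms(2)])
      (auto dest: sets.sets_into_space)
  with assms(3) show False by simp
qed

locale gaussian_heat_kernel = finite_ball_space \<mu>
  for \<mu> :: "'a::{metric_space,second_countable_topology} measure" +
  fixes heat :: "real \<Rightarrow> 'a \<Rightarrow> 'a \<Rightarrow> real" and C c1 c2 :: real
  assumes heat: "heat_kernel \<mu> heat"
    and C: "0 < C" and c1: "0 < c1" and c2: "0 < c2"
    and gauss: "\<And>x y s. 0 < s \<Longrightarrow>
      ennreal c1 * (ennreal (exp (- C * (dist x y)\<^sup>2 / s)) / emeasure \<mu> (ball x (sqrt s))) \<le> ennreal (heat s x y)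
      \<and> ennreal (heat s x y) \<le> ennreal c2 * (ennreal (exp (- C * (dist x y)\<^sup>2 / s)) / emeasure \<mu> (ball x (sqrt s)))"
begin

text \<open>A null ball would make the Gaussian lower bound infinite.\<close>

lemma ball_pos: assumes r: "0 < r" shows "0 < measure \<mu> (ball x r)"
proof -
  have "emeasure \<mu> (ball x r) \<noteq> 0"
  proof
    assume "emeasure \<mu> (ball x r) = 0"
    then have "ennreal c1 * \<infinity> \<le> ennreal (heat (r\<^sup>2) x x)"
      using gauss[of "r\<^sup>2" x x] r by (simp add: ennreal_divide_zero)
    then show False using c1 by (simp add: ennreal_mult_top top_unique)
  qed
  then show ?thesis using ball_finite[OF r, of x]
    by (simp add: measure_def enn2real_positive_iff less_top zero_less_iff_neq_zero)
qed

lemma heat_lower: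
  assumes "0 < s"
  shows "c1 * exp (- C * (dist x y)\<^sup>2 / s) / measure \<mu> (ball x (sqrt s)) \<le> heat s x y"
proof -
  have V: "0 < measure \<mu> (ball x (sqrt s))" using assms by (intro ball_pos) auto
  have "ennreal (c1 * exp (- C * (dist x y)\<^sup>2 / s) / measure \<mu> (ball x (sqrt s))) \<le> ennreal (heat s x y)"
    using gauss[OF assms, of x y] assms V c1
    by (simp add: emeasure_ball divide_ennreal ennreal_mult[symmetric])
  moreover have "0 < c1 * exp (- C * (dist x y)\<^sup>2 / s) / measure \<mu> (ball x (sqrt s))"
    using V c1 by simp
  ultimately show ?thesis by (auto simp: ennreal_le_iff2)
qed

lemma heat_pos: "0 < s \<Longrightarrow> 0 < heat s x y"
  using heat_lower[of s x y] ball_pos[of "sqrt s" x] c1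
  by (intro less_le_trans[OF _ heat_lower[of s x y]]) auto

lemma heat_upper:
  assumes "0 < s"
  shows "heat s x y \<le> c2 * exp (- C * (dist x y)\<^sup>2 / s) / measure \<mu> (ball x (sqrt s))"
proof -
  have V: "0 < measure \<mu> (ball x (sqrt s))" using assms by (intro ball_pos) auto
  have "ennreal (heat s x y) \<le> ennreal (c2 * exp (- C * (dist x y)\<^sup>2 / s) / measure \<mu> (ball x (sqrt s)))"
    using gauss[OF assms, of x y] assms V c2
    by (simp add: emeasure_ball divide_ennreal ennreal_mult[symmetric])
  then show ?thesis using V c2 by (subst (asm) ennreal_le_iff) auto
qed

definition growth_const :: real where "growth_const = c2 * exp (5 * C) / c1\<^sup>2"

text \<open>The semigroup identity bounds \<open>p\<^sub>2\<^sub>s(x, y)\<close> from below by the integral of \<open>p\<^sub>s(x, z) p\<^sub>s(z, y)\<close> over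
  \<open>z \<in> B(x, \<surd>s)\<close>.  Using symmetry to write the second factor as \<open>p\<^sub>s(y, z)\<close>, both factors have lower
  bounds with denominators independent of \<open>z\<close>, so this integral is at least a constant over
  \<open>\<mu>(B(y, \<surd>s))\<close>.  The upper bound of \<open>p\<^sub>2\<^sub>s(x, y)\<close> involves the larger ball \<open>B(x, \<surd>(2 s))\<close>.  Both
  kernel identities hold only for almost all pairs, and so does the conclusion.\<close>

lemma almost_everywhere_growth:
  "AE x in \<mu>. AE y in \<mu>. \<forall>r>dist x y. measure \<mu> (ball x (sqrt 2 * r)) \<le> growth_const * measure \<mu> (ball y r)"
proof -
  interpret sigma_finite_measure \<mu> by (rule sigma_finite)
  interpret pair_sigma_finite \<mu> \<mu> ..
  have sg: "AE x in \<mu>. AE y in \<mu>. \<forall>s>0. \<forall>t>0.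
        ennreal (heat (s + t) x y) = (\<integral>\<^sup>+z. ennreal (heat s x z) * ennreal (heat t z y) \<partial>\<mu>)"
    using heat AE_pair[of "\<lambda>(x, y). \<forall>s>0. \<forall>t>0.
        ennreal (heat (s + t) x y) = (\<integral>\<^sup>+z. ennreal (heat s x z) * ennreal (heat t z y) \<partial>\<mu>)"]
    by (simp add: heat_kernel_def)
  have sym: "AE y in \<mu>. AE z in \<mu>. \<forall>t>0. heat t y z = heat t z y"
    using heat AE_pair[of "\<lambda>(x, y). \<forall>t>0. heat t x y = heat t y x"] by (simp add: heat_kernel_def)
  have "measure \<mu> (ball x (sqrt 2 * r)) \<le> growth_const * measure \<mu> (ball y r)"
    if sg: "\<forall>s>0. \<forall>t>0. ennreal (heat (s + t) x y) = (\<integral>\<^sup>+z. ennreal (heat s x z) * ennreal (heat t z y) \<partial>\<mu>)"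
      and sym: "AE z in \<mu>. \<forall>t>0. heat t y z = heat t z y" and r: "dist x y < r" for x y r
  proof -
    have r0: "0 < r" using r zero_le_dist[of x y] by linarith
    define s where "s = r\<^sup>2"
    have s: "0 < s" "sqrt s = r" "sqrt (s + s) = sqrt 2 * r"
      using r0 by (auto simp: s_def real_sqrt_mult[symmetric] simp flip: mult_2)
        (auto simp: real_sqrt_mult)
    define V W U where "V = measure \<mu> (ball x r)" and "W = measure \<mu> (ball y r)"
      and "U = measure \<mu> (ball x (sqrt 2 * r))"
    have pos: "0 < V" "0 < W" "0 < U" using r0 by (auto simp: V_def W_def U_def intro!: ball_pos)
    \<comment> \<open>Lower bounds of the two factors, from \<open>d(x, z)\<^sup>2 \<le> s\<close> and \<open>d(y, z)\<^sup>2 \<le> 4 s\<close>.\<close>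
    define b where "b = c1 * exp (- C) / V * (c1 * exp (- 4 * C) / W)"
    have b: "0 < b" using pos c1 by (simp add: b_def)
    have "ennreal b * emeasure \<mu> (ball x r) = (\<integral>\<^sup>+z. ennreal b * indicator (ball x r) z \<partial>\<mu>)"
      by (simp add: nn_integral_cmult_indicator sets_mu)
    also have "\<dots> \<le> (\<integral>\<^sup>+z. ennreal (heat s x z) * ennreal (heat s z y) \<partial>\<mu>)"
      using sym
    proof (intro nn_integral_mono_AE, elim eventually_mono)
      fix z assume sy: "\<forall>t>0. heat t y z = heat t z y"
      show "ennreal b * indicator (ball x r) z \<le> ennreal (heat s x z) * ennreal (heat s z y)"
      proof (cases "dist x z < r")
        case True
        have "dist y z \<le> 2 * r" using True r dist_triangle[of y z x] by (simp add: dist_commute)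
        then have "(dist y z)\<^sup>2 \<le> (2 * r)\<^sup>2" by (intro power_mono) auto
        then have d1: "(dist y z)\<^sup>2 \<le> 4 * s" by (simp add: s_def)
        have d2: "(dist x z)\<^sup>2 \<le> s" using True by (auto simp: s_def intro!: power_mono)
        have "c1 * exp (- C) / V \<le> c1 * exp (- C * (dist x z)\<^sup>2 / s) / V"
          using c1 pos s(1) C d2 by (intro divide_right_mono mult_left_mono) (auto simp: field_simps)
        also have "\<dots> \<le> heat s x z" using heat_lower[OF s(1), of x z] s by (simp add: V_def)
        finally have 1: "c1 * exp (- C) / V \<le> heat s x z" .
        have "c1 * exp (- 4 * C) / W \<le> c1 * exp (- C * (dist y z)\<^sup>2 / s) / W"
          using c1 pos s(1) C d1 by (intro divide_right_mono mult_left_mono) (auto simp: field_simps)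
        also have "\<dots> \<le> heat s y z" using heat_lower[OF s(1), of y z] s by (simp add: W_def)
        also have "\<dots> = heat s z y" using sy s by auto
        finally have "b \<le> heat s x z * heat s z y"
          unfolding b_def using 1 c1 pos heat_pos[OF s(1)] by (intro mult_mono) (auto intro: less_imp_le)
        then have "ennreal b \<le> ennreal (heat s x z * heat s z y)" by (rule ennreal_leI)
        also have "\<dots> = ennreal (heat s x z) * ennreal (heat s z y)"
          using heat_pos[OF s(1)] by (intro ennreal_mult) (auto intro: less_imp_le)
        finally show ?thesis using True by simp
      qed simp
    qed
    also have "\<dots> = ennreal (heat (s + s) x y)" by (simp only: sg[rule_format, OF s(1) s(1)])
    also have "heat (s + s) x y \<le> c2 / U"
    proof -
      have "heat (s + s) x y \<le> c2 * exp (- C * (dist x y)\<^sup>2 / (s + s)) / U"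
        using heat_upper[of "s + s" x y] s by (simp add: U_def)
      also have "\<dots> \<le> c2 * 1 / U" using c2 C s(1) pos
        by (intro divide_right_mono mult_left_mono) (auto intro!: divide_nonneg_nonneg)
      finally show ?thesis by simp
    qed
    finally have "ennreal (b * V) \<le> ennreal (c2 / U)"
      using b pos r0 by (simp add: emeasure_ball ennreal_mult V_def ennreal_leI)
    then have "b * V \<le> c2 / U" using c2 pos by (subst (asm) ennreal_le_iff) auto
    then have "c1 * exp (- C) * (c1 * exp (- 4 * C)) * U \<le> c2 * W"
      using pos by (simp add: b_def field_simps)
    moreover have "c1 * exp (- C) * (c1 * exp (- 4 * C)) = c1\<^sup>2 / exp (5 * C)"
      by (simp add: power2_eq_square exp_add[symmetric] exp_minus[symmetric] divide_inverse)
    ultimately have "c1\<^sup>2 / exp (5 * C) * U \<le> c2 * W" by simp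
    then have "U \<le> growth_const * W"
      unfolding growth_const_def using c1 by (simp add: divide_simps) (simp add: ac_simps)?
    then show ?thesis by (simp add: U_def W_def)
  qed
  note pointwise = this
  show ?thesis
    using sg
  proof (rule eventually_mono)
    fix x assume "AE y in \<mu>. \<forall>s>0. \<forall>t>0.
        ennreal (heat (s + t) x y) = (\<integral>\<^sup>+z. ennreal (heat s x z) * ennreal (heat t z y) \<partial>\<mu>)"
    then show "AE y in \<mu>. \<forall>r>dist x y.
        measure \<mu> (ball x (sqrt 2 * r)) \<le> growth_const * measure \<mu> (ball y r)"
      using sym by eventually_elim (blast intro: pointwise)
  qed
qed

text \<open>Every ball contains points for which the almost everywhere estimate holds.  Moving the centres by
  \<open>r / 11\<close> costs a bit of the factor \<open>\<surd>2\<close>, but since \<open>\<surd>2 > 7 / 5\<close> the enlargement factor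
  \<open>13 / 11\<close> survives.\<close>

lemma growth: 
  assumes r: "0 < r"
  shows "measure \<mu> (ball x (13 / 11 * r)) \<le> growth_const * measure \<mu> (ball x r)"
proof -
  define e where "e = r / 11"
  have e: "0 < e" using r by (simp add: e_def)
  have pos: "0 < emeasure \<mu> (ball x e)" using e ball_pos[OF e, of x] by (simp add: emeasure_ball)
  have s2: "7 / 5 < sqrt 2" by (rule real_less_rsqrt) (simp add: power2_eq_square)
  obtain y where y: "dist x y < e" "AE z in \<mu>. \<forall>r>dist y z. measure \<mu> (ball y (sqrt 2 * r)) \<le> growth_const * measure \<mu> (ball z r)"
    using AE_ex_in_positive[OF almost_everywhere_growth _ pos] by (auto simp: sets_mu)
  obtain z where z: "dist x z < e" "\<forall>r>dist y z. measure \<mu> (ball y (sqrt 2 * r)) \<le> growth_const * measure \<mu> (ball z r)"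
    using AE_ex_in_positive[OF y(2) _ pos] by (auto simp: sets_mu)
  have yz: "dist y z < 10 * e" using y z e dist_triangle[of y z x] by (simp add: dist_commute)
  have "measure \<mu> (ball x (13 * e)) \<le> measure \<mu> (ball y (sqrt 2 * (10 * e)))"
  proof (intro measure_ball_mono subsetI)
    fix w assume "w \<in> ball x (13 * e)"
    then have "dist y w < 14 * e" using y dist_triangle[of y w x] by (simp add: dist_commute)
    also have "14 * e = 7 / 5 * (10 * e)" by simp
    also have "\<dots> < sqrt 2 * (10 * e)" using s2 e by (intro mult_strict_right_mono) auto
    finally show "w \<in> ball y (sqrt 2 * (10 * e))" by simp
  qed (use e in simp)
  also have "\<dots> \<le> growth_const * measure \<mu> (ball z (10 * e))" using z yz by blast
  also have "\<dots> \<le> growth_const * measure \<mu> (ball x (11 * e))"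
  proof (intro mult_left_mono measure_ball_mono subsetI)
    fix w assume "w \<in> ball z (10 * e)"
    then show "w \<in> ball x (11 * e)" using z dist_triangle[of x w z] by simp
  qed (use e c1 c2 in \<open>auto simp: growth_const_def\<close>)
  finally show ?thesis by (simp add: e_def)
qed

text \<open>Five enlargements by \<open>13 / 11\<close> exceed a doubling of the radius.\<close>

lemma doubling_space_exists: "\<exists>A. doubling_space \<mu> A"
proof -
  define A where "A = max 2 (growth_const ^ 5)"
  have it: "measure \<mu> (ball x ((13 / 11) ^ k * r)) \<le> growth_const ^ k * measure \<mu> (ball x r)" if "0 < r" for x k r
  proof (induction k)
    case (Suc k)
    have "measure \<mu> (ball x ((13 / 11) ^ Suc k * r)) \<le> growth_const * measure \<mu> (ball x ((13 / 11) ^ k * r))"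
      using growth[of "(13 / 11) ^ k * r" x] that by (simp add: mult.assoc)
    also have "\<dots> \<le> growth_const * (growth_const ^ k * measure \<mu> (ball x r))"
      using Suc c1 c2 by (intro mult_left_mono) (auto simp: growth_const_def)
    finally show ?case by simp
  qed simp
  have "measure \<mu> (ball x (2 * r)) \<le> A * measure \<mu> (ball x r)" if r: "0 < r" for x r
  proof -
    have "2 * r \<le> (13 / 11) ^ 5 * r" using r by (intro mult_right_mono) (auto simp: power_divide)
    then have "measure \<mu> (ball x (2 * r)) \<le> measure \<mu> (ball x ((13 / 11) ^ 5 * r))"
      using r by (intro measure_ball_mono subset_ball) auto
    also have "\<dots> \<le> growth_const ^ 5 * measure \<mu> (ball x r)" using it r by blast
    also have "\<dots> \<le> A * measure \<mu> (ball x r)" by (intro mult_right_mono) (auto simp: A_def)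
    finally show ?thesis .
  qed
  then have "doubling_space \<mu> A"
    by unfold_locales (auto simp: sets_mu A_def intro: ball_pos ball_finite[unfolded infinity_ennreal_def])
  then show ?thesis by blast
qed

end

section \<open>The subordinated kernel averages at one scale\<close>

lemma subordination_densityD:
  assumes "subordination_density \<alpha> \<eta>"
  shows subordination_nonneg: "0 < t \<Longrightarrow> 0 < s \<Longrightarrow> 0 \<le> \<eta> t s"
    and subordination_continuous: "0 < t \<Longrightarrow> continuous_on {0<..} (\<eta> t)"
    and subordination_mass: "0 < t \<Longrightarrow> (\<integral>\<^sup>+s\<in>{0<..}. ennreal (\<eta> t s) \<partial>lborel) = 1"
    and subordination_scaling: "0 < t \<Longrightarrow> 0 < s \<Longrightarrow> \<eta> t s = t powr (- 1 / \<alpha>) * \<eta> 1 (s / t powr (1 / \<alpha>))"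
    and subordination_negative_moment:
      "0 < \<gamma> \<Longrightarrow> (\<integral>\<^sup>+s\<in>{0<..}. ennreal (s powr (- \<gamma>) * \<eta> 1 s) \<partial>lborel) < \<infinity>"
    and subordination_lower: "\<exists>c>0. \<forall>t>0. \<forall>s\<ge>t powr (1 / \<alpha>). c * (t / s powr (1 + \<alpha>)) \<le> \<eta> t s"
proof -
  have "(\<forall>t>0. \<forall>s>0. 0 \<le> \<eta> t s)" and "\<forall>t>0. continuous_on {0<..} (\<eta> t)"
    and "\<forall>t>0. (\<integral>\<^sup>+s\<in>{0<..}. ennreal (\<eta> t s) \<partial>lborel) = 1"
    and "\<forall>t>0. \<forall>s>0. \<eta> t s = t powr (- 1 / \<alpha>) * \<eta> 1 (s / t powr (1 / \<alpha>))"
    and "\<forall>\<gamma>>0. (\<integral>\<^sup>+s\<in>{0<..}. ennreal (s powr (- \<gamma>) * \<eta> 1 s) \<partial>lborel) < \<infinity>"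
    and *: "\<exists>c>0. \<forall>t>0. \<forall>s\<ge>t powr (1 / \<alpha>). c * (t / s powr (1 + \<alpha>)) \<le> \<eta> t s"
    using assms unfolding subordination_density_def by - (elim conjE, assumption)+
  note this[rule_format]
  then show "0 < t \<Longrightarrow> 0 < s \<Longrightarrow> 0 \<le> \<eta> t s"
    and "0 < t \<Longrightarrow> continuous_on {0<..} (\<eta> t)"
    and "0 < t \<Longrightarrow> (\<integral>\<^sup>+s\<in>{0<..}. ennreal (\<eta> t s) \<partial>lborel) = 1"
    and "0 < t \<Longrightarrow> 0 < s \<Longrightarrow> \<eta> t s = t powr (- 1 / \<alpha>) * \<eta> 1 (s / t powr (1 / \<alpha>))"
    and "0 < \<gamma> \<Longrightarrow> (\<integral>\<^sup>+s\<in>{0<..}. ennreal (s powr (- \<gamma>) * \<eta> 1 s) \<partial>lborel) < \<infinity>"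
    by - assumption+
  show "\<exists>c>0. \<forall>t>0. \<forall>s\<ge>t powr (1 / \<alpha>). c * (t / s powr (1 + \<alpha>)) \<le> \<eta> t s" by (rule *)
qed

lemma subordination_density_measurable:
  assumes "subordination_density \<alpha> \<eta>"
  shows "(\<lambda>(t, s). indicator {0<..} t * (indicator {0<..} s * \<eta> t s)) \<in> borel_measurable (borel \<Otimes>\<^sub>M borel)"
proof -
  have "(\<lambda>s. indicator {0<..} s *\<^sub>R \<eta> 1 s) \<in> borel_measurable borel"
    using assms by (intro borel_measurable_continuous_on_indicator subordination_continuous) auto
  then have [measurable]: "(\<lambda>s. indicator {0<..} s * \<eta> 1 s) \<in> borel_measurable borel" by simp
  have "(\<lambda>(t, s). indicator {0<..} t * (indicator {0<..} s * \<eta> t s))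
    = (\<lambda>z. indicator {0<..} (fst z) * indicator {0<..} (snd z) * (fst z powr (- 1 / \<alpha>) *
        ((\<lambda>s. indicator {0<..} s * \<eta> 1 s) (snd z / fst z powr (1 / \<alpha>)))))"
    (is "_ = ?g")
  proof (intro ext)
    fix z :: "real \<times> real"
    show "(case z of (t, s) \<Rightarrow> indicator {0<..} t * (indicator {0<..} s * \<eta> t s)) = ?g z"
      using subordination_scaling[OF assms, of "fst z" "snd z"]
      by (auto simp: indicator_def split_beta)
  qed
  also have "?g \<in> borel_measurable (borel \<Otimes>\<^sub>M borel)" by measurable
  finally show ?thesis .
qed

text \<open>Scaling turns the moment at time \<open>t\<close> into the negative moment of \<open>\<eta> 1\<close>; in particular it does not
  depend on \<open>t\<close>.\<close>

lemma subordination_moment: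
  assumes eta: "subordination_density \<alpha> \<eta>" and \<gamma>: "0 < \<gamma>"
  obtains m where "0 \<le> m"
    "\<And>t. 0 < t \<Longrightarrow> (\<integral>\<^sup>+s\<in>{0<..}. ennreal (\<eta> t s * (t powr (1 / \<alpha>) / s) powr \<gamma>) \<partial>lborel) = ennreal m"
proof -
  define h where "h = (\<lambda>s. ennreal (s powr (- \<gamma>) * \<eta> 1 s))"
  define m where "m = enn2real (\<integral>\<^sup>+s\<in>{0<..}. h s \<partial>lborel)"
  have fin: "(\<integral>\<^sup>+s\<in>{0<..}. h s \<partial>lborel) < \<infinity>"
    unfolding h_def by (rule subordination_negative_moment[OF eta \<gamma>])
  have "(\<integral>\<^sup>+s\<in>{0<..}. ennreal (\<eta> t s * (t powr (1 / \<alpha>) / s) powr \<gamma>) \<partial>lborel) = ennreal m"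
    if t: "0 < t" for t
  proof -
    define \<tau> where "\<tau> = t powr (1 / \<alpha>)"
    have \<tau>: "0 < \<tau>" using t by (simp add: \<tau>_def)
    have ti: "t powr (- 1 / \<alpha>) = 1 / \<tau>" using t by (simp add: \<tau>_def powr_minus_divide)
    have m1: "(\<lambda>s. indicator {0<..} s * \<eta> t s) \<in> borel_measurable borel"
    proof -
      have "(\<lambda>s. (t, s)) \<in> borel \<rightarrow>\<^sub>M borel \<Otimes>\<^sub>M borel" by simp
      from measurable_compose[OF this subordination_density_measurable[OF eta]] t show ?thesis by simp
    qed
    define g where "g s = ennreal (\<eta> t s * (\<tau> / s) powr \<gamma>) * indicator {0<..} s" for s
    have geq: "g = (\<lambda>s. ennreal ((indicator {0<..} s * \<eta> t s) * (\<tau> / s) powr \<gamma>))"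
      by (auto simp: g_def fun_eq_iff indicator_def)
    have [measurable]: "g \<in> borel_measurable borel" unfolding geq using m1 by measurable
    have "(\<integral>\<^sup>+s. g s \<partial>lborel) = ennreal \<bar>\<tau>\<bar> * (\<integral>\<^sup>+s. g (0 + \<tau> * s) \<partial>lborel)"
      using \<tau> by (intro nn_integral_real_affine) auto
    also have "\<dots> = (\<integral>\<^sup>+s. ennreal \<tau> * g (0 + \<tau> * s) \<partial>lborel)"
      using \<tau> by (subst nn_integral_cmult) auto
    also have "\<dots> = (\<integral>\<^sup>+s\<in>{0<..}. h s \<partial>lborel)"
    proof (intro nn_integral_cong)
      fix s :: real
      show "ennreal \<tau> * g (0 + \<tau> * s) = h s * indicator {0<..} s"
      proof (cases "0 < s")
        case True
        have "\<tau> * (\<eta> t (\<tau> * s) * (\<tau> / (\<tau> * s)) powr \<gamma>) = s powr (- \<gamma>) * \<eta> 1 s"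
          using True \<tau> t subordination_scaling[OF eta, of t "\<tau> * s"]
          by (simp add: ti \<tau>_def[symmetric] powr_minus powr_divide field_simps)
        then show ?thesis using True \<tau> by (simp add: g_def h_def ennreal_mult'[symmetric])
      next
        case False
        then have "\<not> 0 < \<tau> * s" using \<tau> by (simp add: zero_less_mult_iff)
        then show ?thesis using False by (simp add: g_def)
      qed
    qed
    also have "\<dots> = ennreal m" using fin by (simp add: m_def)
    finally show ?thesis by (simp add: g_def \<tau>_def)
  qed
  moreover have "0 \<le> m" by (simp add: m_def)
  ultimately show ?thesis using that by blast
qed

text \<open>All that the capacity estimates use about the kernel: seen from \<open>(t, x)\<close> it is an average at scale
  \<open>\<rho> t\<close> around \<open>x\<close>, up to constants.\<close>

locale averaging_kernel = doubling_space \<mu> A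
  for \<mu> :: "'a::{metric_space,second_countable_topology} measure" and A :: real +
  fixes \<rho> :: "real \<Rightarrow> real" and k :: "real \<Rightarrow> 'a \<Rightarrow> 'a \<Rightarrow> real" and c0 c3 :: real
  assumes scale_pos: "0 < t \<Longrightarrow> 0 < \<rho> t"
    and kernel_measurable: "(\<lambda>(t, x, y). indicator {0<..} t * k t x y) \<in> borel_measurable borel"
    and kernel_nonneg: "0 < t \<Longrightarrow> 0 \<le> k t x y"
    and kernel_upper: "0 < t \<Longrightarrow> f \<in> borel_measurable \<mu> \<Longrightarrow>
      (\<And>R. \<rho> t \<le> R \<Longrightarrow> (\<integral>\<^sup>+y\<in>ball x R. f y \<partial>\<mu>) \<le> S * ennreal (measure \<mu> (ball x R))) \<Longrightarrow>
      (\<integral>\<^sup>+y. ennreal (k t x y) * f y \<partial>\<mu>) \<le> ennreal c0 * S"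
    and kernel_lower: "0 < t \<Longrightarrow> dist x y < \<rho> t \<Longrightarrow> c3 / measure \<mu> (ball x (\<rho> t)) \<le> k t x y"
    and c0_pos: "0 < c0" and c3_pos: "0 < c3"

locale subordinated_kernel = gaussian_heat_kernel \<mu> heat C c1 c2 + doubling_space \<mu> A
  for \<mu> :: "'a::{metric_space,second_countable_topology} measure"
    and heat :: "real \<Rightarrow> 'a \<Rightarrow> 'a \<Rightarrow> real" and C c1 c2 A :: real +
  fixes \<alpha> :: real and \<eta> :: "real \<Rightarrow> real \<Rightarrow> real"
  assumes alpha: "0 < \<alpha>" and eta: "subordination_density \<alpha> \<eta>"
begin

abbreviation scale :: "real \<Rightarrow> real" where "scale t \<equiv> t powr (1 / (2 * \<alpha>))"

lemma scale_squared: "0 < t \<Longrightarrow> (scale t)\<^sup>2 = t powr (1 / \<alpha>)"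
  using alpha by (simp add: powr_power)

lemma eta_nonneg: "0 < t \<Longrightarrow> 0 < s \<Longrightarrow> 0 \<le> \<eta> t s"
  by (rule subordination_nonneg[OF eta])

lemma eta_measurable: "0 < t \<Longrightarrow> (\<lambda>s. indicator {0<..} s * \<eta> t s) \<in> borel_measurable borel"
proof -
  assume t: "0 < t"
  have "(\<lambda>s. (t, s)) \<in> borel \<rightarrow>\<^sub>M borel \<Otimes>\<^sub>M borel" by simp
  from measurable_compose[OF this subordination_density_measurable[OF eta]] t
  show ?thesis by simp
qed

lemma heat_measurable:
  "(\<lambda>(s, x, y). indicator {0<..} s * heat s x y) \<in> borel_measurable borel"
proof -
  have "(\<lambda>(t, x, y). heat t x y) \<in> borel_measurable (restrict_space borel ({0<..} \<times> UNIV))"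
    using heat by (simp add: heat_kernel_def)
  then have "(\<lambda>z. indicator ({0<..} \<times> UNIV) z *\<^sub>R (case z of (t, x, y) \<Rightarrow> heat t x y)) \<in> borel_measurable borel"
    by (subst (asm) borel_measurable_restrict_space_iff)
      (auto intro!: borel_open open_Times)
  also have "(\<lambda>z. indicator ({0<..} \<times> UNIV) z *\<^sub>R (case z of (t, x, y) \<Rightarrow> heat t x y))
    = (\<lambda>(s, x, y). indicator {0<..} s * heat s x y)"
    by (auto simp: fun_eq_iff indicator_def)
  finally show ?thesis .
qed

lemma integrand_measurable:
  "(\<lambda>w. indicator {0<..} (fst (fst w)) * (indicator {0<..} (snd w) * \<eta> (fst (fst w)) (snd w)) *
      (indicator {0<..} (snd w) * heat (snd w) (fst (snd (fst w))) (snd (snd (fst w)))))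
     \<in> borel_measurable (borel \<Otimes>\<^sub>M borel)"
proof -
  have t1: "(\<lambda>w. (fst (fst w), snd w)) \<in> (borel :: (real \<times> 'a \<times> 'a) measure) \<Otimes>\<^sub>M borel \<rightarrow>\<^sub>M borel \<Otimes>\<^sub>M (borel :: real measure)"
    unfolding borel_prod[symmetric] by measurable
  have t2: "(\<lambda>w. (snd w, snd (fst w))) \<in> (borel :: (real \<times> 'a \<times> 'a) measure) \<Otimes>\<^sub>M borel \<rightarrow>\<^sub>M (borel :: (real \<times> 'a \<times> 'a) measure)"
    unfolding borel_prod[symmetric] by measurable
  have "(\<lambda>w. (\<lambda>(t, s). indicator {0<..} t * (indicator {0<..} s * \<eta> t s)) (fst (fst w), snd w) *
      (\<lambda>(s, x, y). indicator {0<..} s * heat s x y) (snd w, snd (fst w)))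
     \<in> borel_measurable ((borel :: (real \<times> 'a \<times> 'a) measure) \<Otimes>\<^sub>M borel)"
    by (intro borel_measurable_times measurable_compose[OF t1 subordination_density_measurable[OF eta]]
        measurable_compose[OF t2 heat_measurable])
  then show ?thesis by (simp add: split_beta mult.assoc)
qed

lemma frac_kernel_measurable:
  "(\<lambda>(t, x, y). indicator {0<..} t * frac_kernel \<eta> heat t x y) \<in> borel_measurable borel"
proof -
  let ?g = "\<lambda>w s. indicator {0<..} (fst w) * (indicator {0<..} s * \<eta> (fst w) s) *
    (indicator {0<..} s * heat s (fst (snd w)) (snd (snd w)))"
  have "sets ((borel :: (real \<times> 'a \<times> 'a) measure) \<Otimes>\<^sub>M lborel) = sets (borel \<Otimes>\<^sub>M (borel :: real measure))"
    by (intro sets_pair_measure_cong) auto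
  note * = measurable_cong_sets[OF this refl]
  have "(\<lambda>(w, s). ?g w s) \<in> borel_measurable (borel \<Otimes>\<^sub>M lborel)"
    using integrand_measurable unfolding * by (simp add: split_beta)
  then have "(\<lambda>w. \<integral>s. ?g w s \<partial>lborel) \<in> borel_measurable borel"
    by (rule lborel.borel_measurable_lebesgue_integral)
  also have "(\<lambda>w. \<integral>s. ?g w s \<partial>lborel)
      = (\<lambda>(t, x, y). indicator {0<..} t * frac_kernel \<eta> heat t x y)"
    by (auto simp: fun_eq_iff frac_kernel_def set_lebesgue_integral_def indicator_def intro!: Bochner_Integration.integral_cong)
  finally show ?thesis .
qed

lemma frac_kernel_integrand_measurable:
  assumes "0 < t"
  shows "(\<lambda>(y, s). indicator {0<..} s * (\<eta> t s * heat s x y)) \<in> borel_measurable (borel \<Otimes>\<^sub>M borel)"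
proof -
  have t1: "(\<lambda>z. ((t, x, fst z), snd z)) \<in> (borel :: 'a measure) \<Otimes>\<^sub>M (borel :: real measure) \<rightarrow>\<^sub>M borel \<Otimes>\<^sub>M borel"
    unfolding borel_prod[symmetric] by measurable
  from measurable_compose[OF t1 integrand_measurable]
  have "(\<lambda>z. (indicator {0<..} (snd z) * \<eta> t (snd z)) * (indicator {0<..} (snd z) * heat (snd z) x (fst z))) \<in> borel_measurable ((borel :: 'a measure) \<Otimes>\<^sub>M (borel :: real measure))"
    using assms by simp
  also have "(\<lambda>z. (indicator {0<..} (snd z) * \<eta> t (snd z)) * (indicator {0<..} (snd z) * heat (snd z) x (fst z)))
    = (\<lambda>(y, s). indicator {0<..} s * (\<eta> t s * heat s x y))"
    by (auto simp: fun_eq_iff indicator_def)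
  finally show ?thesis .
qed

text \<open>Up to the factor \<open>A\<close>, the bracket bounds the ratio of the ball volumes at scale \<open>max (\<surd>s) r\<close> and at
  the random scale \<open>\<surd>s\<close> of the subordinator; its mean is independent of \<open>t\<close> by scaling.\<close>

definition growth_moment :: real where
  "growth_moment = (SOME m. 0 \<le> m \<and> (\<forall>t>0. 
     (\<integral>\<^sup>+s\<in>{0<..}. ennreal (\<eta> t s * (1 + (scale t / sqrt s) powr log 2 A)) \<partial>lborel) = ennreal m))"

lemma growth_moment:
  "0 \<le> growth_moment" 
  "0 < t \<Longrightarrow> (\<integral>\<^sup>+s\<in>{0<..}. ennreal (\<eta> t s * (1 + (scale t / sqrt s) powr log 2 A)) \<partial>lborel) = ennreal growth_moment"
proof -
  define D where "D = log 2 A"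
  have D: "0 < D" using A_ge by (simp add: D_def)
  obtain m where m: "0 \<le> m"
    "\<And>t. 0 < t \<Longrightarrow> (\<integral>\<^sup>+s\<in>{0<..}. ennreal (\<eta> t s * (t powr (1 / \<alpha>) / s) powr (D / 2)) \<partial>lborel) = ennreal m"
    using subordination_moment[OF eta, of "D / 2"] D by auto
  have "(\<integral>\<^sup>+s\<in>{0<..}. ennreal (\<eta> t s * (1 + (scale t / sqrt s) powr D)) \<partial>lborel) = ennreal (1 + m)"
    if t: "0 < t" for t
  proof -
    have pw: "(scale t / sqrt s) powr D = (t powr (1 / \<alpha>) / s) powr (D / 2)" if "0 < s" for s
    proof -
      have "t powr (1 / \<alpha>) / s = (scale t / sqrt s) powr 2"
        using that t scale_squared[OF t] by (simp add: power_divide)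
      then show ?thesis by (simp add: powr_powr)
    qed
    have [measurable]: "(\<lambda>s. indicator {0<..} s * \<eta> t s) \<in> borel_measurable borel" by (rule eta_measurable[OF t])
    have "(\<integral>\<^sup>+s\<in>{0<..}. ennreal (\<eta> t s * (1 + (scale t / sqrt s) powr D)) \<partial>lborel)
      = (\<integral>\<^sup>+s. ennreal (indicator {0<..} s * \<eta> t s) + ennreal (indicator {0<..} s * \<eta> t s * (t powr (1 / \<alpha>) / s) powr (D / 2)) \<partial>lborel)"
      using eta_nonneg[OF t] pw
      by (intro nn_integral_cong) (auto simp: indicator_def distrib_left ennreal_plus[symmetric] simp del: ennreal_plus)
    also have "\<dots> = (\<integral>\<^sup>+s. ennreal (indicator {0<..} s * \<eta> t s) \<partial>lborel)
        + (\<integral>\<^sup>+s. ennreal (indicator {0<..} s * \<eta> t s * (t powr (1 / \<alpha>) / s) powr (D / 2)) \<partial>lborel)"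
      by (intro nn_integral_add) auto
    also have "(\<integral>\<^sup>+s. ennreal (indicator {0<..} s * \<eta> t s) \<partial>lborel) = (\<integral>\<^sup>+s\<in>{0<..}. ennreal (\<eta> t s) \<partial>lborel)"
      by (intro nn_integral_cong) (auto simp: indicator_def)
    also have "\<dots> = 1" by (rule subordination_mass[OF eta t])
    also have "(\<integral>\<^sup>+s. ennreal (indicator {0<..} s * \<eta> t s * (t powr (1 / \<alpha>) / s) powr (D / 2)) \<partial>lborel)
       = (\<integral>\<^sup>+s\<in>{0<..}. ennreal (\<eta> t s * (t powr (1 / \<alpha>) / s) powr (D / 2)) \<partial>lborel)"
      by (intro nn_integral_cong) (auto simp: indicator_def)
    also have "\<dots> = ennreal m" by (rule m(2)[OF t])
    finally show ?thesis using m(1) by (simp add: ennreal_plus)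
  qed
  then have "\<exists>m. 0 \<le> m \<and> (\<forall>t>0. 
     (\<integral>\<^sup>+s\<in>{0<..}. ennreal (\<eta> t s * (1 + (scale t / sqrt s) powr log 2 A)) \<partial>lborel) = ennreal m)"
    using m(1) by (intro exI[of _ "1 + m"]) (auto simp: D_def)
  from someI_ex[OF this, folded growth_moment_def]
  show "0 \<le> growth_moment" 
    "0 < t \<Longrightarrow> (\<integral>\<^sup>+s\<in>{0<..}. ennreal (\<eta> t s * (1 + (scale t / sqrt s) powr log 2 A)) \<partial>lborel) = ennreal growth_moment"
    by auto
qed

lemma ball_ratio:
  assumes r: "0 < r" and s: "0 < s"
  shows "measure \<mu> (ball x (max (sqrt s) r)) \<le> A * (1 + (r / sqrt s) powr log 2 A) * measure \<mu> (ball x (sqrt s))"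
proof -
  have "measure \<mu> (ball x (max (sqrt s) r))
      \<le> A * (max (sqrt s) r / sqrt s) powr log 2 A * measure \<mu> (ball x (sqrt s))"
    using s by (intro ball_growth) auto
  also have "(max (sqrt s) r / sqrt s) powr log 2 A \<le> 1 + (r / sqrt s) powr log 2 A"
    using s r by (cases "sqrt s \<le> r") (auto simp: max_def)
  finally show ?thesis using A_ge by (simp add: mult_left_mono mult_right_mono)
qed

text \<open>The Bochner integral defining the kernel has junk value zero if it diverges.  It converges at every
  point, because \<open>p\<^sub>s(x, y)\<close> is at most a constant over \<open>\<mu>(B(x, r))\<close> times a bound for the volume
  ratio that has finite mean.\<close>

lemma ennreal_frac_kernel:
  assumes t: "0 < t"
  shows "ennreal (frac_kernel \<eta> heat t x y) = (\<integral>\<^sup>+s. ennreal (indicator {0<..} s * (\<eta> t s * heat s x y)) \<partial>lborel)"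
proof -
  define r where "r = scale t"
  have r: "0 < r" using t by (simp add: r_def)
  have t1: "(\<lambda>s. (y, s)) \<in> borel \<rightarrow>\<^sub>M borel \<Otimes>\<^sub>M borel" by simp
  have m: "(\<lambda>s. indicator {0<..} s * (\<eta> t s * heat s x y)) \<in> borel_measurable lborel"
    using measurable_compose[OF t1 frac_kernel_integrand_measurable[OF t, of x]] by simp
  define V where "V = measure \<mu> (ball x r)"
  have V: "0 < V" using r unfolding V_def by (rule ball_pos)
  have "(\<integral>\<^sup>+s. ennreal (indicator {0<..} s * (\<eta> t s * heat s x y)) \<partial>lborel)
    \<le> (\<integral>\<^sup>+s. ennreal (c2 * A / V) * (ennreal (\<eta> t s * (1 + (r / sqrt s) powr log 2 A)) * indicator {0<..} s) \<partial>lborel)"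
  proof (intro nn_integral_mono)
    fix s :: real
    show "ennreal (indicator {0<..} s * (\<eta> t s * heat s x y))
      \<le> ennreal (c2 * A / V) * (ennreal (\<eta> t s * (1 + (r / sqrt s) powr log 2 A)) * indicator {0<..} s)"
    proof (cases "0 < s")
      case True
      define W where "W = measure \<mu> (ball x (sqrt s))"
      have W: "0 < W" unfolding W_def using True by (intro ball_pos) auto
      have "V \<le> measure \<mu> (ball x (max (sqrt s) r))"
        unfolding V_def using r by (intro measure_ball_mono subset_ball) auto
      also have "\<dots> \<le> A * (1 + (r / sqrt s) powr log 2 A) * W"
        unfolding W_def by (rule ball_ratio[OF r True])
      finally have VW: "1 / W \<le> A * (1 + (r / sqrt s) powr log 2 A) / V" using V W by (simp add: field_simps)
      have "heat s x y \<le> c2 * exp (- C * (dist x y)\<^sup>2 / s) / W"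
        unfolding W_def by (rule heat_upper[OF True])
      also have "\<dots> \<le> c2 * 1 * (1 / W)" using c2 W C True
        by (simp add: divide_right_mono)
      also have "\<dots> \<le> c2 * 1 * (A * (1 + (r / sqrt s) powr log 2 A) / V)"
        using VW c2 by (intro mult_left_mono) auto
      finally have "\<eta> t s * heat s x y \<le> \<eta> t s * (c2 * A / V * (1 + (r / sqrt s) powr log 2 A))"
        using eta_nonneg[OF t True] by (intro mult_left_mono) (auto simp: mult.assoc)
      also have "\<dots> = c2 * A / V * (\<eta> t s * (1 + (r / sqrt s) powr log 2 A))" by simp
      finally show ?thesis
        using True V A_ge c2 by (simp add: ennreal_mult'[symmetric] ennreal_leI)
    qed simp
  qed
  also have "\<dots> = ennreal (c2 * A / V) * (\<integral>\<^sup>+s\<in>{0<..}. ennreal (\<eta> t s * (1 + (r / sqrt s) powr log 2 A)) \<partial>lborel)"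
  proof (rule nn_integral_cmult)
    have [measurable]: "(\<lambda>s. indicator {0<..} s * \<eta> t s) \<in> borel_measurable borel" by (rule eta_measurable[OF t])
    have "(\<lambda>s. ennreal (\<eta> t s * (1 + (r / sqrt s) powr log 2 A)) * indicator {0<..} s)
      = (\<lambda>s. ennreal ((indicator {0<..} s * \<eta> t s) * (1 + (r / sqrt s) powr log 2 A)))"
      by (auto simp: fun_eq_iff indicator_def)
    then show "(\<lambda>s. ennreal (\<eta> t s * (1 + (r / sqrt s) powr log 2 A)) * indicator {0<..} s) \<in> borel_measurable lborel"
      by simp
  qed
  also have "\<dots> < \<infinity>" unfolding r_def growth_moment(2)[OF t] by (simp add: ennreal_mult_less_top)
  finally have fin: "(\<integral>\<^sup>+s. ennreal (indicator {0<..} s * (\<eta> t s * heat s x y)) \<partial>lborel) < \<infinity>" .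
  have nn: "0 \<le> indicator {0<..} s * (\<eta> t s * heat s x y)" for s
    using eta_nonneg[OF t, of s] heat_pos[of s x y] by (auto simp: indicator_def)
  have "frac_kernel \<eta> heat t x y = enn2real (\<integral>\<^sup>+s. ennreal (indicator {0<..} s * (\<eta> t s * heat s x y)) \<partial>lborel)"
    unfolding frac_kernel_def set_lebesgue_integral_def real_scaleR_def
    using m nn by (intro integral_eq_nn_integral) auto
  then show ?thesis using fin by simp
qed

lemma frac_kernel_nonneg: "0 < t \<Longrightarrow> 0 \<le> frac_kernel \<eta> heat t x y"
  unfolding frac_kernel_def set_lebesgue_integral_def
  using eta_nonneg[of t] heat_pos[of _ x y]
  by (intro Bochner_Integration.integral_nonneg) (auto simp: indicator_def intro!: mult_nonneg_nonneg intro: less_imp_le)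

text \<open>The times \<open>s\<close> between \<open>r\<^sup>2\<close> and \<open>2 r\<^sup>2\<close> have subordination mass bounded below, and for these
  \<open>p\<^sub>s(x, y)\<close> is comparable to \<open>1 / \<mu>(B(x, r))\<close> when \<open>d(x, y) < r\<close>.\<close>

lemma frac_kernel_lower:
  "\<exists>c3>0. \<forall>t>0. \<forall>x y. dist x y < scale t \<longrightarrow> c3 / measure \<mu> (ball x (scale t)) \<le> frac_kernel \<eta> heat t x y"
proof -
  obtain c where c: "0 < c" and lower: "\<And>t s. 0 < t \<Longrightarrow> t powr (1 / \<alpha>) \<le> s \<Longrightarrow> c * (t / s powr (1 + \<alpha>)) \<le> \<eta> t s"
    using subordination_lower[OF eta] by blast
  define c3 where "c3 = c * 2 powr (- (1 + \<alpha>)) * c1 * exp (- C) / A"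
  have c3: "0 < c3" using c c1 A_ge by (simp add: c3_def)
  have "c3 / measure \<mu> (ball x (scale t)) \<le> frac_kernel \<eta> heat t x y"
    if t: "0 < t" and d: "dist x y < scale t" for t x y
  proof -
    define r \<tau> V where "r = scale t" and "\<tau> = t powr (1 / \<alpha>)" and "V = measure \<mu> (ball x r)"
    have pos: "0 < r" "0 < \<tau>" using t by (auto simp: r_def \<tau>_def)
    have V: "0 < V" unfolding V_def by (rule ball_pos[OF pos(1)])
    have r2: "r\<^sup>2 = \<tau>" using scale_squared[OF t] by (simp add: r_def \<tau>_def)
    have t\<tau>: "t = \<tau> powr \<alpha>" using t alpha by (simp add: \<tau>_def powr_powr)
    have pt: "c3 / (\<tau> * V) \<le> \<eta> t s * heat s x y" if s: "\<tau> \<le> s" "s \<le> 2 * \<tau>" for s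
    proof -
      have s0: "0 < s" using s pos by linarith
      have "c * 2 powr (- (1 + \<alpha>)) / \<tau> = c * (t / (2 * \<tau>) powr (1 + \<alpha>))"
      proof -
        have "(2 * \<tau>) powr (1 + \<alpha>) = 2 powr (1 + \<alpha>) * (\<tau> * t)"
          using pos t\<tau> by (simp add: powr_mult powr_add)
        then show ?thesis unfolding powr_minus_divide using pos t by simp
      qed
      also have "\<dots> \<le> c * (t / s powr (1 + \<alpha>))"
        using s s0 c t alpha by (intro mult_left_mono divide_left_mono powr_mono2) auto
      also have "\<dots> \<le> \<eta> t s" using lower[OF t] s by (simp add: \<tau>_def)
      finally have e: "c * 2 powr (- (1 + \<alpha>)) / \<tau> \<le> \<eta> t s" .
      have "sqrt s \<le> 2 * r"
      proof (rule real_le_lsqrt)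
        show "s \<le> (2 * r)\<^sup>2" using s r2 pos by (simp add: power_mult_distrib)
      qed (use s0 pos in auto)
      then have "measure \<mu> (ball x (sqrt s)) \<le> measure \<mu> (ball x (2 * r))"
        using pos by (intro measure_ball_mono subset_ball) auto
      also have "\<dots> \<le> A * V" unfolding V_def by (rule doubling[OF pos(1)])
      finally have W: "measure \<mu> (ball x (sqrt s)) \<le> A * V" .
      have W0: "0 < measure \<mu> (ball x (sqrt s))" using s0 by (intro ball_pos) auto
      have "(dist x y)\<^sup>2 \<le> r\<^sup>2" using d by (intro power_mono) (auto simp: r_def)
      then have "(dist x y)\<^sup>2 \<le> s" using r2 s by simp
      then have "exp (- C) \<le> exp (- C * (dist x y)\<^sup>2 / s)" using C s0 by (simp add: field_simps)
      then have "c1 * exp (- C) / (A * V) \<le> c1 * exp (- C * (dist x y)\<^sup>2 / s) / measure \<mu> (ball x (sqrt s))"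
        using W W0 c1 by (intro frac_le mult_left_mono) auto
      also have "\<dots> \<le> heat s x y" by (rule heat_lower[OF s0])
      finally have h: "c1 * exp (- C) / (A * V) \<le> heat s x y" .
      have "c3 / (\<tau> * V) = (c * 2 powr (- (1 + \<alpha>)) / \<tau>) * (c1 * exp (- C) / (A * V))"
        by (simp add: c3_def ac_simps)
      also have "\<dots> \<le> \<eta> t s * heat s x y"
        using e h eta_nonneg[OF t s0] c1 A_ge V by (intro mult_mono) auto
      finally show ?thesis .
    qed
    have "ennreal (c3 / V) = ennreal (c3 / (\<tau> * V)) * emeasure lborel {\<tau>..2 * \<tau>}"
      using pos V c3 by (simp add: ennreal_mult[symmetric])
    also have "\<dots> = (\<integral>\<^sup>+s. ennreal (c3 / (\<tau> * V)) * indicator {\<tau>..2 * \<tau>} s \<partial>lborel)"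
      by (simp add: nn_integral_cmult_indicator)
    also have "\<dots> \<le> (\<integral>\<^sup>+s. ennreal (indicator {0<..} s * (\<eta> t s * heat s x y)) \<partial>lborel)"
      using pt pos by (intro nn_integral_mono) (auto simp: indicator_def intro!: ennreal_leI)
    also have "\<dots> = ennreal (frac_kernel \<eta> heat t x y)" by (rule ennreal_frac_kernel[OF t, symmetric])
    finally have "c3 / V \<le> frac_kernel \<eta> heat t x y"
      using frac_kernel_nonneg[OF t] by (subst (asm) ennreal_le_iff) auto
    then show ?thesis by (simp add: V_def r_def)
  qed
  with c3 show ?thesis by blast
qed

text \<open>For fixed \<open>s\<close>, enlarge the Gaussian to scale \<open>\<sigma> = max (\<surd>s) r\<close>, so that only balls of radius at least
  \<open>r\<close> enter.  The price is the ratio of the volumes at scales \<open>\<sigma>\<close> and \<open>\<surd>s\<close>, whose mean with respect to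
  \<open>\<eta> t\<close> is finite.\<close>

lemma frac_kernel_upper:
  "\<exists>c0>0. \<forall>t>0. \<forall>x S. \<forall>f\<in>borel_measurable \<mu>.
     (\<forall>R\<ge>scale t. (\<integral>\<^sup>+y\<in>ball x R. f y \<partial>\<mu>) \<le> S * ennreal (measure \<mu> (ball x R))) \<longrightarrow>
     (\<integral>\<^sup>+y. ennreal (frac_kernel \<eta> heat t x y) * f y \<partial>\<mu>) \<le> ennreal c0 * S"
proof -
  obtain N where N: "0 < N" and gav0: "\<forall>f\<in>borel_measurable \<mu>. \<forall>S x \<rho>. 0 < \<rho> \<longrightarrow>
       (\<forall>R\<ge>\<rho>. (\<integral>\<^sup>+y\<in>ball x R. f y \<partial>\<mu>) \<le> S * ennreal (measure \<mu> (ball x R))) \<longrightarrow>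
       (\<integral>\<^sup>+y. ennreal (exp (- C * (dist x y / \<rho>)\<^sup>2)) * f y \<partial>\<mu>) \<le> ennreal N * S * ennreal (measure \<mu> (ball x \<rho>))"
    using gaussian_average[OF C] by (elim exE conjE) (rule that)
  note gav = gav0[rule_format]
  define c0 where "c0 = c2 * N * A * (1 + growth_moment)"
  have c0: "0 < c0" using c2 N A_ge growth_moment(1) by (simp add: c0_def)
  interpret mu: sigma_finite_measure \<mu> by (rule sigma_finite)
  interpret pair_sigma_finite lborel \<mu> ..
  have "(\<integral>\<^sup>+y. ennreal (frac_kernel \<eta> heat t x y) * f y \<partial>\<mu>) \<le> ennreal c0 * S"
    if t: "0 < t" and f[measurable]: "f \<in> borel_measurable \<mu>"
      and av: "\<And>R. scale t \<le> R \<Longrightarrow> (\<integral>\<^sup>+y\<in>ball x R. f y \<partial>\<mu>) \<le> S * ennreal (measure \<mu> (ball x R))" for t x S f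
  proof -
    define r where "r = scale t"
    have r: "0 < r" using t by (simp add: r_def)
    have [measurable]: "(\<lambda>s. indicator {0<..} s * \<eta> t s) \<in> borel_measurable borel" by (rule eta_measurable[OF t])
    have m0: "(\<lambda>(s, y). ennreal (indicator {0<..} s * (\<eta> t s * heat s x y))) \<in> borel_measurable (lborel \<Otimes>\<^sub>M \<mu>)"
    proof -
      have sw: "(\<lambda>z. (snd z, fst z)) \<in> lborel \<Otimes>\<^sub>M \<mu> \<rightarrow>\<^sub>M borel \<Otimes>\<^sub>M (borel :: real measure)"
        using sets_mu by (intro measurable_Pair) (auto cong: measurable_cong_sets)
      from measurable_compose[OF sw frac_kernel_integrand_measurable[OF t, of x]]
      show ?thesis by (simp add: split_beta)
    qed
    have m1: "(\<lambda>(s, y). ennreal (indicator {0<..} s * (\<eta> t s * heat s x y)) * f y) \<in> borel_measurable (lborel \<Otimes>\<^sub>M \<mu>)"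
    proof -
      have "(\<lambda>z. f (snd z)) \<in> borel_measurable (lborel \<Otimes>\<^sub>M \<mu>)" by measurable
      from borel_measurable_times_ennreal[OF m0 this] show ?thesis by (simp add: split_beta)
    qed
    have slice: "(\<integral>\<^sup>+y. ennreal (heat s x y) * f y \<partial>\<mu>) \<le> ennreal (c2 * N * A * (1 + (r / sqrt s) powr log 2 A)) * S"
      if s: "0 < s" for s
    proof -
      \<comment> \<open>Averages are controlled only from radius \<open>r\<close> on, while \<open>\<surd>s\<close> may be smaller.\<close>
      define \<sigma> W where "\<sigma> = max (sqrt s) r" and "W = measure \<mu> (ball x (sqrt s))"
      have \<sigma>: "0 < \<sigma>" "r \<le> \<sigma>" "s \<le> \<sigma>\<^sup>2" using r s
        by (auto simp: \<sigma>_def less_max_iff_disj) (metis max.cobounded1 real_sqrt_le_iff real_sqrt_unique abs_of_nonneg abs_le_square_iff real_sqrt_abs real_sqrt_pow2 less_imp_le power_mono real_sqrt_ge_zero)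
      have W: "0 < W" unfolding W_def using s by (intro ball_pos) auto
      have "(\<integral>\<^sup>+y. ennreal (heat s x y) * f y \<partial>\<mu>)
        \<le> (\<integral>\<^sup>+y. ennreal (c2 / W) * (ennreal (exp (- C * (dist x y / \<sigma>)\<^sup>2)) * f y) \<partial>\<mu>)"
      proof (intro nn_integral_mono)
        fix y
        have "(dist x y)\<^sup>2 / \<sigma>\<^sup>2 \<le> (dist x y)\<^sup>2 / s" using \<sigma> s by (intro divide_left_mono) auto
        then have "C * ((dist x y)\<^sup>2 / \<sigma>\<^sup>2) \<le> C * ((dist x y)\<^sup>2 / s)"
          using C by (intro mult_left_mono) auto
        then have "exp (- C * (dist x y)\<^sup>2 / s) \<le> exp (- C * (dist x y / \<sigma>)\<^sup>2)"
          by (simp add: power_divide)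
        then have "c2 * exp (- C * (dist x y)\<^sup>2 / s) / W \<le> c2 * exp (- C * (dist x y / \<sigma>)\<^sup>2) / W"
          using c2 W by (intro divide_right_mono mult_left_mono) auto
        then have "heat s x y \<le> c2 / W * exp (- C * (dist x y / \<sigma>)\<^sup>2)"
          using heat_upper[OF s, of x y] by (simp add: W_def)
        then have "ennreal (heat s x y) \<le> ennreal (c2 / W) * ennreal (exp (- C * (dist x y / \<sigma>)\<^sup>2))"
          using c2 W by (simp add: ennreal_mult[symmetric] ennreal_leI)
        then show "ennreal (heat s x y) * f y \<le> ennreal (c2 / W) * (ennreal (exp (- C * (dist x y / \<sigma>)\<^sup>2)) * f y)"
          by (simp add: mult.assoc[symmetric] mult_right_mono)
      qed
      also have "\<dots> = ennreal (c2 / W) * (\<integral>\<^sup>+y. ennreal (exp (- C * (dist x y / \<sigma>)\<^sup>2)) * f y \<partial>\<mu>)"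
      proof (rule nn_integral_cmult)
        have "(\<lambda>y. dist x y) \<in> borel_measurable \<mu>"
          using sets_mu by (subst measurable_cong_sets[OF sets_mu refl]) simp
        then show "(\<lambda>y. ennreal (exp (- C * (dist x y / \<sigma>)\<^sup>2)) * f y) \<in> borel_measurable \<mu>" by simp
      qed
      also have "\<dots> \<le> ennreal (c2 / W) * (ennreal N * S * ennreal (measure \<mu> (ball x \<sigma>)))"
        using \<sigma> av by (intro mult_left_mono gav) (auto simp: r_def)
      also have "\<dots> \<le> ennreal (c2 / W) * (ennreal N * S * ennreal (A * (1 + (r / sqrt s) powr log 2 A) * W))"
        using ball_ratio[OF r s, of x] unfolding \<sigma>_def W_def by (intro mult_left_mono ennreal_leI) auto
      also have "\<dots> = ennreal (c2 / W) * ennreal N * ennreal (A * (1 + (r / sqrt s) powr log 2 A) * W) * S"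
        by (simp add: ac_simps)
      also have "ennreal (c2 / W) * ennreal N * ennreal (A * (1 + (r / sqrt s) powr log 2 A) * W)
        = ennreal (c2 / W * N * (A * (1 + (r / sqrt s) powr log 2 A) * W))"
        using c2 W N A_ge
        by (subst ennreal_mult[symmetric], simp, simp, subst ennreal_mult[symmetric]) auto
      also have "c2 / W * N * (A * (1 + (r / sqrt s) powr log 2 A) * W) = c2 * N * A * (1 + (r / sqrt s) powr log 2 A)"
        using W by simp
      finally show ?thesis .
    qed
    have "(\<integral>\<^sup>+y. ennreal (frac_kernel \<eta> heat t x y) * f y \<partial>\<mu>)
      = (\<integral>\<^sup>+y. \<integral>\<^sup>+s. ennreal (indicator {0<..} s * (\<eta> t s * heat s x y)) * f y \<partial>lborel \<partial>\<mu>)"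
    proof (intro nn_integral_cong)
      fix y :: 'a
      have t1: "(\<lambda>s. (y, s)) \<in> borel \<rightarrow>\<^sub>M borel \<Otimes>\<^sub>M borel" by simp
      have "(\<lambda>s. indicator {0<..} s * (\<eta> t s * heat s x y)) \<in> borel_measurable lborel"
        using measurable_compose[OF t1 frac_kernel_integrand_measurable[OF t, of x]] by simp
      then show "ennreal (frac_kernel \<eta> heat t x y) * f y
        = (\<integral>\<^sup>+s. ennreal (indicator {0<..} s * (\<eta> t s * heat s x y)) * f y \<partial>lborel)"
        by (simp add: ennreal_frac_kernel[OF t] nn_integral_multc)
    qed
    also have "\<dots> = (\<integral>\<^sup>+s. \<integral>\<^sup>+y. ennreal (indicator {0<..} s * (\<eta> t s * heat s x y)) * f y \<partial>\<mu> \<partial>lborel)"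
      using m1 by (rule Fubini')
    also have "\<dots> \<le> (\<integral>\<^sup>+s. ennreal (c2 * N * A) * S * (ennreal (\<eta> t s * (1 + (r / sqrt s) powr log 2 A)) * indicator {0<..} s) \<partial>lborel)"
    proof (intro nn_integral_mono)
      fix s :: real
      show "(\<integral>\<^sup>+y. ennreal (indicator {0<..} s * (\<eta> t s * heat s x y)) * f y \<partial>\<mu>)
        \<le> ennreal (c2 * N * A) * S * (ennreal (\<eta> t s * (1 + (r / sqrt s) powr log 2 A)) * indicator {0<..} s)"
      proof (cases "0 < s")
        case True
        have [measurable]: "(\<lambda>y. ennreal (heat s x y)) \<in> borel_measurable \<mu>"
        proof -
          have "(\<lambda>y. (s, x, y)) \<in> \<mu> \<rightarrow>\<^sub>M borel"
            unfolding borel_prod[symmetric] using sets_mu by (intro measurable_Pair) (auto cong: measurable_cong_sets)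
          from measurable_compose[OF this heat_measurable] True show ?thesis by simp
        qed
        have "(\<integral>\<^sup>+y. ennreal (indicator {0<..} s * (\<eta> t s * heat s x y)) * f y \<partial>\<mu>)
          = (\<integral>\<^sup>+y. ennreal (\<eta> t s) * (ennreal (heat s x y) * f y) \<partial>\<mu>)"
          using True eta_nonneg[OF t True] by (intro nn_integral_cong) (simp add: ennreal_mult' mult.assoc)
        also have "\<dots> = ennreal (\<eta> t s) * (\<integral>\<^sup>+y. ennreal (heat s x y) * f y \<partial>\<mu>)"
          by (rule nn_integral_cmult) measurable
        also have "\<dots> \<le> ennreal (\<eta> t s) * (ennreal (c2 * N * A * (1 + (r / sqrt s) powr log 2 A)) * S)"
          by (intro mult_left_mono slice True) auto
        also have "\<dots> = (ennreal (\<eta> t s) * ennreal (c2 * N * A * (1 + (r / sqrt s) powr log 2 A))) * S"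
          by (simp add: mult.assoc)
        also have "ennreal (\<eta> t s) * ennreal (c2 * N * A * (1 + (r / sqrt s) powr log 2 A))
          = ennreal (c2 * N * A) * ennreal (\<eta> t s * (1 + (r / sqrt s) powr log 2 A))"
          using eta_nonneg[OF t True] c2 N A_ge by (simp add: ennreal_mult[symmetric])
        finally show ?thesis using True by (simp add: ac_simps)
      qed simp
    qed
    also have "\<dots> = ennreal (c2 * N * A) * S * (\<integral>\<^sup>+s\<in>{0<..}. ennreal (\<eta> t s * (1 + (r / sqrt s) powr log 2 A)) \<partial>lborel)"
    proof (rule nn_integral_cmult)
      have "(\<lambda>s. ennreal (\<eta> t s * (1 + (r / sqrt s) powr log 2 A)) * indicator {0<..} s)
        = (\<lambda>s. ennreal ((indicator {0<..} s * \<eta> t s) * (1 + (r / sqrt s) powr log 2 A)))"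
        by (auto simp: fun_eq_iff indicator_def)
      then show "(\<lambda>s. ennreal (\<eta> t s * (1 + (r / sqrt s) powr log 2 A)) * indicator {0<..} s) \<in> borel_measurable lborel"
        by simp
    qed
    also have "\<dots> = ennreal (c2 * N * A) * S * ennreal growth_moment"
      unfolding r_def growth_moment(2)[OF t] ..
    also have "\<dots> = ennreal (c2 * N * A * growth_moment) * S"
      using c2 N A_ge growth_moment(1) by (simp add: ennreal_mult ac_simps)
    also have "\<dots> \<le> ennreal c0 * S"
      using c2 N A_ge growth_moment(1) unfolding c0_def by (intro mult_right_mono ennreal_leI mult_left_mono) auto
    finally show ?thesis .
  qed
  with c0 show ?thesis by blast
qed

lemma averaging_kernel_exists: "\<exists>c0 c3. averaging_kernel \<mu> A scale (frac_kernel \<eta> heat) c0 c3"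
proof -
  obtain c0 where c0: "0 < c0" "\<And>t x S f. 0 < t \<Longrightarrow> f \<in> borel_measurable \<mu> \<Longrightarrow>
     (\<And>R. scale t \<le> R \<Longrightarrow> (\<integral>\<^sup>+y\<in>ball x R. f y \<partial>\<mu>) \<le> S * ennreal (measure \<mu> (ball x R))) \<Longrightarrow>
     (\<integral>\<^sup>+y. ennreal (frac_kernel \<eta> heat t x y) * f y \<partial>\<mu>) \<le> ennreal c0 * S"
    using frac_kernel_upper by blast
  obtain c3 where c3: "0 < c3" "\<And>t x y. 0 < t \<Longrightarrow> dist x y < scale t \<Longrightarrow> c3 / measure \<mu> (ball x (scale t)) \<le> frac_kernel \<eta> heat t x y"
    using frac_kernel_lower by blast
  have "averaging_kernel \<mu> A scale (frac_kernel \<eta> heat) c0 c3"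
    using c0 c3 frac_kernel_measurable frac_kernel_nonneg by unfold_locales auto
  then show ?thesis by blast
qed

end

section \<open>Sums over dyadic levels\<close>

lemma nn_integral_count_space_int_le:
  fixes g :: "int \<Rightarrow> ennreal"
  assumes "\<And>J. finite J \<Longrightarrow> (\<Sum>j\<in>J. g j) \<le> M"
  shows "(\<integral>\<^sup>+j. g j \<partial>count_space UNIV) \<le> M"
proof -
  have "(\<integral>\<^sup>+j. g j \<partial>count_space UNIV) = (\<integral>\<^sup>+n. g (int_decode n) \<partial>count_space UNIV)"
    by (rule nn_integral_bij_count_space[symmetric]) (rule bij_int_decode)
  also have "\<dots> = (\<Sum>n. g (int_decode n))" by (rule nn_integral_count_space_nat)
  also have "\<dots> \<le> M"
  proof (rule suminf_le_const)
    fix n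
    have "(\<Sum>i<n. g (int_decode i)) = (\<Sum>j\<in>int_decode ` {..<n}. g j)"
      by (subst sum.reindex) (auto intro: inj_on_subset[OF inj_int_decode])
    then show "(\<Sum>i<n. g (int_decode i)) \<le> M" using assms by simp
  qed auto
  finally show ?thesis .
qed

text \<open>The sets \<open>{g \<ge> b\<^sub>j}\<close> overlap and \<open>b\<close> may fail to be monotone, so \<open>g\<close> is sliced horizontally: below the height \<open>h = b\<^sub>m\<close> of the largest
  index \<open>m\<close>, the weights add up to at most \<open>2 \<cdot> 2\<^sup>m\<close>, which \<open>{g \<ge> h}\<close> pays for; above \<open>h\<close> only smaller
  indices are left, with \<open>g - h\<close> in place of \<open>g\<close>.\<close>

lemma dyadic_levels_le_nn_integral:
  fixes g :: "'b \<Rightarrow> real" and b :: "int \<Rightarrow> real" and J :: "int set"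
  assumes "finite J" and "g \<in> borel_measurable N" and "\<And>j. j \<in> J \<Longrightarrow> 0 \<le> b j"
    and "\<And>j. j \<in> J \<Longrightarrow> ennreal (2 powr j) \<le> emeasure N {z \<in> space N. b j \<le> g z}"
  shows "ennreal (\<Sum>j\<in>J. 2 powr j * b j) \<le> 2 * (\<integral>\<^sup>+z. ennreal (g z) \<partial>N)"
  using assms
proof (induction "card J" arbitrary: J g b rule: less_induct)
  case less
  note [measurable] = less.prems(2)
  show ?case
  proof (cases "J = {}")
    case False
    define m h where "m = Max J" and "h = b m"
    have m: "m \<in> J" "\<And>j. j \<in> J \<Longrightarrow> j \<le> m" using less.prems(1) False by (auto simp: m_def)
    have h: "0 \<le> h" using less.prems(3) m by (simp add: h_def)
    define J' where "J' = {j \<in> J. h < b j}"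
    have J': "J' \<subseteq> J" "m \<notin> J'" "finite J'" using less.prems(1) by (auto simp: J'_def h_def)
    have "J' \<subset> J" using J' m by blast
    then have "card J' < card J" by (rule psubset_card_mono[OF less.prems(1)])
    then have IH: "ennreal (\<Sum>j\<in>J'. 2 powr j * (b j - h)) \<le> 2 * (\<integral>\<^sup>+z. ennreal (g z - h) \<partial>N)"
      using less.prems(4) J' by (intro less.hyps) (auto simp: J'_def)
    have "(\<Sum>j\<in>J. 2 powr (1 * real_of_int j)) \<le> 2 powr m / (1 - 2 powr - 1)"
      using less.prems(1) m(2) by (intro dyadic_sum_le_largest) auto
    then have geo: "(\<Sum>j\<in>J. 2 powr j) \<le> 2 * 2 powr m" by (simp add: powr_minus)
    have "(\<Sum>j\<in>J. 2 powr j * b j) \<le> (\<Sum>j\<in>J. 2 powr j * h + (if h < b j then 2 powr j * (b j - h) else 0))"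
      by (intro sum_mono) (auto simp: algebra_simps)
    also have "\<dots> = (\<Sum>j\<in>J. 2 powr j) * h + (\<Sum>j\<in>J'. 2 powr j * (b j - h))"
      unfolding J'_def by (simp add: sum.distrib sum_distrib_right sum.inter_filter[OF less.prems(1)])
    also have "\<dots> \<le> 2 * 2 powr m * h + (\<Sum>j\<in>J'. 2 powr j * (b j - h))"
      using geo h by (intro add_right_mono mult_right_mono) auto
    finally have "ennreal (\<Sum>j\<in>J. 2 powr j * b j) \<le> ennreal (2 * 2 powr m * h + (\<Sum>j\<in>J'. 2 powr j * (b j - h)))"
      by (rule ennreal_leI)
    also have "\<dots> = ennreal (2 * 2 powr m * h) + ennreal (\<Sum>j\<in>J'. 2 powr j * (b j - h))"
      using h by (intro ennreal_plus sum_nonneg) (auto simp: J'_def)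
    also have "ennreal (2 * 2 powr m * h) = 2 * (ennreal h * ennreal (2 powr m))"
      using h by (simp add: ennreal_mult ac_simps)
    also have "\<dots> + ennreal (\<Sum>j\<in>J'. 2 powr j * (b j - h))
        \<le> 2 * (ennreal h * emeasure N {z \<in> space N. h \<le> g z}) + 2 * (\<integral>\<^sup>+z. ennreal (g z - h) \<partial>N)"
      using less.prems(4)[OF m(1)] IH by (intro add_mono mult_left_mono) (auto simp: h_def)
    also have "\<dots> = 2 * ((\<integral>\<^sup>+z. ennreal h * indicator {z \<in> space N. h \<le> g z} z \<partial>N) + (\<integral>\<^sup>+z. ennreal (g z - h) \<partial>N))"
      by (subst nn_integral_cmult_indicator) (auto simp: distrib_left)
    also have "\<dots> = 2 * (\<integral>\<^sup>+z. ennreal h * indicator {z \<in> space N. h \<le> g z} z + ennreal (g z - h) \<partial>N)"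
      by (subst nn_integral_add) auto
    also have "\<dots> \<le> 2 * (\<integral>\<^sup>+z. ennreal (g z) \<partial>N)"
      using h by (intro mult_left_mono nn_integral_mono)
        (auto simp: indicator_def ennreal_plus[symmetric] ennreal_neg simp del: ennreal_plus)
    finally show ?thesis .
  qed simp
qed

lemma Lp_norm_powr: "0 < r \<Longrightarrow> Lp_norm r M f powr r = (\<integral>x. \<bar>f x\<bar> powr r \<partial>M)"
  by (simp add: Lp_norm_def powr_powr)

lemma Lp_space_scale: "f \<in> Lp_space r M \<Longrightarrow> (\<lambda>x. c * f x) \<in> Lp_space r M"
  by (auto simp: Lp_space_def abs_mult powr_mult)

lemma Lp_space_abs: "f \<in> Lp_space r M \<Longrightarrow> (\<lambda>x. \<bar>f x\<bar>) \<in> Lp_space r M"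
  by (auto simp: Lp_space_def)

section \<open>The extension and the capacitary strong type inequality\<close>

locale extension_space = averaging_kernel \<mu> A \<rho> "frac_kernel \<eta> heat" c0 c3
  for \<mu> :: "'a::{metric_space,second_countable_topology} measure" and A :: real
    and \<rho> :: "real \<Rightarrow> real" and \<eta> :: "real \<Rightarrow> real \<Rightarrow> real"
    and heat :: "real \<Rightarrow> 'a \<Rightarrow> 'a \<Rightarrow> real" and c0 c3 :: real +
  fixes p :: real
  assumes p: "1 < p"
begin

abbreviation T :: "('a \<Rightarrow> real) \<Rightarrow> real \<times> 'a \<Rightarrow> real" where "T \<equiv> frac_extension \<mu> \<eta> heat"

abbreviation cap :: "(real \<times> 'a) set \<Rightarrow> ennreal" where "cap \<equiv> capacity \<mu> \<eta> heat p"

lemma kernel_slice_measurable [measurable]: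
  assumes "0 < t" shows "(\<lambda>y. frac_kernel \<eta> heat t x y) \<in> borel_measurable \<mu>"
proof -
  have "(\<lambda>y. (t, x, y)) \<in> \<mu> \<rightarrow>\<^sub>M borel"
    unfolding borel_prod[symmetric] using sets_mu by (intro measurable_Pair) (auto cong: measurable_cong_sets)
  from measurable_compose[OF this kernel_measurable] assms show ?thesis by simp
qed

lemma extension_measurable:
  assumes f: "f \<in> borel_measurable \<mu>"
  shows "(\<lambda>z. indicator upper_half z * T f z) \<in> borel_measurable borel"
proof -
  interpret sigma_finite_measure \<mu> by (rule sigma_finite)
  have t1: "(\<lambda>w. (fst (fst w), snd (fst w), snd w)) \<in> (borel :: (real \<times> 'a) measure) \<Otimes>\<^sub>M \<mu> \<rightarrow>\<^sub>M borel"
  proof -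
    have "(\<lambda>w. snd w) \<in> (borel :: (real \<times> 'a) measure) \<Otimes>\<^sub>M \<mu> \<rightarrow>\<^sub>M borel"
      using measurable_snd[of "borel :: (real \<times> 'a) measure" \<mu>]
      by (simp add: measurable_cong_sets[OF refl sets_mu])
    then show ?thesis unfolding borel_prod[symmetric] by measurable
  qed
  have "(\<lambda>w. (\<lambda>(t, x, y). indicator {0<..} t * frac_kernel \<eta> heat t x y) (fst (fst w), snd (fst w), snd w) * f (snd w))
      \<in> borel_measurable ((borel :: (real \<times> 'a) measure) \<Otimes>\<^sub>M \<mu>)"
    by (intro borel_measurable_times measurable_compose[OF t1 kernel_measurable]
        measurable_compose[OF measurable_snd f])
  then have "(\<lambda>z. \<integral>y. indicator {0<..} (fst z) * frac_kernel \<eta> heat (fst z) (snd z) y * f y \<partial>\<mu>) \<in> borel_measurable borel"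
    by (intro borel_measurable_lebesgue_integral) (simp add: split_beta)
  also have "(\<lambda>z. \<integral>y. indicator {0<..} (fst z) * frac_kernel \<eta> heat (fst z) (snd z) y * f y \<partial>\<mu>)
      = (\<lambda>z. indicator upper_half z * T f z)"
    by (auto simp: fun_eq_iff frac_extension_def upper_half_def indicator_def)
  finally show ?thesis .
qed

text \<open>Since \<open>|f| \<le> 1 + |f|\<^sup>p\<close>, the averages of \<open>|f|\<close> over the balls \<open>B(x, R)\<close> with \<open>R \<ge> \<rho> t\<close> are at most
  \<open>1 + \<parallel>f\<parallel>\<^sub>p\<^sup>p / \<mu>(B(x, \<rho> t))\<close>, so the upper bound of the kernel applies.  Without convergence at every
  point the Bochner integral would not be monotone in \<open>f\<close>.\<close>

lemma extension_integrable:
  assumes f: "f \<in> Lp_space p \<mu>" and t: "0 < t"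
  shows "integrable \<mu> (\<lambda>y. frac_kernel \<eta> heat t x y * f y)"
proof (rule integrableI_bounded)
  have [measurable]: "f \<in> borel_measurable \<mu>" using f by (simp add: Lp_space_def)
  have int: "integrable \<mu> (\<lambda>y. \<bar>f y\<bar> powr p)" using f by (simp add: Lp_space_def)
  show "(\<lambda>y. frac_kernel \<eta> heat t x y * f y) \<in> borel_measurable \<mu>" using t by measurable
  define I V where "I = (\<integral>y. \<bar>f y\<bar> powr p \<partial>\<mu>)" and "V = measure \<mu> (ball x (\<rho> t))"
  have V: "0 < V" unfolding V_def by (intro ball_pos scale_pos t)
  have I: "0 \<le> I" by (simp add: I_def)
  have "(\<integral>\<^sup>+y\<in>ball x R. ennreal \<bar>f y\<bar> \<partial>\<mu>) \<le> ennreal (1 + I / V) * ennreal (measure \<mu> (ball x R))"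
    if R: "\<rho> t \<le> R" for R
  proof -
    have R0: "0 < R" using scale_pos[OF t] R by linarith
    have "V \<le> measure \<mu> (ball x R)" unfolding V_def using R R0 by (intro measure_ball_mono subset_ball)
    then have "I * V \<le> I * measure \<mu> (ball x R)" using I by (rule mult_left_mono)
    then have le: "measure \<mu> (ball x R) + I \<le> (1 + I / V) * measure \<mu> (ball x R)" using V by (simp add: field_simps)
    have "(\<integral>\<^sup>+y\<in>ball x R. ennreal \<bar>f y\<bar> \<partial>\<mu>) \<le> (\<integral>\<^sup>+y. indicator (ball x R) y + ennreal (\<bar>f y\<bar> powr p) \<partial>\<mu>)"
    proof (intro nn_integral_mono)
      fix y
      have "\<bar>f y\<bar> \<le> 1 + \<bar>f y\<bar> powr p"
        using powr_mono[of 1 p "\<bar>f y\<bar>"] p by (cases "\<bar>f y\<bar> \<le> 1") (auto intro: add_increasing2)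
      then have "ennreal \<bar>f y\<bar> \<le> ennreal (1 + \<bar>f y\<bar> powr p)" by (rule ennreal_leI)
      then show "ennreal \<bar>f y\<bar> * indicator (ball x R) y \<le> indicator (ball x R) y + ennreal (\<bar>f y\<bar> powr p)"
        by (auto simp: indicator_def ennreal_plus)
    qed
    also have "\<dots> = emeasure \<mu> (ball x R) + (\<integral>\<^sup>+y. ennreal (\<bar>f y\<bar> powr p) \<partial>\<mu>)"
      by (subst nn_integral_add) auto
    also have "(\<integral>\<^sup>+y. ennreal (\<bar>f y\<bar> powr p) \<partial>\<mu>) = ennreal I"
      unfolding I_def by (intro nn_integral_eq_integral int) auto
    also have "emeasure \<mu> (ball x R) + ennreal I = ennreal (measure \<mu> (ball x R) + I)"
      using R0 I by (simp add: emeasure_ball)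
    also have "\<dots> \<le> ennreal ((1 + I / V) * measure \<mu> (ball x R))" by (rule ennreal_leI[OF le])
    also have "\<dots> = ennreal (1 + I / V) * ennreal (measure \<mu> (ball x R))"
      using I V by (intro ennreal_mult) auto
    finally show ?thesis .
  qed
  then have "(\<integral>\<^sup>+y. ennreal (frac_kernel \<eta> heat t x y) * ennreal \<bar>f y\<bar> \<partial>\<mu>) \<le> ennreal c0 * ennreal (1 + I / V)"
    by (intro kernel_upper t) auto
  also have "\<dots> < \<infinity>" by (simp add: ennreal_mult_less_top)
  also have "(\<integral>\<^sup>+y. ennreal (frac_kernel \<eta> heat t x y) * ennreal \<bar>f y\<bar> \<partial>\<mu>)
      = (\<integral>\<^sup>+y. ennreal (norm (frac_kernel \<eta> heat t x y * f y)) \<partial>\<mu>)"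
    using kernel_nonneg[OF t] by (intro nn_integral_cong) (simp add: abs_mult ennreal_mult)
  finally show "(\<integral>\<^sup>+y. ennreal (norm (frac_kernel \<eta> heat t x y * f y)) \<partial>\<mu>) < \<infinity>" .
qed

lemma extension_nonneg:
  assumes "z \<in> upper_half" "\<And>y. 0 \<le> f y" shows "0 \<le> T f z"
  using assms kernel_nonneg
  by (auto simp: frac_extension_def upper_half_def intro!: Bochner_Integration.integral_nonneg mult_nonneg_nonneg)

lemma ennreal_extension:
  assumes f: "f \<in> Lp_space p \<mu>" "\<And>y. 0 \<le> f y" and t: "0 < t"
  shows "ennreal (T f (t, x)) = (\<integral>\<^sup>+y. ennreal (frac_kernel \<eta> heat t x y) * ennreal (f y) \<partial>\<mu>)"
proof -
  have "(\<integral>\<^sup>+y. ennreal (frac_kernel \<eta> heat t x y * f y) \<partial>\<mu>) = ennreal (T f (t, x))"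
    unfolding frac_extension_def using f kernel_nonneg[OF t]
    by (simp, intro nn_integral_eq_integral extension_integrable t) auto
  then show ?thesis using f kernel_nonneg[OF t] by (simp add: ennreal_mult)
qed

lemma extension_mono:
  assumes "f \<in> Lp_space p \<mu>" "g \<in> Lp_space p \<mu>" "\<And>y. f y \<le> g y" "z \<in> upper_half"
  shows "T f z \<le> T g z"
  using assms extension_integrable kernel_nonneg
  by (auto simp: frac_extension_def upper_half_def intro!: integral_mono mult_left_mono)

lemma abs_extension_le:
  assumes "f \<in> Lp_space p \<mu>" "z \<in> upper_half"
  shows "\<bar>T f z\<bar> \<le> T (\<lambda>y. \<bar>f y\<bar>) z"
proof -
  obtain t x where z: "z = (t, x)" "0 < t" using assms by (auto simp: upper_half_def)
  have "\<bar>\<integral>y. frac_kernel \<eta> heat t x y * f y \<partial>\<mu>\<bar> \<le> (\<integral>y. \<bar>frac_kernel \<eta> heat t x y * f y\<bar> \<partial>\<mu>)"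
    by (rule integral_abs_bound)
  also have "\<dots> = (\<integral>y. frac_kernel \<eta> heat t x y * \<bar>f y\<bar> \<partial>\<mu>)"
    using kernel_nonneg[OF z(2)] by (simp add: abs_mult)
  finally show ?thesis using z by (simp add: frac_extension_def)
qed

lemma extension_scale: "T (\<lambda>y. c * f y) z = c * T f z"
proof -
  have "(\<lambda>y. k y * (c * f y)) = (\<lambda>y. c * (k y * f y))" for k :: "'a \<Rightarrow> real"
    by (simp add: ac_simps fun_eq_iff)
  then show ?thesis by (simp add: frac_extension_def split_beta)
qed

lemma capacity_le:
  assumes "g \<in> Lp_space p \<mu>" "\<And>y. 0 \<le> g y" "\<And>z. z \<in> K \<Longrightarrow> z \<in> upper_half \<Longrightarrow> 1 \<le> T g z"
  shows "cap K \<le> ennreal (\<integral>y. \<bar>g y\<bar> powr p \<partial>\<mu>)"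
proof -
  have "cap K \<le> ennreal (Lp_norm p \<mu> g powr p)"
    unfolding capacity_def using assms extension_nonneg
    by (intro INF_lower) (auto simp: indicator_def)
  then show ?thesis using p by (simp add: Lp_norm_powr)
qed

text \<open>Where \<open>T f\<close> is at least \<open>l\<close>, the upper bound of the kernel produces a ball of radius at least \<open>\<rho> t\<close>
  on which the average of \<open>f\<close> is above \<open>l / (2 c\<^sub>0)\<close>.  Thus the ball of radius \<open>\<rho> t\<close> lies in the set
  \<open>U\<close> of high averages, and by the lower bound \<open>1\<^sub>U / c\<^sub>3\<close> is admissible for the capacity.\<close>

lemma capacity_level_set:
  assumes f: "f \<in> Lp_space p \<mu>" "\<And>y. 0 \<le> f y" and l: "0 < l"
    and K: "K \<subseteq> upper_half" "\<And>z. z \<in> K \<Longrightarrow> l \<le> T f z"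
  shows "cap K \<le> ennreal ((1 / c3) powr p) * emeasure \<mu> (high_average_set (\<lambda>y. ennreal (f y)) (l / (2 * c0)))"
proof (cases "emeasure \<mu> (high_average_set (\<lambda>y. ennreal (f y)) (l / (2 * c0))) = \<infinity>")
  case True
  then show ?thesis using c3_pos by (simp add: ennreal_mult_top)
next
  case False
  define U where "U = high_average_set (\<lambda>y. ennreal (f y)) (l / (2 * c0))"
  have [measurable]: "f \<in> borel_measurable \<mu>" using f by (simp add: Lp_space_def)
  have [measurable]: "U \<in> sets \<mu>" by (simp add: U_def)
  have fin: "emeasure \<mu> U < \<infinity>" using False by (simp add: U_def less_top)
  define g where "g y = 1 / c3 * indicator U y" for y
  have gp: "(\<lambda>y. \<bar>g y\<bar> powr p) = (\<lambda>y. (1 / c3) powr p * indicator U y)"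
    using c3_pos by (auto simp: g_def fun_eq_iff indicator_def)
  have "g \<in> borel_measurable \<mu>" unfolding g_def by measurable
  then have g: "g \<in> Lp_space p \<mu>" "\<And>y. 0 \<le> g y"
    using fin c3_pos unfolding Lp_space_def mem_Collect_eq gp by (auto simp: g_def)
  have "1 \<le> T g z" if z: "z \<in> K" for z
  proof -
    obtain t x where tx: "z = (t, x)" "0 < t" using K(1) z by (auto simp: upper_half_def)
    have r: "0 < \<rho> t" by (rule scale_pos[OF tx(2)])
    obtain R where R: "\<rho> t \<le> R" "\<not> (\<integral>\<^sup>+y\<in>ball x R. ennreal (f y) \<partial>\<mu>) \<le> ennreal (l / (2 * c0)) * ennreal (measure \<mu> (ball x R))"
    proof (rule ccontr)
      assume "\<not> thesis"
      with that have "\<And>R. \<rho> t \<le> R \<Longrightarrow> (\<integral>\<^sup>+y\<in>ball x R. ennreal (f y) \<partial>\<mu>) \<le> ennreal (l / (2 * c0)) * ennreal (measure \<mu> (ball x R))"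
        by blast
      then have "(\<integral>\<^sup>+y. ennreal (frac_kernel \<eta> heat t x y) * ennreal (f y) \<partial>\<mu>) \<le> ennreal c0 * ennreal (l / (2 * c0))"
        using tx by (intro kernel_upper) auto
      then have "ennreal (T f z) \<le> ennreal (c0 * (l / (2 * c0)))"
        using c0_pos l unfolding tx(1) ennreal_extension[OF f tx(2)]
        by (subst ennreal_mult) auto
      then have "T f z \<le> c0 * (l / (2 * c0))" using c0_pos l by (subst (asm) ennreal_le_iff) auto
      also have "\<dots> < l" using c0_pos l by simp
      finally show False using K(2)[OF z] by simp
    qed
    have "ball x R \<subseteq> U"
      using R r c0_pos l unfolding U_def high_average_set_def not_le
      by (intro Union_upper CollectI exI[of _ x] exI[of _ R]) (auto simp: ennreal_mult[symmetric])
    then have sub: "ball x (\<rho> t) \<subseteq> U" using R(1) by (meson order_trans subset_ball)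
    define V where "V = measure \<mu> (ball x (\<rho> t))"
    have V: "0 < V" unfolding V_def by (rule ball_pos[OF r])
    have "1 = ennreal (1 / V) * emeasure \<mu> (ball x (\<rho> t))"
      using V r by (simp add: emeasure_ball V_def[symmetric] ennreal_mult[symmetric])
    also have "\<dots> = (\<integral>\<^sup>+y. ennreal (1 / V) * indicator (ball x (\<rho> t)) y \<partial>\<mu>)"
      by (simp add: nn_integral_cmult_indicator)
    also have "\<dots> \<le> (\<integral>\<^sup>+y. ennreal (frac_kernel \<eta> heat t x y) * ennreal (g y) \<partial>\<mu>)"
    proof (intro nn_integral_mono)
      fix y
      show "ennreal (1 / V) * indicator (ball x (\<rho> t)) y \<le> ennreal (frac_kernel \<eta> heat t x y) * ennreal (g y)"
      proof (cases "dist x y < \<rho> t")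
        case True
        have "c3 / V * (1 / c3) \<le> frac_kernel \<eta> heat t x y * (1 / c3)"
          using kernel_lower[OF tx(2) True] c3_pos by (intro mult_right_mono) (auto simp: V_def)
        then have "1 / V \<le> frac_kernel \<eta> heat t x y * g y"
          using c3_pos True sub by (auto simp: g_def indicator_def)
        then show ?thesis using True g(2) kernel_nonneg[OF tx(2)]
          by (simp add: ennreal_mult[symmetric] ennreal_leI)
      qed simp
    qed
    also have "\<dots> = ennreal (T g z)" using tx by (simp add: ennreal_extension[OF g tx(2)])
    finally show ?thesis by simp
  qed
  then have "cap K \<le> ennreal (\<integral>y. \<bar>g y\<bar> powr p \<partial>\<mu>)" by (intro capacity_le g) auto
  also have "\<dots> = ennreal ((1 / c3) powr p) * emeasure \<mu> U"
    unfolding gp using fin by (simp add: emeasure_eq_ennreal_measure ennreal_mult less_top)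
  finally show ?thesis by (simp add: U_def)
qed

text \<open>Summation of the previous estimate over \<open>l = 2\<^sup>j\<close> by the dyadic maximal theorem.\<close>

lemma capacity_strong_type:
  "\<exists>B\<ge>0. \<forall>f\<in>Lp_space p \<mu>. \<forall>J::int set. \<forall>K. (\<forall>y. 0 \<le> f y) \<longrightarrow> finite J \<longrightarrow>
     (\<forall>j\<in>J. K j \<subseteq> upper_half \<and> (\<forall>z\<in>K j. 2 powr j \<le> T f z)) \<longrightarrow>
     (\<Sum>j\<in>J. ennreal (2 powr (p * j)) * cap (K j)) \<le> ennreal (B * (\<integral>y. \<bar>f y\<bar> powr p \<partial>\<mu>))"
proof -
  define c where "c = 1 / (2 * c0)"
  have c: "0 < c" using c0_pos by (simp add: c_def)
  define D where "D = 2 * A\<^sup>2 / c * (2 / c) powr (p - 1) / (1 - 2 powr - (p - 1))"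
  have D: "0 \<le> D" using c powr_less_mono[of "-(p-1)" 0 "2::real"] p by (auto simp: D_def)
  define B where "B = (1 / c3) powr p * D"
  have B: "0 \<le> B" using D by (simp add: B_def)
  have "(\<Sum>j\<in>J. ennreal (2 powr (p * j)) * cap (K j)) \<le> ennreal (B * (\<integral>y. \<bar>f y\<bar> powr p \<partial>\<mu>))"
    if f: "f \<in> Lp_space p \<mu>" "\<forall>y. 0 \<le> f y" and J: "finite J"
      and K: "\<forall>j\<in>J. K j \<subseteq> upper_half \<and> (\<forall>z\<in>K j. 2 powr j \<le> T f z)" for f K and J :: "int set"
  proof -
    have "(\<Sum>j\<in>J. ennreal (2 powr (p * j)) * cap (K j))
      \<le> (\<Sum>j\<in>J. ennreal (2 powr (p * j)) * (ennreal ((1 / c3) powr p) * emeasure \<mu> (high_average_set (\<lambda>y. ennreal (f y)) (2 powr j / (2 * c0)))))"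
      using f K by (intro sum_mono mult_left_mono capacity_level_set) auto
    also have "\<dots> = ennreal ((1 / c3) powr p) * (\<Sum>j\<in>J. ennreal (2 powr (p * j)) * emeasure \<mu> (high_average_set (\<lambda>y. ennreal (f y)) (c * 2 powr j)))"
      by (simp add: sum_distrib_left ac_simps c_def)
    also have "\<dots> \<le> ennreal ((1 / c3) powr p) * (ennreal D * (\<integral>\<^sup>+y. ennreal (f y powr p) \<partial>\<mu>))"
      unfolding D_def using f J c p by (intro mult_left_mono high_average_strong_type) (auto simp: Lp_space_def)
    also have "(\<integral>\<^sup>+y. ennreal (f y powr p) \<partial>\<mu>) = ennreal (\<integral>y. \<bar>f y\<bar> powr p \<partial>\<mu>)"
      using f by (subst nn_integral_eq_integral[symmetric]) (auto simp: Lp_space_def)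
    also have "ennreal ((1 / c3) powr p) * (ennreal D * ennreal (\<integral>y. \<bar>f y\<bar> powr p \<partial>\<mu>)) = ennreal (B * (\<integral>y. \<bar>f y\<bar> powr p \<partial>\<mu>))"
      using D by (simp add: B_def ennreal_mult mult.assoc)
    finally show ?thesis .
  qed
  with B show ?thesis by blast
qed

end

section \<open>A finite profile integral implies boundedness\<close>

lemma ennreal_divide_left_mono:
  fixes x y z :: ennreal
  assumes "x \<le> y" shows "z / y \<le> z / x"
proof (cases "z = 0 \<or> x = 0 \<or> y = \<infinity>")
  case True
  then show ?thesis using assms by (cases "z = 0") (auto simp: ennreal_divide_zero)
next
  case False
  then obtain u v where uv: "x = ennreal u" "y = ennreal v" "0 < u" "0 < v" "u \<le> v"
    using assms by (cases x; cases y) (auto simp: top_unique less_le)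
  then have "inverse y \<le> inverse x" by (simp add: inverse_ennreal ennreal_leI le_imp_inverse_le)
  then show ?thesis unfolding divide_ennreal_def by (intro mult_left_mono) auto
qed

lemma ennreal_powr_mono: "0 < \<theta> \<Longrightarrow> x \<le> y \<Longrightarrow> ennreal_powr x \<theta> \<le> ennreal_powr y \<theta>"
  by (auto simp: ennreal_powr_def less_top top_unique intro!: ennreal_leI powr_mono2 enn2real_mono)

lemma ennreal_powr_ennreal: "0 \<le> x \<Longrightarrow> ennreal_powr (ennreal x) \<theta> = ennreal (x powr \<theta>)"
  by (simp add: ennreal_powr_def)

locale extension_traces = extension_space \<mu> A \<rho> \<eta> heat c0 c3 p
  for \<mu> :: "'a::{metric_space,second_countable_topology} measure" and A :: real
    and \<rho> :: "real \<Rightarrow> real" and \<eta> :: "real \<Rightarrow> real \<Rightarrow> real"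
    and heat :: "real \<Rightarrow> 'a \<Rightarrow> 'a \<Rightarrow> real" and c0 c3 p :: real +
  fixes \<nu> :: "(real \<times> 'a) measure" and q :: real
  assumes radon: "radon_measure_on upper_half \<nu>" and q: "1 < q" "q < p"
begin

abbreviation profile :: "real \<Rightarrow> ennreal" where "profile \<equiv> capacity_profile \<mu> \<eta> heat p \<nu>"

text \<open>The profile enters the integral with the power \<open>-\<theta>\<close>; the exponent conjugate to \<open>p / q\<close> is \<open>\<theta> + 1\<close>.\<close>

definition \<theta> :: real where "\<theta> = q / (p - q)"

definition profile_integrand :: "real \<Rightarrow> ennreal" where
  "profile_integrand l = ennreal_powr (ennreal (l powr (p / q)) / profile l) \<theta> * ennreal (1 / l)"

lemma theta_pos: "0 < \<theta>" using q by (simp add: \<theta>_def)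

lemma exponents: "p / q * \<theta> = \<theta> + 1" "1 / (p - q) * q = \<theta>" "1 / (p - q) * p = \<theta> + 1" "(p - q) * \<theta> = q"
  using q by (auto simp: \<theta>_def field_simps)

lemma upper_half_borel: "upper_half \<in> sets (borel :: (real \<times> 'a) measure)"
  unfolding upper_half_def by (intro borel_open open_Times) auto

lemma space_nu: "space \<nu> = upper_half"
  using radon by (simp add: radon_measure_on_def)

lemma sets_nu: "sets \<nu> = sets (restrict_space borel upper_half)"
  using radon by (simp add: radon_measure_on_def)

lemma compact_sets: "compact K \<Longrightarrow> K \<subseteq> upper_half \<Longrightarrow> K \<in> sets \<nu>"
  unfolding sets_nu using upper_half_borel
  by (subst sets_restrict_space_iff) (auto intro: borel_compact)

lemma compact_finite: "compact K \<Longrightarrow> K \<subseteq> upper_half \<Longrightarrow> emeasure \<nu> K < \<infinity>"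
  using radon by (simp add: radon_measure_on_def)

lemma inner_regular: "S \<in> sets \<nu> \<Longrightarrow> emeasure \<nu> S = (SUP K \<in> {K. compact K \<and> K \<subseteq> S}. emeasure \<nu> K)"
  using radon by (simp add: radon_measure_on_def)

lemma extension_measurable_nu:
  assumes "f \<in> borel_measurable \<mu>" shows "T f \<in> borel_measurable \<nu>"
proof -
  have "T f \<in> borel_measurable (restrict_space borel upper_half)"
    using extension_measurable[OF assms] upper_half_borel
    by (subst borel_measurable_restrict_space_iff) auto
  then show ?thesis by (simp add: measurable_cong_sets[OF sets_nu refl])
qed

lemma profile_le:
  "compact K \<Longrightarrow> K \<subseteq> upper_half \<Longrightarrow> ennreal l \<le> emeasure \<nu> K \<Longrightarrow> profile l \<le> cap K"
  unfolding capacity_profile_def by (intro INF_lower) auto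

lemma profile_mono: "l \<le> l' \<Longrightarrow> profile l \<le> profile l'"
  unfolding capacity_profile_def by (intro INF_superset_mono) (auto intro: order_trans ennreal_leI)

text \<open>Young's inequality for the exponents \<open>p / q\<close> and \<open>\<theta> + 1\<close>, in a form with constant one: whichever
  of \<open>n\<close> and \<open>2\<^sup>(\<^sup>p\<^sup>-\<^sup>q\<^sup>)\<^sup>s c\<close> is smaller decides which term dominates.\<close>

lemma young_split:
  assumes n: "0 < n" and c: "0 < c"
  shows "2 powr (q * s) * n \<le> 2 powr (p * s) * c + n powr (\<theta> + 1) * c powr (- \<theta>)"
proof (cases "n \<le> 2 powr ((p - q) * s) * c")
  case True
  have "2 powr (q * s) * n \<le> 2 powr (q * s) * (2 powr ((p - q) * s) * c)"
    using True by (intro mult_left_mono) auto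
  also have "\<dots> = 2 powr (p * s) * c" by (simp add: powr_add[symmetric] algebra_simps)
  finally show ?thesis by (intro add_increasing2) auto
next
  case False
  have "2 powr (q * s) = (2 powr ((p - q) * s)) powr \<theta>"
  proof -
    have "(p - q) * s * \<theta> = ((p - q) * \<theta>) * s" by simp
    then have "(p - q) * s * \<theta> = q * s" by (simp only: exponents(4))
    then show ?thesis by (simp only: powr_powr)
  qed
  also have "\<dots> \<le> (n / c) powr \<theta>" using False c theta_pos by (intro powr_mono2) (auto simp: field_simps)
  also have "\<dots> = n powr \<theta> * c powr (- \<theta>)" using n c by (simp add: powr_divide powr_minus_divide)
  finally have "2 powr (q * s) * n \<le> n powr \<theta> * c powr (- \<theta>) * n"
    using n by (intro mult_right_mono) auto
  also have "\<dots> = n powr (\<theta> + 1) * c powr (- \<theta>)" using n by (simp add: powr_add)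
  finally show ?thesis using c by (intro add_increasing) auto
qed

text \<open>With \<open>c = C(K)\<close> and \<open>\<nu>(K) = v\<close>, the profile is at most \<open>c\<close> on all \<open>l \<le> v\<close>.  So the second term of
  Young's inequality is at most a constant times \<open>n / 2\<close> times the infimum of the integrand over the
  interval \<open>{v - n / 2<..v}\<close>, which stays above \<open>n / 2\<close>.  If \<open>c = 0\<close>, the integrand is infinite
  there.  The infimum is used in place of the integral over the interval to keep the summation over
  \<open>j\<close> within measurable step functions.\<close>

lemma level_estimate:
  assumes K: "compact K" "K \<subseteq> upper_half" "emeasure \<nu> K = ennreal v" and n: "0 \<le> n" "n \<le> v"
    and fin: "cap K < \<infinity>"
  shows "ennreal (2 powr (q * s) * n) \<le> ennreal (2 powr (p * s)) * cap K
    + ennreal (2 powr (\<theta> + 1)) * ((INF l \<in> {v - n / 2<..v}. profile_integrand l) * ennreal (n / 2))"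
proof (cases "n = 0")
  case False
  then have n0: "0 < n" using n by simp
  have prof: "profile l \<le> cap K" if "l \<le> v" for l
    using that K n by (intro profile_le) (auto intro: ennreal_leI)
  obtain c where c: "cap K = ennreal c" "0 \<le> c" using fin by (cases "cap K") auto
  show ?thesis
  proof (cases "c = 0")
    case True
    have "profile_integrand l = \<infinity>" if "l \<in> {v - n / 2<..v}" for l
    proof -
      have l: "0 < l" using that n0 n by auto
      have "profile l = 0" using prof[of l] that c True by simp
      then have "ennreal (l powr (p / q)) / profile l = \<infinity>" using l by (simp add: ennreal_divide_zero)
      then show ?thesis using l by (simp add: profile_integrand_def ennreal_powr_def ennreal_top_mult)
    qed
    then have "(INF l \<in> {v - n / 2<..v}. profile_integrand l) = \<infinity>"
      by (simp add: INF_eq_const cong: INF_cong_simp)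
    then show ?thesis using n0 by (simp add: ennreal_top_mult ennreal_mult_top)
  next
    case False
    with c have c0: "0 < c" by simp
    define w where "w = (n / 2) powr \<theta> * c powr (- \<theta>)"
    have "ennreal w \<le> profile_integrand l" if "l \<in> {v - n / 2<..v}" for l
    proof -
      have l: "0 < l" "n / 2 \<le> l" "l \<le> v" using that n0 n by auto
      have "w \<le> l powr \<theta> * c powr (- \<theta>)" unfolding w_def
        using n0 l theta_pos by (intro mult_right_mono powr_mono2) auto
      also have "\<dots> = (l powr (p / q) / c) powr \<theta> * (1 / l)"
        using l c0 exponents(1) by (simp add: powr_divide powr_powr powr_minus_divide powr_add)
      finally have "ennreal w \<le> ennreal ((l powr (p / q) / c) powr \<theta>) * ennreal (1 / l)"
        using l by (simp add: ennreal_mult[symmetric] ennreal_leI)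
      also have "ennreal ((l powr (p / q) / c) powr \<theta>) = ennreal_powr (ennreal (l powr (p / q)) / cap K) \<theta>"
        using c0 c by (simp add: divide_ennreal ennreal_powr_ennreal)
      also have "\<dots> * ennreal (1 / l) \<le> profile_integrand l" unfolding profile_integrand_def
        using l prof[of l] by (intro mult_right_mono ennreal_powr_mono theta_pos ennreal_divide_left_mono) auto
      finally show ?thesis .
    qed
    then have inf: "ennreal w \<le> (INF l \<in> {v - n / 2<..v}. profile_integrand l)" by (intro INF_greatest)
    have "n powr (\<theta> + 1) * c powr (- \<theta>) = 2 powr (\<theta> + 1) * (w * (n / 2))"
      using n0 by (simp add: w_def powr_divide powr_add field_simps)
    then have "ennreal (2 powr (q * s) * n) \<le> ennreal (2 powr (p * s) * c + 2 powr (\<theta> + 1) * (w * (n / 2)))"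
      using young_split[OF n0 c0, of s] by (intro ennreal_leI) simp
    also have "\<dots> = ennreal (2 powr (p * s)) * cap K + ennreal (2 powr (\<theta> + 1)) * (ennreal w * ennreal (n / 2))"
      using n0 c0 unfolding c(1) by (simp add: w_def ennreal_mult[symmetric] ennreal_plus[symmetric] del: ennreal_plus)
    also have "\<dots> \<le> ennreal (2 powr (p * s)) * cap K + ennreal (2 powr (\<theta> + 1)) * ((INF l \<in> {v - n / 2<..v}. profile_integrand l) * ennreal (n / 2))"
      by (intro add_left_mono mult_left_mono mult_right_mono inf) auto
    finally show ?thesis .
  qed
qed simp

text \<open>The numbers \<open>v\<^sub>j\<close> are tail sums of the \<open>n\<^sub>j\<close>, so consecutive ones differ by at least \<open>n\<^sub>j\<close> and the
  intervals \<open>{v\<^sub>j - n\<^sub>j / 2<..v\<^sub>j}\<close> are disjoint.\<close>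

lemma disjoint_steps_le:
  fixes J :: "int set" and v n :: "int \<Rightarrow> real"
  assumes J: "finite J" and n: "\<And>j. j \<in> J \<Longrightarrow> 0 \<le> n j" and v: "\<And>j. j \<in> J \<Longrightarrow> v j = (\<Sum>i\<in>{i\<in>J. j \<le> i}. n i)"
  shows "(\<Sum>j\<in>J. (INF l \<in> {v j - n j / 2<..v j}. profile_integrand l) * ennreal (n j / 2))
    \<le> (\<integral>\<^sup>+l\<in>{0<..}. profile_integrand l \<partial>lborel)"
proof -
  define I where "I j = {v j - n j / 2<..v j}" for j
  define g where "g j = (INF l \<in> I j. profile_integrand l)" for j
  have vn: "n j \<le> v j" if "j \<in> J" for j
    unfolding v[OF that] using J that n by (intro member_le_sum) auto
  have step: "v j \<le> v i - n i" if "i \<in> J" "j \<in> J" "i < j" for i j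
  proof -
    have "v j + n i = (\<Sum>k\<in>insert i {k\<in>J. j \<le> k}. n k)"
      using that J by (subst sum.insert) (auto simp: v)
    also have "\<dots> \<le> v i" unfolding v[OF that(1)] using J n that by (intro sum_mono2) auto
    finally show ?thesis by simp
  qed
  have disj: "disjoint_family_on I J"
  proof -
    have "I i \<inter> I j = {}" if "i \<in> J" "j \<in> J" "i < j" for i j
      using step[OF that] n[OF that(1)] by (auto simp: I_def)
    then show ?thesis unfolding disjoint_family_on_def by (metis inf_commute linorder_neqE)
  qed
  have "(\<Sum>j\<in>J. g j * ennreal (n j / 2)) = (\<Sum>j\<in>J. \<integral>\<^sup>+l. g j * indicator (I j) l \<partial>lborel)"
    using n by (intro sum.cong refl) (subst nn_integral_cmult_indicator, auto simp: I_def)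
  also have "\<dots> = (\<integral>\<^sup>+l. (\<Sum>j\<in>J. g j * indicator (I j) l) \<partial>lborel)"
    by (subst nn_integral_sum) (auto simp: I_def)
  also have "\<dots> \<le> (\<integral>\<^sup>+l\<in>{0<..}. profile_integrand l \<partial>lborel)"
  proof (intro nn_integral_mono)
    fix l
    show "(\<Sum>j\<in>J. g j * indicator (I j) l) \<le> profile_integrand l * indicator {0<..} l"
    proof (cases "\<exists>i\<in>J. l \<in> I i")
      case True
      then obtain i where i: "i \<in> J" "l \<in> I i" by blast
      have "0 < l" using i vn[OF i(1)] n[OF i(1)] by (auto simp: I_def)
      have "(\<Sum>j\<in>J. g j * indicator (I j) l) = (\<Sum>j\<in>{i}. g j * indicator (I j) l)"
        using i disj J by (intro sum.mono_neutral_right) (auto simp: disjoint_family_on_def indicator_def)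
      also have "\<dots> = g i" using i by simp
      also have "\<dots> \<le> profile_integrand l" unfolding g_def using i by (intro INF_lower)
      finally show ?thesis using \<open>0 < l\<close> by simp
    next
      case False
      then have "(\<Sum>j\<in>J. g j * indicator (I j) l) = 0" by (intro sum.neutral) auto
      then show ?thesis by simp
    qed
  qed
  finally show ?thesis by (simp add: g_def I_def)
qed

text \<open>Apply \<open>level_estimate\<close> to the unions \<open>K\<^sub>j\<close> of all \<open>L\<^sub>i\<close> with \<open>i \<ge> j\<close>: they lie in \<open>{T f \<ge> 2\<^sup>j}\<close>, so their
  capacities are summable with weights \<open>2\<^sup>p\<^sup>j\<close>, and their measures are tail sums.  The hypothesis on
  \<open>B\<close> is the conclusion of \<open>capacity_strong_type\<close>.\<close>

lemma compact_levels_bound: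
  fixes L :: "int \<Rightarrow> (real \<times> 'a) set"
  assumes B: "0 \<le> B" "\<forall>f\<in>Lp_space p \<mu>. \<forall>J::int set. \<forall>K. (\<forall>y. 0 \<le> f y) \<longrightarrow> finite J \<longrightarrow>
     (\<forall>j\<in>J. K j \<subseteq> upper_half \<and> (\<forall>z\<in>K j. 2 powr j \<le> T f z)) \<longrightarrow>
     (\<Sum>j\<in>J. ennreal (2 powr (p * j)) * cap (K j)) \<le> ennreal (B * (\<integral>y. \<bar>f y\<bar> powr p \<partial>\<mu>))"
    and f: "f \<in> Lp_space p \<mu>" "\<forall>y. 0 \<le> f y" "(\<integral>y. \<bar>f y\<bar> powr p \<partial>\<mu>) \<le> 1"
    and J: "finite (J :: int set)"
    and L: "\<And>j. j \<in> J \<Longrightarrow> compact (L j)" "\<And>j. j \<in> J \<Longrightarrow> L j \<subseteq> {z\<in>upper_half. 2 powr j \<le> T f z \<and> T f z < 2 powr (j + 1)}"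
  shows "(\<Sum>j\<in>J. ennreal (2 powr (q * j)) * emeasure \<nu> (L j))
    \<le> ennreal B + ennreal (2 powr (\<theta> + 1)) * (\<integral>\<^sup>+l\<in>{0<..}. profile_integrand l \<partial>lborel)"
proof -
  define K where "K j = (\<Union>i\<in>{i\<in>J. j \<le> i}. L i)" for j
  define n where "n j = measure \<nu> (L j)" for j
  define v where "v j = (\<Sum>i\<in>{i\<in>J. j \<le> i}. n i)" for j
  have Lu: "L j \<subseteq> upper_half" if "j \<in> J" for j using L(2)[OF that] by auto
  have en: "emeasure \<nu> (L j) = ennreal (n j)" if "j \<in> J" for j
    unfolding n_def using compact_finite[OF L(1)[OF that] Lu[OF that]] by (intro emeasure_eq_ennreal_measure) auto
  have disj: "disjoint_family_on L J"
  proof -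
    have "L i \<inter> L j = {}" if "i \<in> J" "j \<in> J" "i < j" for i j
    proof -
      have "real_of_int i + 1 \<le> real_of_int j" using that(3) by linarith
      then have "2 powr (real_of_int i + 1) \<le> 2 powr real_of_int j" by (intro powr_mono) auto
      then have "z \<notin> L j" if "z \<in> L i" for z
        using L(2)[OF \<open>i \<in> J\<close>] L(2)[OF \<open>j \<in> J\<close>] that
        by (smt (verit, ccfv_SIG) mem_Collect_eq subset_iff)
      then show ?thesis by blast
    qed
    then show ?thesis unfolding disjoint_family_on_def by (metis inf_commute linorder_neqE)
  qed
  have K: "compact (K j)" "K j \<subseteq> upper_half" for j
    unfolding K_def using J L(1) Lu by (auto intro!: compact_UN)
  have Kv: "emeasure \<nu> (K j) = ennreal (v j)" for j
  proof -
    have "emeasure \<nu> (K j) = (\<Sum>i\<in>{i\<in>J. j \<le> i}. emeasure \<nu> (L i))"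
      unfolding K_def using J L(1) Lu disj
      by (intro sum_emeasure[symmetric]) (auto intro!: compact_sets intro: disjoint_family_on_mono)
    also have "\<dots> = (\<Sum>i\<in>{i\<in>J. j \<le> i}. ennreal (n i))" by (intro sum.cong refl en) auto
    also have "\<dots> = ennreal (v j)" unfolding v_def by (intro sum_ennreal) (auto simp: n_def)
    finally show ?thesis .
  qed
  have Kf: "2 powr j \<le> T f z" if zK: "z \<in> K j" for z and j :: int
  proof -
    obtain i where i: "i \<in> J" "j \<le> i" "z \<in> L i" using zK by (auto simp: K_def)
    have "2 powr j \<le> 2 powr i" using i by (intro powr_mono) auto
    also have "\<dots> \<le> T f z" using L(2)[OF i(1)] i(3) by auto
    finally show ?thesis .
  qed
  have "(\<Sum>j\<in>J. ennreal (2 powr (p * j)) * cap (K j)) \<le> ennreal (B * (\<integral>y. \<bar>f y\<bar> powr p \<partial>\<mu>))"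
    by (rule B(2)[rule_format, OF f(1)]) (use f(2) J K Kf in auto)
  also have "\<dots> \<le> ennreal B" using f(3) B(1) by (intro ennreal_leI mult_left_le)
  finally have strong: "(\<Sum>j\<in>J. ennreal (2 powr (p * j)) * cap (K j)) \<le> ennreal B" .
  have fin: "cap (K j) < \<infinity>" if "j \<in> J" for j
  proof -
    have "ennreal (2 powr (p * j)) * cap (K j) \<le> (\<Sum>j\<in>J. ennreal (2 powr (p * j)) * cap (K j))"
      using J that by (intro member_le_sum) auto
    then have "ennreal (2 powr (p * j)) * cap (K j) < \<infinity>" 
      using le_less_trans[OF order_trans[OF _ strong] ennreal_less_top] by simp
    then show ?thesis by (auto simp: ennreal_mult_less_top)
  qed
  have "(\<Sum>j\<in>J. ennreal (2 powr (q * j)) * emeasure \<nu> (L j)) = (\<Sum>j\<in>J. ennreal (2 powr (q * j) * n j))"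
    using en by (intro sum.cong refl) (simp add: ennreal_mult n_def)
  also have "\<dots> \<le> (\<Sum>j\<in>J. ennreal (2 powr (p * j)) * cap (K j)
      + ennreal (2 powr (\<theta> + 1)) * ((INF l \<in> {v j - n j / 2<..v j}. profile_integrand l) * ennreal (n j / 2)))"
  proof (intro sum_mono level_estimate K Kv fin)
    fix j assume "j \<in> J"
    then show "n j \<le> v j" unfolding v_def using J by (intro member_le_sum) (auto simp: n_def)
  qed (auto simp: n_def)
  also have "\<dots> = (\<Sum>j\<in>J. ennreal (2 powr (p * j)) * cap (K j))
      + ennreal (2 powr (\<theta> + 1)) * (\<Sum>j\<in>J. (INF l \<in> {v j - n j / 2<..v j}. profile_integrand l) * ennreal (n j / 2))"
    by (simp add: sum.distrib sum_distrib_left)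
  also have "\<dots> \<le> ennreal B + ennreal (2 powr (\<theta> + 1)) * (\<integral>\<^sup>+l\<in>{0<..}. profile_integrand l \<partial>lborel)"
    using J by (intro add_mono strong mult_left_mono disjoint_steps_le) (auto simp: n_def v_def)
  finally show ?thesis .
qed

text \<open>Each dyadic shell of \<open>T f\<close> is approximated from inside by a compact set of at least half its
  measure.  Single shells are handled first, to know that their measures are finite.\<close>

lemma normalized_bound:
  assumes fin: "(\<integral>\<^sup>+l\<in>{0<..}. profile_integrand l \<partial>lborel) < \<infinity>"
  shows "\<exists>M\<ge>0. \<forall>f\<in>Lp_space p \<mu>. (\<forall>y. 0 \<le> f y) \<longrightarrow> (\<integral>y. \<bar>f y\<bar> powr p \<partial>\<mu>) \<le> 1 \<longrightarrow>
    (\<integral>\<^sup>+z. ennreal (T f z powr q) \<partial>\<nu>) \<le> ennreal M"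
proof -
  obtain B where B: "0 \<le> B" "\<forall>f\<in>Lp_space p \<mu>. \<forall>J::int set. \<forall>K. (\<forall>y. 0 \<le> f y) \<longrightarrow> finite J \<longrightarrow>
     (\<forall>j\<in>J. K j \<subseteq> upper_half \<and> (\<forall>z\<in>K j. 2 powr j \<le> T f z)) \<longrightarrow>
     (\<Sum>j\<in>J. ennreal (2 powr (p * j)) * cap (K j)) \<le> ennreal (B * (\<integral>y. \<bar>f y\<bar> powr p \<partial>\<mu>))"
    using capacity_strong_type by (elim exE conjE) (rule that)
  define M0 where "M0 = ennreal B + ennreal (2 powr (\<theta> + 1)) * (\<integral>\<^sup>+l\<in>{0<..}. profile_integrand l \<partial>lborel)"
  have M0: "M0 < \<infinity>" using fin by (simp add: M0_def ennreal_mult_less_top)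
  define M where "M = enn2real (ennreal (2 powr q) * (2 * M0))"
  have M: "0 \<le> M" "ennreal M = ennreal (2 powr q) * (2 * M0)"
    using M0 by (auto simp: M_def ennreal_mult_less_top)
  have "(\<integral>\<^sup>+z. ennreal (T f z powr q) \<partial>\<nu>) \<le> ennreal M"
    if f: "f \<in> Lp_space p \<mu>" "\<forall>y. 0 \<le> f y" "(\<integral>y. \<bar>f y\<bar> powr p \<partial>\<mu>) \<le> 1" for f
  proof -
    define F where "F j = {z\<in>upper_half. 2 powr real_of_int j \<le> T f z \<and> T f z < 2 powr (real_of_int j + 1)}" for j
    have [measurable]: "T f \<in> borel_measurable \<nu>" using f by (intro extension_measurable_nu) (simp add: Lp_space_def)
    have F[measurable]: "F j \<in> sets \<nu>" for j unfolding F_def space_nu[symmetric] by measurable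
    have bound: "(\<Sum>j\<in>J. ennreal (2 powr (q * j)) * emeasure \<nu> (L j)) \<le> M0"
      if "finite J" "\<And>j. j \<in> J \<Longrightarrow> compact (L j)" "\<And>j. j \<in> J \<Longrightarrow> L j \<subseteq> F j" for J and L :: "int \<Rightarrow> (real \<times> 'a) set"
      unfolding M0_def using that unfolding F_def by (intro compact_levels_bound[OF B f])
    have Ffin: "emeasure \<nu> (F j) < \<infinity>" for j
    proof -
      have "ennreal (2 powr (q * j)) * emeasure \<nu> (F j)
        = (SUP K \<in> {K. compact K \<and> K \<subseteq> F j}. ennreal (2 powr (q * j)) * emeasure \<nu> K)"
        by (subst inner_regular[OF F]) (simp add: SUP_mult_left_ennreal)
      also have "\<dots> \<le> M0" using bound[of "{j}" "\<lambda>_. K" for K] by (intro SUP_least) auto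
      finally have "ennreal (2 powr (q * j)) * emeasure \<nu> (F j) < \<infinity>" using M0 by simp
      then show ?thesis by (auto simp: ennreal_mult_less_top)
    qed
    have "\<exists>L. compact L \<and> L \<subseteq> F j \<and> emeasure \<nu> (F j) \<le> 2 * emeasure \<nu> L" for j
    proof (cases "emeasure \<nu> (F j) = 0")
      case True
      then show ?thesis by (intro exI[of _ "{}"]) auto
    next
      case False
      then obtain w where w: "emeasure \<nu> (F j) = ennreal w" "0 < w"
        using Ffin[of j] by (cases "emeasure \<nu> (F j)") (auto simp: less_le)
      have "ennreal (w / 2) < emeasure \<nu> (F j)" unfolding w(1) using w(2) by (simp add: ennreal_less_iff)
      then obtain K where K: "compact K" "K \<subseteq> F j" "ennreal (w / 2) < emeasure \<nu> K"
        unfolding inner_regular[OF F] less_SUP_iff by auto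
      have "ennreal w = 2 * ennreal (w / 2)" using w by (simp add: ennreal_mult'[symmetric] flip: ennreal_numeral)
      also have "\<dots> \<le> 2 * emeasure \<nu> K" using K by (intro mult_left_mono) auto
      finally show ?thesis using K w by auto
    qed
    then obtain L where L: "\<And>j. compact (L j)" "\<And>j. L j \<subseteq> F j" "\<And>j. emeasure \<nu> (F j) \<le> 2 * emeasure \<nu> (L j)"
      by metis
    have "(\<integral>\<^sup>+z. ennreal (T f z powr q) \<partial>\<nu>)
      \<le> (\<integral>\<^sup>+z. \<integral>\<^sup>+j. ennreal (2 powr (q * (real_of_int j + 1))) * indicator (F j) z \<partial>count_space UNIV \<partial>\<nu>)"
    proof (intro nn_integral_mono)
      fix z assume "z \<in> space \<nu>"
      then have z: "z \<in> upper_half" by (simp add: space_nu)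
      show "ennreal (T f z powr q) \<le> (\<integral>\<^sup>+j. ennreal (2 powr (q * (real_of_int j + 1))) * indicator (F j) z \<partial>count_space UNIV)"
      proof (cases "T f z = 0")
        case False
        then have pos: "0 < T f z" using extension_nonneg[OF z] f(2) by (simp add: less_le)
        define i where "i = \<lfloor>log 2 (T f z)\<rfloor>"
        have i: "real_of_int i \<le> log 2 (T f z)" "log 2 (T f z) < real_of_int i + 1" by (auto simp: i_def)
        have Fi: "z \<in> F i" using i pos z by (simp add: F_def le_log_iff log_less_iff)
        then have "T f z powr q \<le> (2 powr (real_of_int i + 1)) powr q"
          using pos q by (intro powr_mono2) (auto simp: F_def)
        then have "ennreal (T f z powr q) \<le> ennreal (2 powr (q * (real_of_int i + 1))) * indicator (F i) z"
          using Fi by (simp add: powr_powr mult.commute ennreal_leI)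
        also have "\<dots> = (\<integral>\<^sup>+j. ennreal (2 powr (q * (real_of_int j + 1))) * indicator (F j) z * indicator {i} j \<partial>count_space UNIV)"
          by (subst nn_integral_indicator_singleton) auto
        also have "\<dots> \<le> (\<integral>\<^sup>+j. ennreal (2 powr (q * (real_of_int j + 1))) * indicator (F j) z \<partial>count_space UNIV)"
          by (intro nn_integral_mono) (auto simp: indicator_def)
        finally show ?thesis .
      qed simp
    qed
    also have "\<dots> = (\<integral>\<^sup>+j. \<integral>\<^sup>+z. ennreal (2 powr (q * (real_of_int j + 1))) * indicator (F j) z \<partial>\<nu> \<partial>count_space UNIV)"
      by (intro nn_integral_count_space_nn_integral) auto
    also have "\<dots> = (\<integral>\<^sup>+j. ennreal (2 powr (q * (real_of_int j + 1))) * emeasure \<nu> (F j) \<partial>count_space UNIV)"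
      by (simp add: nn_integral_cmult_indicator)
    also have "\<dots> \<le> ennreal M"
    proof (rule nn_integral_count_space_int_le)
      fix J :: "int set" assume J: "finite J"
      have "(\<Sum>j\<in>J. ennreal (2 powr (q * (real_of_int j + 1))) * emeasure \<nu> (F j))
        \<le> (\<Sum>j\<in>J. ennreal (2 powr q) * (2 * (ennreal (2 powr (q * j)) * emeasure \<nu> (L j))))"
      proof (intro sum_mono)
        fix j
        have "ennreal (2 powr (q * (real_of_int j + 1))) * emeasure \<nu> (F j)
          \<le> ennreal (2 powr q * 2 powr (q * j)) * (2 * emeasure \<nu> (L j))"
          using L(3) by (intro mult_mono) (auto simp: powr_add distrib_left mult.commute)
        then show "ennreal (2 powr (q * (real_of_int j + 1))) * emeasure \<nu> (F j)
          \<le> ennreal (2 powr q) * (2 * (ennreal (2 powr (q * j)) * emeasure \<nu> (L j)))"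
          by (simp add: ennreal_mult ac_simps)
      qed
      also have "\<dots> = ennreal (2 powr q) * (2 * (\<Sum>j\<in>J. ennreal (2 powr (q * j)) * emeasure \<nu> (L j)))"
        by (simp add: sum_distrib_left)
      also have "\<dots> \<le> ennreal M"
        unfolding M(2) using J L by (intro mult_left_mono bound) auto
      finally show "(\<Sum>j\<in>J. ennreal (2 powr (q * (real_of_int j + 1))) * emeasure \<nu> (F j)) \<le> ennreal M" .
    qed
    finally show ?thesis .
  qed
  with M(1) show ?thesis by blast
qed

text \<open>Homogeneity removes the normalization, and \<open>|T f| \<le> T |f|\<close> the positivity.  The case \<open>\<parallel>f\<parallel>\<^sub>p = 0\<close>
  cannot be normalized, but then \<open>T f\<close> vanishes identically.\<close>

lemma bounded_if_integral_finite:
  assumes fin: "(\<integral>\<^sup>+l\<in>{0<..}. profile_integrand l \<partial>lborel) < \<infinity>"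
  shows "bounded_extension \<mu> \<eta> heat p q \<nu>"
proof -
  obtain M where M: "0 \<le> M" "\<forall>f\<in>Lp_space p \<mu>. (\<forall>y. 0 \<le> f y) \<longrightarrow> (\<integral>y. \<bar>f y\<bar> powr p \<partial>\<mu>) \<le> 1 \<longrightarrow>
    (\<integral>\<^sup>+z. ennreal (T f z powr q) \<partial>\<nu>) \<le> ennreal M"
    using normalized_bound[OF fin] by (elim exE conjE) (rule that)
  have main: "T f \<in> Lp_space q \<nu> \<and> Lp_norm q \<nu> (T f) \<le> M powr (1 / q) * Lp_norm p \<mu> f" if f: "f \<in> Lp_space p \<mu>" for f
  proof -
    define I where "I = (\<integral>y. \<bar>f y\<bar> powr p \<partial>\<mu>)"
    have I: "0 \<le> I" by (simp add: I_def)
    have fm [measurable]: "f \<in> borel_measurable \<mu>" using f by (simp add: Lp_space_def)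
    have [measurable]: "T f \<in> borel_measurable \<nu>" by (rule extension_measurable_nu[OF fm])
    have nn: "(\<integral>\<^sup>+z. ennreal (\<bar>T f z\<bar> powr q) \<partial>\<nu>) \<le> ennreal (M * I powr (q / p))"
    proof (cases "I = 0")
      case True
      have "AE y in \<mu>. \<bar>f y\<bar> powr p = 0"
        using True f unfolding I_def by (subst (asm) integral_nonneg_eq_0_iff_AE) (auto simp: Lp_space_def)
      then have z: "AE y in \<mu>. f y = 0" by simp
      have "T f z = 0" if "z \<in> upper_half" for z
        unfolding frac_extension_def split_beta by (rule integral_eq_zero_AE) (use z in auto)
      then have "(\<integral>\<^sup>+z. ennreal (\<bar>T f z\<bar> powr q) \<partial>\<nu>) = (\<integral>\<^sup>+z. 0 \<partial>\<nu>)"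
        by (intro nn_integral_cong) (simp add: space_nu)
      then show ?thesis by simp
    next
      case False
      then have I0: "0 < I" using I by simp
      \<comment> \<open>The norm of \<open>f\<close>, so that \<open>|f| / s\<close> is normalized.\<close>
      define s where "s = I powr (1 / p)"
      have s: "0 < s" "s powr p = I" "s powr q = I powr (q / p)" using I0 p by (auto simp: s_def powr_powr)
      define g where "g y = 1 / s * \<bar>f y\<bar>" for y
      have g: "g \<in> Lp_space p \<mu>" "\<forall>y. 0 \<le> g y"
        unfolding g_def using s(1) by (intro Lp_space_scale Lp_space_abs f) (auto intro!: divide_nonneg_pos s(1))
      have "(\<integral>y. \<bar>g y\<bar> powr p \<partial>\<mu>) = (\<integral>y. 1 / I * \<bar>f y\<bar> powr p \<partial>\<mu>)"
        using s by (intro Bochner_Integration.integral_cong refl) (simp add: g_def abs_mult powr_mult powr_divide)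
      also have "\<dots> = 1" using I0 by (simp add: I_def)
      finally have "(\<integral>\<^sup>+z. ennreal (T g z powr q) \<partial>\<nu>) \<le> ennreal M" using M(2) g by simp
      have "(\<integral>\<^sup>+z. ennreal (\<bar>T f z\<bar> powr q) \<partial>\<nu>) \<le> (\<integral>\<^sup>+z. ennreal (s powr q) * ennreal (T g z powr q) \<partial>\<nu>)"
      proof (intro nn_integral_mono)
        fix z assume "z \<in> space \<nu>"
        then have z: "z \<in> upper_half" by (simp add: space_nu)
        have "\<bar>T f z\<bar> \<le> s * T g z"
          using abs_extension_le[OF f z] s(1) unfolding g_def extension_scale by simp
        then have "\<bar>T f z\<bar> powr q \<le> (s * T g z) powr q" using q by (intro powr_mono2) auto
        also have "\<dots> = s powr q * T g z powr q"
          using s(1) extension_nonneg[OF z] g(2) by (simp add: powr_mult)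
        finally show "ennreal (\<bar>T f z\<bar> powr q) \<le> ennreal (s powr q) * ennreal (T g z powr q)"
          by (simp add: ennreal_mult[symmetric] ennreal_leI)
      qed
      also have "\<dots> = ennreal (s powr q) * (\<integral>\<^sup>+z. ennreal (T g z powr q) \<partial>\<nu>)"
      proof (rule nn_integral_cmult)
        have [measurable]: "T g \<in> borel_measurable \<nu>" using g by (intro extension_measurable_nu) (simp add: Lp_space_def)
        show "(\<lambda>z. ennreal (T g z powr q)) \<in> borel_measurable \<nu>" by measurable
      qed
      also have "\<dots> \<le> ennreal (s powr q) * ennreal M" by (intro mult_left_mono) (fact, simp)
      also have "\<dots> = ennreal (M * I powr (q / p))" using M(1) s by (simp add: ennreal_mult mult.commute)
      finally show ?thesis .
    qed
    have int: "integrable \<nu> (\<lambda>z. \<bar>T f z\<bar> powr q)"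
    proof (rule integrableI_bounded)
      have "(\<integral>\<^sup>+z. ennreal (norm (\<bar>T f z\<bar> powr q)) \<partial>\<nu>) \<le> ennreal (M * I powr (q / p))" using nn by simp
      also have "\<dots> < \<infinity>" by simp
      finally show "(\<integral>\<^sup>+z. ennreal (norm (\<bar>T f z\<bar> powr q)) \<partial>\<nu>) < \<infinity>" .
    qed measurable
    have "ennreal (\<integral>z. \<bar>T f z\<bar> powr q \<partial>\<nu>) \<le> ennreal (M * I powr (q / p))"
      using nn by (subst (asm) nn_integral_eq_integral[OF int]) auto
    then have "(\<integral>z. \<bar>T f z\<bar> powr q \<partial>\<nu>) \<le> M * I powr (q / p)" using M(1) by (subst (asm) ennreal_le_iff) auto
    then have "(\<integral>z. \<bar>T f z\<bar> powr q \<partial>\<nu>) powr (1 / q) \<le> (M * I powr (q / p)) powr (1 / q)"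
      using q by (intro powr_mono2) auto
    also have "\<dots> = M powr (1 / q) * I powr (1 / p)" using M(1) q by (simp add: powr_mult powr_powr)
    finally have "Lp_norm q \<nu> (T f) \<le> M powr (1 / q) * Lp_norm p \<mu> f" by (simp add: Lp_norm_def I_def)
    with int show ?thesis by (simp add: Lp_space_def)
  qed
  then show ?thesis unfolding bounded_extension_def by blast
qed

section \<open>Boundedness implies a finite profile integral\<close>

lemma bounded_real:
  assumes "bounded_extension \<mu> \<eta> heat p q \<nu>"
  obtains c where "0 < c" "\<And>f. f \<in> Lp_space p \<mu> \<Longrightarrow> integrable \<nu> (\<lambda>z. \<bar>T f z\<bar> powr q)"
    "\<And>f. f \<in> Lp_space p \<mu> \<Longrightarrow> (\<integral>z. \<bar>T f z\<bar> powr q \<partial>\<nu>) \<le> c * (\<integral>y. \<bar>f y\<bar> powr p \<partial>\<mu>) powr (q / p)"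
proof -
  obtain c where c: "\<forall>f \<in> Lp_space p \<mu>. T f \<in> Lp_space q \<nu> \<and> Lp_norm q \<nu> (T f) \<le> c * Lp_norm p \<mu> f"
    using assms unfolding bounded_extension_def by blast
  define d where "d = max c 1"
  have d: "0 < d" by (simp add: d_def)
  have "(\<integral>z. \<bar>T f z\<bar> powr q \<partial>\<nu>) \<le> d powr q * (\<integral>y. \<bar>f y\<bar> powr p \<partial>\<mu>) powr (q / p)" if f: "f \<in> Lp_space p \<mu>" for f
  proof -
    have nn: "0 \<le> Lp_norm p \<mu> f" by (simp add: Lp_norm_def)
    have "Lp_norm q \<nu> (T f) \<le> c * Lp_norm p \<mu> f" using c f by blast
    also have "\<dots> \<le> d * Lp_norm p \<mu> f" using nn by (intro mult_right_mono) (auto simp: d_def)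
    finally have "Lp_norm q \<nu> (T f) powr q \<le> (d * Lp_norm p \<mu> f) powr q"
      using q by (intro powr_mono2) (auto simp: Lp_norm_def)
    also have "\<dots> = d powr q * (\<integral>y. \<bar>f y\<bar> powr p \<partial>\<mu>) powr (q / p)"
      using d nn by (simp add: powr_mult Lp_norm_def powr_powr)
    finally show ?thesis using q by (simp add: Lp_norm_powr)
  qed
  moreover have "integrable \<nu> (\<lambda>z. \<bar>T f z\<bar> powr q)" if "f \<in> Lp_space p \<mu>" for f
    using c that by (simp add: Lp_space_def)
  ultimately show ?thesis using that[of "d powr q"] d by simp
qed

text \<open>A function admissible for \<open>K\<close> has extension at least \<open>1\<close> on \<open>K\<close>, so its norm controls \<open>\<nu>(K)\<close>.  In
  particular the profile is positive, which makes the weights \<open>(2\<^sup>j / \<kappa>(2\<^sup>j))\<^sup>1\<^sup>/\<^sup>(\<^sup>p\<^sup>-\<^sup>q\<^sup>)\<close> finite.\<close>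

lemma profile_lower:
  assumes c: "0 < c" "\<And>f. f \<in> Lp_space p \<mu> \<Longrightarrow> integrable \<nu> (\<lambda>z. \<bar>T f z\<bar> powr q)"
    "\<And>f. f \<in> Lp_space p \<mu> \<Longrightarrow> (\<integral>z. \<bar>T f z\<bar> powr q \<partial>\<nu>) \<le> c * (\<integral>y. \<bar>f y\<bar> powr p \<partial>\<mu>) powr (q / p)"
    and l: "0 < l"
  shows "ennreal ((l / c) powr (p / q)) \<le> profile l"
  unfolding capacity_profile_def capacity_def
proof (intro INF_greatest)
  fix K f
  assume "K \<in> {K. compact K \<and> K \<subseteq> upper_half \<and> ennreal l \<le> emeasure \<nu> K}"
    and "f \<in> {f \<in> Lp_space p \<mu>. (\<forall>x. 0 \<le> f x) \<and> (\<forall>z\<in>upper_half. indicator K z \<le> T f z)}"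
  then have K: "compact K" "K \<subseteq> upper_half" "ennreal l \<le> emeasure \<nu> K"
    and f: "f \<in> Lp_space p \<mu>" and Tf: "\<forall>z\<in>upper_half. indicator K z \<le> T f z"
    by auto
  have T1: "1 \<le> T f z" if "z \<in> K" for z using bspec[OF Tf, of z] that K(2) by auto
  define I where "I = (\<integral>y. \<bar>f y\<bar> powr p \<partial>\<mu>)"
  have "ennreal l \<le> (\<integral>\<^sup>+z. indicator K z \<partial>\<nu>)"
    using K compact_sets by simp
  also have "\<dots> \<le> (\<integral>\<^sup>+z. ennreal (\<bar>T f z\<bar> powr q) \<partial>\<nu>)"
  proof (intro nn_integral_mono)
    fix z
    have "ennreal 1 \<le> ennreal (\<bar>T f z\<bar> powr q)" if "z \<in> K"
      using T1[OF that] q by (intro ennreal_leI ge_one_powr_ge_zero) auto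
    then show "indicator K z \<le> ennreal (\<bar>T f z\<bar> powr q)" by (auto simp: indicator_def)
  qed
  also have "\<dots> = ennreal (\<integral>z. \<bar>T f z\<bar> powr q \<partial>\<nu>)"
    using c(2)[OF f] by (intro nn_integral_eq_integral) auto
  also have "\<dots> \<le> ennreal (c * I powr (q / p))" unfolding I_def by (intro ennreal_leI c(3) f)
  finally have "l \<le> c * I powr (q / p)" using c(1) by (subst (asm) ennreal_le_iff) auto
  then have "(l / c) powr (p / q) \<le> (I powr (q / p)) powr (p / q)"
    using l c(1) q by (intro powr_mono2) (auto simp: field_simps)
  also have "\<dots> = I" using q by (simp add: powr_powr I_def)
  finally show "ennreal ((l / c) powr (p / q)) \<le> ennreal (Lp_norm p \<mu> f powr p)"
    using p by (simp add: Lp_norm_powr I_def ennreal_leI)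
qed

lemma near_extremal:
  assumes "0 < k" "profile l = ennreal k"
  shows "\<exists>K f. compact K \<and> K \<subseteq> upper_half \<and> ennreal l \<le> emeasure \<nu> K \<and> f \<in> Lp_space p \<mu> \<and> (\<forall>y. 0 \<le> f y) \<and>
    (\<forall>z\<in>K. 1 \<le> T f z) \<and> (\<integral>y. \<bar>f y\<bar> powr p \<partial>\<mu>) \<le> 2 * k"
proof -
  have "profile l < ennreal (2 * k)" using assms by (simp add: ennreal_less_iff)
  then obtain K where K: "compact K" "K \<subseteq> upper_half" "ennreal l \<le> emeasure \<nu> K" "cap K < ennreal (2 * k)"
    unfolding capacity_profile_def INF_less_iff by auto
  then obtain f where f: "f \<in> Lp_space p \<mu>" "\<forall>x. 0 \<le> f x" "\<forall>z\<in>upper_half. indicator K z \<le> T f z"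
    "ennreal (Lp_norm p \<mu> f powr p) < ennreal (2 * k)"
    unfolding capacity_def INF_less_iff by auto
  have "1 \<le> T f z" if "z \<in> K" for z using f(3) K(2) that by (force simp: indicator_def)
  moreover have "(\<integral>y. \<bar>f y\<bar> powr p \<partial>\<mu>) \<le> 2 * k"
    using f(4) p by (simp add: Lp_norm_powr ennreal_less_iff)
  ultimately show ?thesis using K f by blast
qed

text \<open>The \<open>\<ell>\<^sup>p\<close> combination of the functions \<open>w\<^sub>j F\<^sub>j\<close> dominates each of them, and its \<open>p\<close>-th power
  integrates to the sum of theirs.\<close>

lemma power_mean_dominates:
  fixes J :: "'i set" and w :: "'i \<Rightarrow> real" and F :: "'i \<Rightarrow> 'a \<Rightarrow> real"
  assumes J: "finite J" and F: "\<And>j. j \<in> J \<Longrightarrow> F j \<in> Lp_space p \<mu>" "\<And>j y. j \<in> J \<Longrightarrow> 0 \<le> F j y"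
    and w: "\<And>j. j \<in> J \<Longrightarrow> 0 \<le> w j"
  obtains g where "g \<in> Lp_space p \<mu>" "\<And>j y. j \<in> J \<Longrightarrow> w j * F j y \<le> g y"
    "(\<integral>y. \<bar>g y\<bar> powr p \<partial>\<mu>) = (\<Sum>j\<in>J. w j powr p * (\<integral>y. \<bar>F j y\<bar> powr p \<partial>\<mu>))"
proof -
  define g where "g y = (\<Sum>j\<in>J. w j powr p * \<bar>F j y\<bar> powr p) powr (1 / p)" for y
  have gp: "\<bar>g y\<bar> powr p = (\<Sum>j\<in>J. w j powr p * \<bar>F j y\<bar> powr p)" for y
    using p by (simp add: g_def powr_powr sum_nonneg)
  have int: "integrable \<mu> (\<lambda>y. w j powr p * \<bar>F j y\<bar> powr p)" if "j \<in> J" for j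
    using F(1)[OF that] by (simp add: Lp_space_def)
  have sum_meas: "(\<lambda>y. \<Sum>j\<in>J. w j powr p * \<bar>F j y\<bar> powr p) \<in> borel_measurable \<mu>"
    by (intro borel_measurable_sum borel_measurable_integrable[OF int])
  have "(\<lambda>y. h y powr (1 / p)) \<in> borel_measurable \<mu>" if [measurable]: "h \<in> borel_measurable \<mu>" for h :: "'a \<Rightarrow> real"
    by measurable
  from this[OF sum_meas] have "g \<in> borel_measurable \<mu>" by (simp only: g_def[abs_def])
  then have "g \<in> Lp_space p \<mu>" unfolding Lp_space_def using int by (simp add: gp)
  moreover have "w j * F j y \<le> g y" if "j \<in> J" for j y
  proof -
    have "w j * F j y = (w j powr p * \<bar>F j y\<bar> powr p) powr (1 / p)"
      using w[OF that] F(2)[OF that] p by (simp add: powr_mult[symmetric] powr_powr)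
    also have "\<dots> \<le> g y" unfolding g_def using J that p by (intro powr_mono2 member_le_sum) auto
    finally show ?thesis .
  qed
  moreover have "(\<integral>y. \<bar>g y\<bar> powr p \<partial>\<mu>) = (\<Sum>j\<in>J. w j powr p * (\<integral>y. \<bar>F j y\<bar> powr p \<partial>\<mu>))"
    unfolding gp using int F(1) by (simp add: Lp_space_def)
  ultimately show ?thesis using that by blast
qed

text \<open>Since \<open>q / p < 1\<close>, the power of \<open>S\<close> on the right can be absorbed.\<close>

lemma self_improve:
  fixes S D :: real
  assumes "0 \<le> S" "0 \<le> D" "S \<le> D * S powr (q / p)"
  shows "S \<le> D powr (1 / (1 - q / p))"
proof (cases "S = 0")
  case False
  then have S: "0 < S" using assms by simp
  define e where "e = 1 - q / p"
  have e: "0 < e" using q by (simp add: e_def field_simps)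
  have "S powr e \<le> D" using assms(3) S by (simp add: e_def powr_diff field_simps)
  then have "(S powr e) powr (1 / e) \<le> D powr (1 / e)"
    using e by (intro powr_mono2) auto
  also have "(S powr e) powr (1 / e) = S" using S e by (simp add: powr_powr)
  finally show ?thesis by (simp add: e_def)
qed simp

text \<open>The weights are chosen so that \<open>2\<^sup>j w\<^sub>j\<^sup>q = w\<^sub>j\<^sup>p \<kappa>(2\<^sup>j)\<close>; call this number \<open>s\<^sub>j\<close> and its sum \<open>S\<close>.  The
  combination \<open>g\<close> of the nearly optimal functions satisfies \<open>\<parallel>g\<parallel>\<^sub>p\<^sup>p \<le> 2 S\<close>, and \<open>T g \<ge> w\<^sub>j\<close> on a set of
  measure at least \<open>2\<^sup>j\<close>, so \<open>S \<le> 2 \<parallel>T g\<parallel>\<^sub>q\<^sup>q\<close>.  Levels of infinite profile contribute nothing to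
  the integral and are left out.\<close>

lemma dyadic_profile_sums:
  assumes bd: "bounded_extension \<mu> \<eta> heat p q \<nu>"
  obtains E where "0 \<le> E" "\<And>l. 0 < l \<Longrightarrow> 0 < profile l"
    "\<And>J. finite J \<Longrightarrow> (\<And>j. j \<in> J \<Longrightarrow> profile (2 powr real_of_int j) < \<infinity>) \<Longrightarrow>
      (\<Sum>j\<in>J. 2 powr (real_of_int j * (\<theta> + 1)) * enn2real (profile (2 powr real_of_int j)) powr (- \<theta>)) \<le> E"
proof -
  obtain c where c: "0 < c" "\<And>f. f \<in> Lp_space p \<mu> \<Longrightarrow> integrable \<nu> (\<lambda>z. \<bar>T f z\<bar> powr q)"
    "\<And>f. f \<in> Lp_space p \<mu> \<Longrightarrow> (\<integral>z. \<bar>T f z\<bar> powr q \<partial>\<nu>) \<le> c * (\<integral>y. \<bar>f y\<bar> powr p \<partial>\<mu>) powr (q / p)"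
    using bounded_real[OF bd] by blast
  have pos: "0 < profile l" if "0 < l" for l
    by (rule less_le_trans[OF _ profile_lower[OF c that]]) (use that c(1) in simp)
  define D where "D = 2 * c * 2 powr (q / p)"
  have D: "0 \<le> D" using c(1) by (simp add: D_def)
  have "(\<Sum>j\<in>J. 2 powr (real_of_int j * (\<theta> + 1)) * enn2real (profile (2 powr real_of_int j)) powr (- \<theta>)) \<le> D powr (1 / (1 - q / p))"
    if J: "finite J" and finJ: "\<And>j. j \<in> J \<Longrightarrow> profile (2 powr real_of_int j) < \<infinity>" for J
  proof -
    define k where "k j = enn2real (profile (2 powr real_of_int j))" for j
    have k: "profile (2 powr real_of_int j) = ennreal (k j)" "0 < k j" if "j \<in> J" for j
      using finJ[OF that] pos[of "2 powr real_of_int j"] by (auto simp: k_def enn2real_positive_iff)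
    define s where "s j = 2 powr (real_of_int j * (\<theta> + 1)) * k j powr (- \<theta>)" for j
    define S where "S = (\<Sum>j\<in>J. s j)"
    \<comment> \<open>The weights balance \<open>2\<^sup>j w\<^sup>q\<close>, a lower bound for the target norm, against \<open>w\<^sup>p \<kappa>(2\<^sup>j)\<close>, the cost.\<close>
    define w where "w j = (2 powr real_of_int j / k j) powr (1 / (p - q))" for j
    have w1: "2 powr real_of_int j * w j powr q = s j" if "j \<in> J" for j
    proof -
      have d: "2 powr (real_of_int j * (\<theta> + 1)) = 2 powr (real_of_int j * \<theta>) * 2 powr real_of_int j"
        by (simp add: distrib_left powr_add)
      have "w j powr q = (2 powr real_of_int j / k j) powr \<theta>"
        unfolding w_def powr_powr exponents(2) ..
      also have "\<dots> = 2 powr (real_of_int j * \<theta>) * k j powr (- \<theta>)"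
        using k(2)[OF that] by (simp add: powr_divide powr_minus_divide powr_powr)
      finally show ?thesis unfolding s_def d by (simp only: ac_simps)
    qed
    have w2: "w j powr p * k j = s j" if "j \<in> J" for j
    proof -
      have kj: "0 < k j" by (rule k(2)[OF that])
      have "w j powr p = (2 powr real_of_int j / k j) powr (\<theta> + 1)"
        unfolding w_def powr_powr exponents(3) ..
      also have "\<dots> = 2 powr (real_of_int j * (\<theta> + 1)) * (k j powr (- \<theta>) / k j)"
      proof -
        have "k j powr (\<theta> + 1) = k j powr \<theta> * k j" using kj by (simp add: powr_add)
        then show ?thesis using kj by (simp add: powr_divide powr_powr powr_minus_divide)
      qed
      finally show ?thesis unfolding s_def using kj by simp
    qed
    have "\<forall>j\<in>J. \<exists>K f. compact K \<and> K \<subseteq> upper_half \<and> ennreal (2 powr real_of_int j) \<le> emeasure \<nu> K \<and> f \<in> Lp_space p \<mu> \<and> (\<forall>y. 0 \<le> f y) \<and>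
      (\<forall>z\<in>K. 1 \<le> T f z) \<and> (\<integral>y. \<bar>f y\<bar> powr p \<partial>\<mu>) \<le> 2 * k j"
      using near_extremal k by blast
    then obtain K f where Kf: "\<And>j. j \<in> J \<Longrightarrow> compact (K j) \<and> K j \<subseteq> upper_half \<and> ennreal (2 powr real_of_int j) \<le> emeasure \<nu> (K j)
        \<and> f j \<in> Lp_space p \<mu> \<and> (\<forall>y. 0 \<le> f j y) \<and> (\<forall>z\<in>K j. 1 \<le> T (f j) z) \<and> (\<integral>y. \<bar>f j y\<bar> powr p \<partial>\<mu>) \<le> 2 * k j"
      by metis
    obtain g where g: "g \<in> Lp_space p \<mu>" "\<And>j y. j \<in> J \<Longrightarrow> w j * f j y \<le> g y"
      "(\<integral>y. \<bar>g y\<bar> powr p \<partial>\<mu>) = (\<Sum>j\<in>J. w j powr p * (\<integral>y. \<bar>f j y\<bar> powr p \<partial>\<mu>))"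
      using power_mean_dominates[OF J, of f w] Kf by (auto simp: w_def)
    have "(\<integral>y. \<bar>g y\<bar> powr p \<partial>\<mu>) \<le> (\<Sum>j\<in>J. w j powr p * (2 * k j))"
      unfolding g(3) using Kf by (intro sum_mono mult_left_mono) (blast, simp)
    also have "\<dots> = 2 * S" using w2 by (simp add: S_def sum_distrib_left mult.left_commute)
    finally have gS: "(\<integral>y. \<bar>g y\<bar> powr p \<partial>\<mu>) \<le> 2 * S" .
    have S0: "0 \<le> S" unfolding S_def s_def by (intro sum_nonneg) auto
    have gm[measurable]: "T g \<in> borel_measurable \<nu>" using g(1) by (intro extension_measurable_nu) (simp add: Lp_space_def)
    have gq: "(\<lambda>z. \<bar>T g z\<bar> powr q) \<in> borel_measurable \<nu>" by measurable
    have "ennreal S = ennreal (\<Sum>j\<in>J. 2 powr j * w j powr q)" unfolding S_def using w1 by simp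
    also have "\<dots> \<le> 2 * (\<integral>\<^sup>+z. ennreal (\<bar>T g z\<bar> powr q) \<partial>\<nu>)"
    proof (rule dyadic_levels_le_nn_integral[OF J])
      fix j assume j: "j \<in> J"
      have sub: "K j \<subseteq> {z \<in> space \<nu>. w j powr q \<le> \<bar>T g z\<bar> powr q}"
      proof
        fix z assume z: "z \<in> K j"
        then have zu: "z \<in> upper_half" using Kf[OF j] by blast
        have "w j * 1 \<le> w j * T (f j) z" using Kf[OF j] z by (intro mult_left_mono) (auto simp: w_def)
        also have "\<dots> = T (\<lambda>y. w j * f j y) z" by (rule extension_scale[symmetric])
        also have "\<dots> \<le> T g z" using Kf[OF j] g j zu by (intro extension_mono Lp_space_scale) auto
        finally have "w j powr q \<le> \<bar>T g z\<bar> powr q" using q by (intro powr_mono2) (auto simp: w_def)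
        then show "z \<in> {z \<in> space \<nu>. w j powr q \<le> \<bar>T g z\<bar> powr q}" using zu by (simp add: space_nu)
      qed
      have "ennreal (2 powr j) \<le> emeasure \<nu> (K j)" using Kf[OF j] by blast
      also have "\<dots> \<le> emeasure \<nu> {z \<in> space \<nu>. w j powr q \<le> \<bar>T g z\<bar> powr q}"
        by (intro emeasure_mono sub) measurable
      finally show "ennreal (2 powr j) \<le> emeasure \<nu> {z \<in> space \<nu>. w j powr q \<le> \<bar>T g z\<bar> powr q}" .
    qed (use gq in auto)
    also have "(\<integral>\<^sup>+z. ennreal (\<bar>T g z\<bar> powr q) \<partial>\<nu>) = ennreal (\<integral>z. \<bar>T g z\<bar> powr q \<partial>\<nu>)"
      using c(2)[OF g(1)] by (intro nn_integral_eq_integral) auto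
    also have "2 * \<dots> = ennreal (2 * (\<integral>z. \<bar>T g z\<bar> powr q \<partial>\<nu>))"
      by (simp add: ennreal_mult)
    finally have "S \<le> 2 * (\<integral>z. \<bar>T g z\<bar> powr q \<partial>\<nu>)" by (subst (asm) ennreal_le_iff) auto
    also have "\<dots> \<le> 2 * (c * (\<integral>y. \<bar>g y\<bar> powr p \<partial>\<mu>) powr (q / p))"
      using c(3)[OF g(1)] by simp
    also have "\<dots> \<le> 2 * (c * (2 * S) powr (q / p))"
      using gS c(1) q by (intro mult_left_mono powr_mono2) auto
    also have "\<dots> = D * S powr (q / p)" using S0 by (simp add: D_def powr_mult)
    finally have "S \<le> D powr (1 / (1 - q / p))" by (intro self_improve S0 D)
    then show ?thesis by (simp add: S_def s_def k_def)
  qed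
  then show ?thesis using that[of "D powr (1 / (1 - q / p))"] pos by simp
qed

text \<open>On the dyadic interval starting at \<open>2\<^sup>j\<close>, monotonicity of the profile bounds the integrand by its
  dyadic value; the interval has length \<open>2\<^sup>j\<close>, which cancels the density \<open>1 / l\<close>.\<close>

lemma integral_finite_if_bounded:
  assumes bd: "bounded_extension \<mu> \<eta> heat p q \<nu>"
  shows "(\<integral>\<^sup>+l\<in>{0<..}. profile_integrand l \<partial>lborel) < \<infinity>"
proof -
  obtain E where E: "0 \<le> E" "\<And>l. 0 < l \<Longrightarrow> 0 < profile l"
    "\<And>J. finite J \<Longrightarrow> (\<And>j. j \<in> J \<Longrightarrow> profile (2 powr real_of_int j) < \<infinity>) \<Longrightarrow>
      (\<Sum>j\<in>J. 2 powr (real_of_int j * (\<theta> + 1)) * enn2real (profile (2 powr real_of_int j)) powr (- \<theta>)) \<le> E"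
    using dyadic_profile_sums[OF bd] by blast
  define s where "s j = (if profile (2 powr real_of_int j) < \<infinity>
     then 2 powr (real_of_int j * (\<theta> + 1)) * enn2real (profile (2 powr real_of_int j)) powr (- \<theta>) else 0)" for j :: int
  have s0: "0 \<le> s j" for j by (simp add: s_def)
  define I where "I j = {2 powr real_of_int j..<2 powr (real_of_int j + 1)}" for j :: int
  have le: "profile_integrand l \<le> ennreal (2 powr (\<theta> + 1) * s j * 2 powr - real_of_int j)" if l: "l \<in> I j" for l and j :: int
  proof -
    have l0: "0 < l" "2 powr real_of_int j \<le> l" "l \<le> 2 powr (real_of_int j + 1)"
      using l by (auto simp: I_def intro: less_le_trans[of 0 "2 powr real_of_int j"])
    have "profile_integrand l \<le> ennreal_powr (ennreal ((2 powr (real_of_int j + 1)) powr (p / q)) / profile (2 powr real_of_int j)) \<theta> * ennreal (2 powr - real_of_int j)"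
      unfolding profile_integrand_def
    proof (intro mult_mono ennreal_powr_mono theta_pos)
      have "ennreal (l powr (p / q)) / profile l \<le> ennreal ((2 powr (real_of_int j + 1)) powr (p / q)) / profile l"
        using l0 q by (intro divide_right_mono_ennreal ennreal_leI powr_mono2) auto
      also have "\<dots> \<le> ennreal ((2 powr (real_of_int j + 1)) powr (p / q)) / profile (2 powr real_of_int j)"
        by (intro ennreal_divide_left_mono profile_mono l0)
      finally show "ennreal (l powr (p / q)) / profile l \<le> \<dots>" .
      show "ennreal (1 / l) \<le> ennreal (2 powr - real_of_int j)"
        using l0 by (intro ennreal_leI) (simp add: powr_minus_divide field_simps)
    qed auto
    also have "\<dots> = ennreal (2 powr (\<theta> + 1) * s j * 2 powr - real_of_int j)"
    proof (cases "profile (2 powr real_of_int j) < \<infinity>")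
      case False
      then have "profile (2 powr real_of_int j) = \<infinity>" by (simp add: not_less top_unique)
      then show ?thesis by (simp add: s_def ennreal_powr_def)
    next
      case True
      define k where "k = enn2real (profile (2 powr real_of_int j))"
      have k: "profile (2 powr real_of_int j) = ennreal k" "0 < k"
        using True E(2)[of "2 powr real_of_int j"] by (auto simp: k_def enn2real_positive_iff)
      have "((2 powr (real_of_int j + 1)) powr (p / q) / k) powr \<theta> = (2 powr (real_of_int j + 1)) powr (p / q * \<theta>) * k powr (- \<theta>)"
        using k(2) by (simp add: powr_divide powr_powr powr_minus_divide mult.assoc)
      also have "\<dots> = 2 powr (\<theta> + 1) * s j"
        using True unfolding exponents(1)
        by (simp add: s_def k_def powr_powr powr_add[symmetric] distrib_right add.commute)
      finally have e: "((2 powr (real_of_int j + 1)) powr (p / q) / k) powr \<theta> = 2 powr (\<theta> + 1) * s j" .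
      show ?thesis using k s0[of j] unfolding k(1)
        by (simp add: divide_ennreal ennreal_powr_ennreal e ennreal_mult[symmetric])
    qed
    finally show ?thesis .
  qed
  have "(\<integral>\<^sup>+l\<in>{0<..}. profile_integrand l \<partial>lborel)
    \<le> (\<integral>\<^sup>+l. \<integral>\<^sup>+j. ennreal (2 powr (\<theta> + 1) * s j * 2 powr - real_of_int j) * indicator (I j) l \<partial>count_space UNIV \<partial>lborel)"
  proof (intro nn_integral_mono)
    fix l :: real
    show "profile_integrand l * indicator {0<..} l
      \<le> (\<integral>\<^sup>+j. ennreal (2 powr (\<theta> + 1) * s j * 2 powr - real_of_int j) * indicator (I j) l \<partial>count_space UNIV)"
    proof (cases "0 < l")
      case True
      define i where "i = \<lfloor>log 2 l\<rfloor>"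
      have i: "real_of_int i \<le> log 2 l" "log 2 l < real_of_int i + 1" by (auto simp: i_def)
      have Ii: "l \<in> I i" using i True by (simp add: I_def le_log_iff log_less_iff)
      have "profile_integrand l * indicator {0<..} l \<le> ennreal (2 powr (\<theta> + 1) * s i * 2 powr - real_of_int i) * indicator (I i) l"
        using le[OF Ii] True Ii by simp
      also have "\<dots> = (\<integral>\<^sup>+j. ennreal (2 powr (\<theta> + 1) * s j * 2 powr - real_of_int j) * indicator (I j) l * indicator {i} j \<partial>count_space UNIV)"
        by (subst nn_integral_indicator_singleton) auto
      also have "\<dots> \<le> (\<integral>\<^sup>+j. ennreal (2 powr (\<theta> + 1) * s j * 2 powr - real_of_int j) * indicator (I j) l \<partial>count_space UNIV)"
        by (intro nn_integral_mono) (auto simp: indicator_def)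
      finally show ?thesis .
    qed simp
  qed
  also have "\<dots> = (\<integral>\<^sup>+j. \<integral>\<^sup>+l. ennreal (2 powr (\<theta> + 1) * s j * 2 powr - real_of_int j) * indicator (I j) l \<partial>lborel \<partial>count_space UNIV)"
    by (intro nn_integral_count_space_nn_integral) (auto simp: I_def)
  also have "\<dots> = (\<integral>\<^sup>+j. ennreal (2 powr (\<theta> + 1) * s j) \<partial>count_space UNIV)"
  proof (intro nn_integral_cong)
    fix j :: int
    have "(\<integral>\<^sup>+l. ennreal (2 powr (\<theta> + 1) * s j * 2 powr - real_of_int j) * indicator (I j) l \<partial>lborel)
      = ennreal (2 powr (\<theta> + 1) * s j * 2 powr - real_of_int j) * emeasure lborel (I j)"
      by (intro nn_integral_cmult_indicator) (simp add: I_def)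
    also have "emeasure lborel (I j) = ennreal (2 powr real_of_int j)"
      unfolding I_def by (subst emeasure_lborel_Ico) (auto simp: powr_add)
    also have "ennreal (2 powr (\<theta> + 1) * s j * 2 powr - real_of_int j) * ennreal (2 powr real_of_int j)
      = ennreal (2 powr (\<theta> + 1) * s j)"
      using s0[of j] by (simp add: ennreal_mult[symmetric] powr_minus)
    finally show "(\<integral>\<^sup>+l. ennreal (2 powr (\<theta> + 1) * s j * 2 powr - real_of_int j) * indicator (I j) l \<partial>lborel)
      = ennreal (2 powr (\<theta> + 1) * s j)" .
  qed
  also have "\<dots> \<le> ennreal (2 powr (\<theta> + 1) * E)"
  proof (rule nn_integral_count_space_int_le)
    fix J :: "int set" assume J: "finite J"
    have "(\<Sum>j\<in>J. s j) = (\<Sum>j\<in>{j\<in>J. profile (2 powr real_of_int j) < \<infinity>}.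
        2 powr (real_of_int j * (\<theta> + 1)) * enn2real (profile (2 powr real_of_int j)) powr (- \<theta>))"
      unfolding s_def by (rule sum.inter_filter[symmetric, OF J])
    also have "\<dots> \<le> E" using J by (intro E(3)) auto
    finally have "2 powr (\<theta> + 1) * (\<Sum>j\<in>J. s j) \<le> 2 powr (\<theta> + 1) * E" by (intro mult_left_mono) auto
    then show "(\<Sum>j\<in>J. ennreal (2 powr (\<theta> + 1) * s j)) \<le> ennreal (2 powr (\<theta> + 1) * E)"
      using s0 by (subst sum_ennreal) (auto simp: sum_distrib_left[symmetric] ennreal_leI)
  qed
  finally show ?thesis by (rule le_less_trans) simp
qed

lemma bounded_iff_profile_integral:
  "bounded_extension \<mu> \<eta> heat p q \<nu> \<longleftrightarrow> (\<integral>\<^sup>+l\<in>{0<..}. profile_integrand l \<partial>lborel) < \<infinity>"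
  using integral_finite_if_bounded bounded_if_integral_finite by blast

end

section \<open>The equivalence\<close>

theorem theorem5p4:
  fixes \<mu> :: "'a::{metric_space,second_countable_topology} measure"
    and heat :: "real \<Rightarrow> 'a \<Rightarrow> 'a \<Rightarrow> real"
    and \<eta> :: "real \<Rightarrow> real \<Rightarrow> real"
    and \<nu> :: "(real \<times> 'a) measure"
    and \<alpha> \<beta> C p q :: real
  assumes "locally compact (UNIV :: 'a set)"
    and "sets \<mu> = sets borel"
    and "0 < \<beta>" and "ennreal \<beta> \<le> hausdorff_dim (UNIV :: 'a set)"
    and "heat_kernel \<mu> heat"
    and "0 < \<alpha>" and "\<alpha> < 1"
    and "subordination_density \<alpha> \<eta>"
    and "0 < C" and "gaussian_bounds \<mu> C heat"
    and "(SUP (x, r) \<in> UNIV \<times> {0<..}. emeasure \<mu> (ball x r) / ennreal (r powr \<beta>)) < \<infinity>"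
    and "1 < q" and "q < p"
    and "radon_measure_on upper_half \<nu>"
  shows "bounded_extension \<mu> \<eta> heat p q \<nu> \<longleftrightarrow>
    (\<integral>\<^sup>+l\<in>{0<..}. ennreal_powr (ennreal (l powr (p / q)) / capacity_profile \<mu> \<eta> heat p \<nu> l)
        (q / (p - q)) * ennreal (1 / l) \<partial>lborel) < \<infinity>"
proof -
  have ball_finite: "emeasure \<mu> (ball x r) < \<infinity>" if r: "0 < r" for x r
  proof -
    have "emeasure \<mu> (ball x r) / ennreal (r powr \<beta>)
        \<le> (SUP (x, r) \<in> UNIV \<times> {0<..}. emeasure \<mu> (ball x r) / ennreal (r powr \<beta>))"
      using r by (intro SUP_upper2[of "(x, r)"]) auto
    then have "emeasure \<mu> (ball x r) / ennreal (r powr \<beta>) < \<infinity>" using assms(11) by (rule le_less_trans)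
    then show ?thesis by (cases "emeasure \<mu> (ball x r)") (auto simp: ennreal_top_divide)
  qed
  obtain c1 c2 where c: "0 < c1" "0 < c2"
    and gauss: "\<And>x y s. 0 < s \<Longrightarrow>
      ennreal c1 * (ennreal (exp (- C * (dist x y)\<^sup>2 / s)) / emeasure \<mu> (ball x (sqrt s))) \<le> ennreal (heat s x y)
      \<and> ennreal (heat s x y) \<le> ennreal c2 * (ennreal (exp (- C * (dist x y)\<^sup>2 / s)) / emeasure \<mu> (ball x (sqrt s)))"
    using assms(10) unfolding gaussian_bounds_def by blast
  interpret gaussian_heat_kernel \<mu> heat C c1 c2
    using assms c gauss ball_finite by unfold_locales auto
  obtain A where "doubling_space \<mu> A" using doubling_space_exists by blast
  then interpret doubling_space \<mu> A .
  interpret subordinated_kernel \<mu> heat C c1 c2 A \<alpha> \<eta>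
    using assms by unfold_locales auto
  obtain c0 c3 where "averaging_kernel \<mu> A (\<lambda>t. t powr (1 / (2 * \<alpha>))) (frac_kernel \<eta> heat) c0 c3"
    using averaging_kernel_exists by blast
  then interpret averaging_kernel \<mu> A "\<lambda>t. t powr (1 / (2 * \<alpha>))" "frac_kernel \<eta> heat" c0 c3 .
  interpret extension_traces \<mu> A "\<lambda>t. t powr (1 / (2 * \<alpha>))" \<eta> heat c0 c3 p \<nu> q
    using assms by unfold_locales auto
  show ?thesis
    using bounded_iff_profile_integral by (simp add: profile_integrand_def \<theta>_def)
qed

end
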